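(* Let $A$ be an ordered abelian group. Then $K^{df}_{\mathbb{Q}}(\Gamma_A^{\mathrm{bdd}})$ is generated as a $\mathbb{Q}$-algebra by the elements $e(a),\iota(a)$, $a\in\mathbb{Q}\otimes A$.
   Context: $A$ is a base of parameters for the theory DOAG of (nontrivial) divisible ordered abelian groups; $\Gamma$ denotes a sufficiently saturated model of DOAG containing $A$. An object of $\Gamma_A[n]$ is a subset of $\Gamma^n$ defined by (a Boolean combination of) linear equalities and inequalities with $\mathbb{Z}$-coefficients and parameters in $A$. A morphism $X\to Y$ in $\Gamma_A[n]$ is a bijection $f$ for which there are a finite definable partition $X=\bigcup X_i$, $M_i\in GL_n(\mathbb{Z})$ and $a_i\in A^n$ with $f(x)=M_ix+a_i$ for $x\in X_i$. $\Gamma_A^{\mathrm{bdd}}[n]$ is the full subcategory of objects contained in $[-\gamma,\gamma]^n$ for some $\gamma\in\Gamma$. $K_+(\Gamma_A^{\mathrm{bdd}})=\bigoplus_nK_+(\Gamma_A^{\mathrm{bdd}})[n]$ is the graded Grothendieck semiring: degree $n$ is the semigroup generated by objects $[X]_n$ of $\Gamma_A^{\mathrm{bdd}}[n]$ subject to $[X_1]+[X_2]=[Z]$ when $Z=Z_1\sqcup Z_2$ with $Z_i\cong X_i$; the product is induced by Cartesian product. With $[0]_1$ the class of $\{0\}\subset\Gamma$, $K_+^{df}(\Gamma_A^{\mathrm{bdd}})$ is the degree $0$ part of $K_+(\Gamma_A^{\mathrm{bdd}})[[0]_1^{-1}]$, $K^{df}$ is the ring obtained by adding additive inverses, and $K^{df}_{\mathbb{Q}}=\mathbb{Q}\otimes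 K^{df}$. $e(a)=[\{a\}]_1/[0]_1$; $\iota(a)=[[0,a)]_1/[0]_1$ for $a>0$, $\iota(0)=0$, $\iota(a)=-\iota(-a)$ for $a<0$. *)

theory Defs
  imports
    "Jordan_Normal_Form.Matrix"
    "HOL-Algebra.Embedded_Algebras"
    "HOL-Library.Equipollence"
    "HOL-Library.Multiset"
begin

section \<open>Divisible ordered abelian groups\<close>

definition (in ab_group_add) zmul :: "int \<Rightarrow> 'a \<Rightarrow> 'a" where
  "zmul k x = (((+) x) ^^ nat k) 0 - (((+) x) ^^ nat (- k)) 0"

class doag = linordered_ab_group_add +
  assumes divisible: "0 < n \<Longrightarrow> \<exists>y. zmul n y = x"
    and nontrivial: "\<exists>x. x \<noteq> 0"

definition add_subgroup :: "'a::ab_group_add set \<Rightarrow> bool" where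
  "add_subgroup A \<longleftrightarrow>
     0 \<in> A \<and> (\<forall>x\<in>A. \<forall>y\<in>A. x + y \<in> A) \<and> (\<forall>x\<in>A. - x \<in> A)"

text \<open>A model of DOAG is a \<open>\<rat>\<close>-vector space, and for a subgroup \<open>A\<close> the map
  \<open>\<rat> \<otimes> A \<rightarrow> \<Gamma>\<close>, \<open>(1/k) \<otimes> b \<mapsto> b/k\<close>, is injective (an ordered group is torsion-free);
  \<open>div_hull A\<close> is its image.\<close>

definition div_hull :: "'g::doag set \<Rightarrow> 'g set" where
  "div_hull A = {a. \<exists>k>0. zmul k a \<in> A}"


section \<open>The categories of definable sets\<close>

text \<open>\<open>\<Gamma>\<^sup>n\<close> is \<open>carrier_vec n\<close>, where \<open>\<Gamma>\<close> is the type \<open>'g\<close>.\<close>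

definition lin :: "int vec \<Rightarrow> 'g::ab_group_add vec \<Rightarrow> 'g" where
  "lin c x = (\<Sum>j<dim_vec x. zmul (c $ j) (x $ j))"

text \<open>As the parameter set \<open>A\<close> is always a subgroup, a single parameter on the right-hand side
  is the general linear condition over \<open>A\<close>.\<close>

inductive_set definable :: "'g::doag set \<Rightarrow> nat \<Rightarrow> 'g vec set set"
  for A :: "'g set" and n :: nat where
  definable_eq: "c \<in> carrier_vec n \<Longrightarrow> a \<in> A \<Longrightarrow> {x \<in> carrier_vec n. lin c x = a} \<in> definable A n"
| definable_le: "c \<in> carrier_vec n \<Longrightarrow> a \<in> A \<Longrightarrow> {x \<in> carrier_vec n. lin c x \<le> a} \<in> definable A n"
| definable_less: "c \<in> carrier_vec n \<Longrightarrow> a \<in> A \<Longrightarrow> {x \<in> carrier_vec n. lin c x < a} \<in> definable A n"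
| definable_Compl: "X \<in> definable A n \<Longrightarrow> carrier_vec n - X \<in> definable A n"
| definable_Un: "X \<in> definable A n \<Longrightarrow> Y \<in> definable A n \<Longrightarrow> X \<union> Y \<in> definable A n"
| definable_Int: "X \<in> definable A n \<Longrightarrow> Y \<in> definable A n \<Longrightarrow> X \<inter> Y \<in> definable A n"

text \<open>\<open>\<Gamma>\<close> is \<open>\<kappa>\<close>-saturated for \<open>\<kappa> = (|A| + \<aleph>\<^sub>0)\<^sup>+\<close>: every 1-type over fewer than \<open>\<kappa>\<close> parameters is
  realized. By quantifier elimination in DOAG, formulas may be replaced by the definable sets
  above. Parameter sets may be taken to be subgroups, since generating a subgroup does not
  raise the cardinality above \<open>|A| + \<aleph>\<^sub>0\<close>.\<close>

definition sufficiently_saturated :: "'g::doag set \<Rightarrow> bool" where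
  "sufficiently_saturated A \<longleftrightarrow>
     (\<forall>(B :: 'g set) F. add_subgroup B \<and> B \<lesssim> A <+> (UNIV :: nat set) \<and> F \<subseteq> definable B 1 \<and>
        (\<forall>F'\<subseteq>F. finite F' \<longrightarrow> \<Inter>F' \<noteq> {}) \<longrightarrow> \<Inter>F \<noteq> {})"

definition affine_map :: "int mat \<Rightarrow> 'g::ab_group_add vec \<Rightarrow> 'g vec \<Rightarrow> 'g vec" where
  "affine_map M a x = vec (dim_row M) (\<lambda>i. lin (row M i) x) + a"

definition Gamma_mor ::
  "'g::doag set \<Rightarrow> nat \<Rightarrow> 'g vec set \<Rightarrow> 'g vec set \<Rightarrow> ('g vec \<Rightarrow> 'g vec) \<Rightarrow> bool" where
  "Gamma_mor A n X Y f \<longleftrightarrow>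
     X \<in> definable A n \<and> Y \<in> definable A n \<and> bij_betw f X Y \<and>
     (\<exists>P. finite P \<and> P \<subseteq> definable A n \<and> \<Union>P = X \<and> disjoint P \<and>
        (\<forall>Z\<in>P. \<exists>M\<in>carrier_mat n n. \<exists>a\<in>carrier_vec n.
           invertible_mat M \<and> (\<forall>i<n. a $ i \<in> A) \<and> (\<forall>x\<in>Z. f x = affine_map M a x)))"

definition Gamma_iso :: "'g::doag set \<Rightarrow> nat \<Rightarrow> 'g vec set \<Rightarrow> 'g vec set \<Rightarrow> bool" where
  "Gamma_iso A n X Y \<longleftrightarrow>
     (\<exists>f g. Gamma_mor A n X Y f \<and> Gamma_mor A n Y X g \<and>
        (\<forall>x\<in>X. g (f x) = x) \<and> (\<forall>y\<in>Y. f (g y) = y))"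

definition bdd_obj :: "'g::doag set \<Rightarrow> nat \<Rightarrow> 'g vec set set" where
  "bdd_obj A n =
     {X \<in> definable A n. \<exists>\<gamma>. \<forall>x\<in>X. \<forall>i<n. - \<gamma> \<le> x $ i \<and> x $ i \<le> \<gamma>}"


section \<open>Quotients and presentations of semirings\<close>

definition quotient_semiring :: "('a, 'm) ring_scheme \<Rightarrow> ('a \<times> 'a) set \<Rightarrow> 'a set ring" where
  "quotient_semiring R E =
     \<lparr>carrier = carrier R // E,
      mult = (\<lambda>X Y. \<Union>x\<in>X. \<Union>y\<in>Y. E `` {x \<otimes>\<^bsub>R\<^esub> y}),
      one = E `` {\<one>\<^bsub>R\<^esub>},
      zero = E `` {\<zero>\<^bsub>R\<^esub>},
      add = (\<lambda>X Y. \<Union>x\<in>X. \<Union>y\<in>Y. E `` {x \<oplus>\<^bsub>R\<^esub> y})\<rparr>"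

text \<open>Finite formal sums of elements of a monoid \<open>G\<close>, written as multisets, with the biadditive
  extension of the product of \<open>G\<close>.\<close>

definition formal_sums :: "('b, 'm) monoid_scheme \<Rightarrow> 'b multiset ring" where
  "formal_sums G =
     \<lparr>carrier = {u. set_mset u \<subseteq> carrier G},
      mult = (\<lambda>u v. \<Sum>x\<in>#u. {#x \<otimes>\<^bsub>G\<^esub> y. y \<in># v#}),
      one = {#\<one>\<^bsub>G\<^esub>#},
      zero = {#},
      add = (+)\<rparr>"

inductive_set add_congruence ::
  "'b set \<Rightarrow> ('b multiset \<times> 'b multiset) set \<Rightarrow> ('b multiset \<times> 'b multiset) set"
  for G :: "'b set" and S :: "('b multiset \<times> 'b multiset) set" where
  base: "(u, v) \<in> S \<Longrightarrow> (u, v) \<in> add_congruence G S"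
| refl: "set_mset u \<subseteq> G \<Longrightarrow> (u, u) \<in> add_congruence G S"
| sym: "(u, v) \<in> add_congruence G S \<Longrightarrow> (v, u) \<in> add_congruence G S"
| trans: "(u, v) \<in> add_congruence G S \<Longrightarrow> (v, w) \<in> add_congruence G S \<Longrightarrow>
    (u, w) \<in> add_congruence G S"
| plus: "(u, v) \<in> add_congruence G S \<Longrightarrow> set_mset w \<subseteq> G \<Longrightarrow>
    (u + w, v + w) \<in> add_congruence G S"

text \<open>In both uses below the relations \<open>S\<close> are stable under multiplication by generators, so the
  additive congruence they generate is also multiplicative.\<close>

definition presented_semiring ::
  "('b, 'm) monoid_scheme \<Rightarrow> ('b multiset \<times> 'b multiset) set \<Rightarrow> 'b multiset set ring" where
  "presented_semiring G S = quotient_semiring (formal_sums G) (add_congruence (carrier G) S)"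

definition presented_class ::
  "('b, 'm) monoid_scheme \<Rightarrow> ('b multiset \<times> 'b multiset) set \<Rightarrow> 'b multiset \<Rightarrow> 'b multiset set" where
  "presented_class G S u = add_congruence (carrier G) S `` {u}"

text \<open>\<open>R[s\<^sup>-\<^sup>1]\<close> for a commutative semiring \<open>R\<close>; the pair \<open>(x, k)\<close> stands for \<open>x / s\<^sup>k\<close>.\<close>

definition fractions :: "('a, 'm) ring_scheme \<Rightarrow> 'a \<Rightarrow> ('a \<times> nat) ring" where
  "fractions R s =
     \<lparr>carrier = carrier R \<times> UNIV,
      mult = (\<lambda>(x, k) (y, l). (x \<otimes>\<^bsub>R\<^esub> y, k + l)),
      one = (\<one>\<^bsub>R\<^esub>, 0),
      zero = (\<zero>\<^bsub>R\<^esub>, 0),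
      add = (\<lambda>(x, k) (y, l).
        ((x \<otimes>\<^bsub>R\<^esub> (s [^]\<^bsub>R\<^esub> l)) \<oplus>\<^bsub>R\<^esub> (y \<otimes>\<^bsub>R\<^esub> (s [^]\<^bsub>R\<^esub> k)), k + l))\<rparr>"

definition fraction_rel ::
  "('a, 'm) ring_scheme \<Rightarrow> 'a \<Rightarrow> (('a \<times> nat) \<times> ('a \<times> nat)) set" where
  "fraction_rel R s =
     {((x, k), (y, l)) | x k y l. x \<in> carrier R \<and> y \<in> carrier R \<and>
        (\<exists>j::nat. x \<otimes>\<^bsub>R\<^esub> (s [^]\<^bsub>R\<^esub> (j + l)) = y \<otimes>\<^bsub>R\<^esub> (s [^]\<^bsub>R\<^esub> (j + k)))}"

definition localization :: "('a, 'm) ring_scheme \<Rightarrow> 'a \<Rightarrow> ('a \<times> nat) set ring" where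
  "localization R s = quotient_semiring (fractions R s) (fraction_rel R s)"

definition frac :: "('a, 'm) ring_scheme \<Rightarrow> 'a \<Rightarrow> 'a \<Rightarrow> nat \<Rightarrow> ('a \<times> nat) set" where
  "frac R s x k = fraction_rel R s `` {(x, k)}"

text \<open>The ring obtained from a commutative semiring by adding additive inverses; the pair
  \<open>(x, y)\<close> stands for \<open>x - y\<close>.\<close>

definition differences :: "('a, 'm) ring_scheme \<Rightarrow> ('a \<times> 'a) ring" where
  "differences R =
     \<lparr>carrier = carrier R \<times> carrier R,
      mult = (\<lambda>(x, y) (x', y').
        ((x \<otimes>\<^bsub>R\<^esub> x') \<oplus>\<^bsub>R\<^esub> (y \<otimes>\<^bsub>R\<^esub> y'), (x \<otimes>\<^bsub>R\<^esub> y') \<oplus>\<^bsub>R\<^esub> (y \<otimes>\<^bsub>R\<^esub> x'))),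
      one = (\<one>\<^bsub>R\<^esub>, \<zero>\<^bsub>R\<^esub>),
      zero = (\<zero>\<^bsub>R\<^esub>, \<zero>\<^bsub>R\<^esub>),
      add = (\<lambda>(x, y) (x', y'). (x \<oplus>\<^bsub>R\<^esub> x', y \<oplus>\<^bsub>R\<^esub> y'))\<rparr>"

definition difference_rel :: "('a, 'm) ring_scheme \<Rightarrow> (('a \<times> 'a) \<times> ('a \<times> 'a)) set" where
  "difference_rel R =
     {((x, y), (x', y')) | x y x' y'.
        x \<in> carrier R \<and> y \<in> carrier R \<and> x' \<in> carrier R \<and> y' \<in> carrier R \<and>
        (\<exists>z\<in>carrier R. (x \<oplus>\<^bsub>R\<^esub> y') \<oplus>\<^bsub>R\<^esub> z = (x' \<oplus>\<^bsub>R\<^esub> y) \<oplus>\<^bsub>R\<^esub> z)}"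

definition groth_ring :: "('a, 'm) ring_scheme \<Rightarrow> ('a \<times> 'a) set ring" where
  "groth_ring R = quotient_semiring (differences R) (difference_rel R)"

definition groth_of :: "('a, 'm) ring_scheme \<Rightarrow> 'a \<Rightarrow> ('a \<times> 'a) set" where
  "groth_of R x = difference_rel R `` {(x, \<zero>\<^bsub>R\<^esub>)}"

text \<open>\<open>\<rat> \<otimes> R\<close> for a ring \<open>R\<close>: formal sums of symbols \<open>(q, x) = q \<otimes> x\<close> modulo biadditivity. Sums
  with nonnegative multiplicities suffice, because \<open>(- q) \<otimes> x\<close> is the negative of \<open>q \<otimes> x\<close>.\<close>

definition rat_tensors :: "('a, 'm) ring_scheme \<Rightarrow> (rat \<times> 'a) monoid" where
  "rat_tensors R =
     \<lparr>carrier = UNIV \<times> carrier R,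
      mult = (\<lambda>(q, x) (r, y). (q * r, x \<otimes>\<^bsub>R\<^esub> y)),
      one = (1, \<one>\<^bsub>R\<^esub>)\<rparr>"

definition tensor_relations ::
  "('a, 'm) ring_scheme \<Rightarrow> ((rat \<times> 'a) multiset \<times> (rat \<times> 'a) multiset) set" where
  "tensor_relations R =
     {({#(q + r, x)#}, {#(q, x), (r, x)#}) | q r x. x \<in> carrier R} \<union>
     {({#(q, x \<oplus>\<^bsub>R\<^esub> y)#}, {#(q, x), (q, y)#}) | q x y. x \<in> carrier R \<and> y \<in> carrier R} \<union>
     {({#(0, x)#}, {#}) | x. x \<in> carrier R} \<union>
     {({#(q, \<zero>\<^bsub>R\<^esub>)#}, {#}) | q. True}"

definition rat_tensor :: "('a, 'm) ring_scheme \<Rightarrow> (rat \<times> 'a) multiset set ring" where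
  "rat_tensor R = presented_semiring (rat_tensors R) (tensor_relations R)"

definition pure_tensor :: "('a, 'm) ring_scheme \<Rightarrow> rat \<Rightarrow> 'a \<Rightarrow> (rat \<times> 'a) multiset set" where
  "pure_tensor R q x = presented_class (rat_tensors R) (tensor_relations R) {#(q, x)#}"

definition rat_scalars :: "('a, 'm) ring_scheme \<Rightarrow> (rat \<times> 'a) multiset set set" where
  "rat_scalars R = range (\<lambda>q. pure_tensor R q \<one>\<^bsub>R\<^esub>)"

text \<open>The smallest \<open>k\<close>-subalgebra of \<open>R\<close> containing \<open>H\<close>, where \<open>k \<subseteq> R\<close> are the scalars. The
  library's \<open>subalgebra\<close> only asks for a \<open>k\<close>-subspace, so \<open>subring\<close> has to be added.\<close>

definition algebra_generated :: "'a set \<Rightarrow> ('a, 'm) ring_scheme \<Rightarrow> 'a set \<Rightarrow> 'a set" where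
  "algebra_generated k R H = \<Inter>{V. subring V R \<and> subalgebra k V R \<and> H \<subseteq> V}"


section \<open>The Grothendieck rings\<close>

text \<open>Generators of \<open>K\<^sub>+\<close>: the pair \<open>(n, X)\<close> stands for \<open>[X]\<^sub>n\<close>. The degree has to be recorded, because
  the empty set is an object in every degree.\<close>

definition object_monoid :: "'g::doag set \<Rightarrow> (nat \<times> 'g vec set) monoid" where
  "object_monoid A =
     \<lparr>carrier = {(n, X). X \<in> bdd_obj A n},
      mult = (\<lambda>(m, X) (n, Y). (m + n, {x @\<^sub>v y | x y. x \<in> X \<and> y \<in> Y})),
      one = (0, carrier_vec 0)\<rparr>"

text \<open>The first set consists of the relations \<open>[X\<^sub>1] + [X\<^sub>2] = [Z]\<close>. They make \<open>[\<emptyset>]\<^sub>n\<close> the neutral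
  element of the degree \<open>n\<close> part; the second set identifies these neutral elements with the
  zero of the direct sum.\<close>

definition scissor_relations ::
  "'g::doag set \<Rightarrow> ((nat \<times> 'g vec set) multiset \<times> (nat \<times> 'g vec set) multiset) set" where
  "scissor_relations A =
     {({#(n, X1), (n, X2)#}, {#(n, Z)#}) | n X1 X2 Z Z1 Z2.
        X1 \<in> bdd_obj A n \<and> X2 \<in> bdd_obj A n \<and> Z \<in> bdd_obj A n \<and>
        Z1 \<in> bdd_obj A n \<and> Z2 \<in> bdd_obj A n \<and> Z = Z1 \<union> Z2 \<and> Z1 \<inter> Z2 = {} \<and>
        Gamma_iso A n Z1 X1 \<and> Gamma_iso A n Z2 X2} \<union>
     {({#(n, {})#}, {#}) | n. True}"

definition K_plus :: "'g::doag set \<Rightarrow> (nat \<times> 'g vec set) multiset set ring" where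
  "K_plus A = presented_semiring (object_monoid A) (scissor_relations A)"

definition K_class :: "'g::doag set \<Rightarrow> nat \<Rightarrow> 'g vec set \<Rightarrow> (nat \<times> 'g vec set) multiset set" where
  "K_class A n X = presented_class (object_monoid A) (scissor_relations A) {#(n, X)#}"

definition K_plus_degree :: "'g::doag set \<Rightarrow> nat \<Rightarrow> (nat \<times> 'g vec set) multiset set set" where
  "K_plus_degree A n =
     {presented_class (object_monoid A) (scissor_relations A) u | u.
        \<forall>p\<in>#u. fst p = n \<and> snd p \<in> bdd_obj A n}"

definition zero_class :: "'g::doag set \<Rightarrow> (nat \<times> 'g vec set) multiset set" where
  "zero_class A = K_class A 1 {0\<^sub>v 1}"

text \<open>The degree \<open>0\<close> part of \<open>K\<^sub>+[[0]\<^sub>1\<^sup>-\<^sup>1]\<close>: as \<open>[0]\<^sub>1\<close> has degree \<open>1\<close>, it consists of the fractions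
  \<open>x / [0]\<^sub>1\<^sup>n\<close> with \<open>x\<close> homogeneous of degree \<open>n\<close>.\<close>

definition K_plus_df :: "'g::doag set \<Rightarrow> ((nat \<times> 'g vec set) multiset set \<times> nat) set ring" where
  "K_plus_df A = (localization (K_plus A) (zero_class A))
     \<lparr>carrier := {frac (K_plus A) (zero_class A) x n | x n. x \<in> K_plus_degree A n}\<rparr>"

abbreviation K_df where
  "K_df A \<equiv> groth_ring (K_plus_df A)"

abbreviation K_df_rat where
  "K_df_rat A \<equiv> rat_tensor (K_df A)"

text \<open>For an object \<open>X\<close> of degree \<open>1\<close>, the element \<open>[X]\<^sub>1 / [0]\<^sub>1\<close> of \<open>K\<^sup>d\<^sup>f\<close>.\<close>

definition df_class :: "'g::doag set \<Rightarrow> 'g vec set \<Rightarrow>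
    (((nat \<times> 'g vec set) multiset set \<times> nat) set \<times>
     ((nat \<times> 'g vec set) multiset set \<times> nat) set) set" where
  "df_class A X = groth_of (K_plus_df A) (frac (K_plus A) (zero_class A) (K_class A 1 X) 1)"

definition e_df where
  "e_df A a = df_class A {x \<in> carrier_vec 1. x $ 0 = a}"

definition iota_df where
  "iota_df A a =
     (if a > 0 then df_class A {x \<in> carrier_vec 1. 0 \<le> x $ 0 \<and> x $ 0 < a}
      else if a = 0 then \<zero>\<^bsub>K_df A\<^esub>
      else \<ominus>\<^bsub>K_df A\<^esub> df_class A {x \<in> carrier_vec 1. 0 \<le> x $ 0 \<and> x $ 0 < - a})"

definition e_rat where
  "e_rat A a = pure_tensor (K_df A) 1 (e_df A a)"

definition iota_rat where
  "iota_rat A a = pure_tensor (K_df A) 1 (iota_df A a)"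

end

theory Submission
  imports Defs
begin

text \<open>Let \<open>V\<close> be a \<open>\<rat>\<close>-subalgebra containing the generators. The bounded sets whose class lies in \<open>V\<close>
  are stable under disjoint unions and differences and under unimodular maps; a set belongs to them
  if a disjoint union of finitely many unimodular copies of it does (divide by the number of copies), or
  if it is a slice \<open>x\<^sub>n = d\<close> (induction on the dimension); and they contain the boxes
  \<open>0 < x\<^sub>i < b\<^sub>i\<close>. These closure properties reach every bounded definable set.

  Sets inside finitely many rational hyperplanes reduce to slices by Euclid's algorithm. Up to such
  sets, a definable set is a union of cells given by linear inequalities on the first \<open>p\<close> coordinates and
  \<open>0 < x\<^sub>i < f\<^sub>i(x\<^sub>0, \<dots>, x\<^sub>p\<^sub>-\<^sub>1)\<close> for the others; for \<open>p = 0\<close> the cells are boxes, and for \<open>p\<close> the dimension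
  they are arbitrary open polyhedra. In the step from \<open>p\<close> to \<open>p + 1\<close> put \<open>s = x\<^sub>p\<close> and use
  induction on a common denominator \<open>N\<close> of the slopes of the \<open>f\<^sub>i\<close> in \<open>s\<close>. Shears and reflections
  bring the \<open>f\<^sub>i\<close> to the form \<open>a\<^sub>i s + \<phi>\<^sub>i\<close> with \<open>0 \<le> a\<^sub>i < 1\<close>, or \<open>f\<^sub>i = s\<close>. The difference of the
  boxes at the upper and the lower bound of \<open>s\<close> is the union of the sets \<open>Y\<^sub>j\<close> on which the coordinate \<open>j\<close>
  enters the growing box last. Exchanging \<open>x\<^sub>j\<close> and \<open>s\<close> turns \<open>Y\<^sub>j\<close> into a cell with slopes
  \<open>a\<^sub>i / a\<^sub>j\<close>, of denominator \<open>N a\<^sub>j < N\<close> unless \<open>a\<^sub>j = 1\<close>. The remaining \<open>Y\<^sub>j\<close> are copies of the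
  original cell, so that the cell is obtained after division by their number.\<close>

section \<open>Commutative semirings\<close>

text \<open>The elements of GL_n(Z) shear, reflect and permute coordinates but never rescale one, so
  only the integer part of a rational slope can be removed. The fractional parts are the obstacle,
  and the induction on denominators exists for them. Rational coefficients in the algebra come from
  the same source: the triangle 0 < y < x < b is not a product of intervals, but two copies of it
  and a thin diagonal fill the square with side b, so its class is reached by halving. The general
  exchange is a product rule: the box at height s grows at a rate that is a sum over its sides, the
  slope of side j times the product of the other sides, and Y_j is the share of side j. After the
  exchange of x_j and s the slopes a_i / a_j times the integer N a_j give the integers N a_i, which
  is why the denominator drops when a_j < 1. The geometry is carried out for an abstract predicate
  on sets, so that the Grothendieck ring enters only through closure properties of that
  predicate.\<close>

locale commutative_semiring = semiring R + comm_monoid R for R (structure)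

lemma commutative_semiringI:
  fixes R (structure)
  assumes closed: "\<And>x y. x \<in> carrier R \<Longrightarrow> y \<in> carrier R \<Longrightarrow> x \<oplus> y \<in> carrier R"
      "\<And>x y. x \<in> carrier R \<Longrightarrow> y \<in> carrier R \<Longrightarrow> x \<otimes> y \<in> carrier R"
      "\<zero> \<in> carrier R" "\<one> \<in> carrier R"
    and add: "\<And>x y z. x \<in> carrier R \<Longrightarrow> y \<in> carrier R \<Longrightarrow> z \<in> carrier R \<Longrightarrow> (x \<oplus> y) \<oplus> z = x \<oplus> (y \<oplus> z)"
      "\<And>x y. x \<in> carrier R \<Longrightarrow> y \<in> carrier R \<Longrightarrow> x \<oplus> y = y \<oplus> x"
      "\<And>x. x \<in> carrier R \<Longrightarrow> \<zero> \<oplus> x = x"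
    and mult: "\<And>x y z. x \<in> carrier R \<Longrightarrow> y \<in> carrier R \<Longrightarrow> z \<in> carrier R \<Longrightarrow> (x \<otimes> y) \<otimes> z = x \<otimes> (y \<otimes> z)"
      "\<And>x y. x \<in> carrier R \<Longrightarrow> y \<in> carrier R \<Longrightarrow> x \<otimes> y = y \<otimes> x"
      "\<And>x. x \<in> carrier R \<Longrightarrow> \<one> \<otimes> x = x"
    and distr: "\<And>x y z. x \<in> carrier R \<Longrightarrow> y \<in> carrier R \<Longrightarrow> z \<in> carrier R \<Longrightarrow>
        (x \<oplus> y) \<otimes> z = x \<otimes> z \<oplus> y \<otimes> z"
    and null: "\<And>x. x \<in> carrier R \<Longrightarrow> \<zero> \<otimes> x = \<zero>"
  shows "commutative_semiring R"
proof -
  interpret abelian_monoid R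
    by (rule abelian_monoidI) (use closed add in auto)
  interpret comm_monoid R
    by (rule comm_monoidI) (use closed mult in auto)
  show ?thesis
    by unfold_locales (use closed distr null mult(2) in \<open>simp_all add: m_comm\<close>)
qed

text \<open>Serves the degree 0 part of a localization, which keeps the operations of the large
  semiring and only shrinks the carrier.\<close>

lemma (in commutative_semiring) restrict_carrier:
  assumes "H \<subseteq> carrier R" "\<zero> \<in> H" "\<one> \<in> H"
    and "\<And>x y. x \<in> H \<Longrightarrow> y \<in> H \<Longrightarrow> x \<oplus> y \<in> H" "\<And>x y. x \<in> H \<Longrightarrow> y \<in> H \<Longrightarrow> x \<otimes> y \<in> H"
  shows "commutative_semiring (R\<lparr>carrier := H\<rparr>)"
proof -
  have [simp]: "x \<in> H \<Longrightarrow> x \<in> carrier R" for x using assms(1) by auto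
  show ?thesis
    by (rule commutative_semiringI)
      (use assms in \<open>simp_all add: a_ac m_ac l_distr r_distr\<close>)
qed

text \<open>All laws are asked modulo \<open>E\<close>, because the raw structures are not
  semirings: products of formal sums commute only up to the relations, and fractions distribute only
  up to cancelling a common power of the denominator. Compatibility is asked in the left argument
  only; commutativity modulo \<open>E\<close> supplies the right one.\<close>

locale semiring_congruence =
  fixes R :: "('a, 'm) ring_scheme" (structure) and E :: "('a \<times> 'a) set"
  assumes equiv: "equiv (carrier R) E"
    and a_closed: "\<And>x y. x \<in> carrier R \<Longrightarrow> y \<in> carrier R \<Longrightarrow> x \<oplus> y \<in> carrier R"
    and m_closed: "\<And>x y. x \<in> carrier R \<Longrightarrow> y \<in> carrier R \<Longrightarrow> x \<otimes> y \<in> carrier R"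
    and zero_closed: "\<zero> \<in> carrier R" and one_closed: "\<one> \<in> carrier R"
    and a_congruent: "\<And>x x' y. (x, x') \<in> E \<Longrightarrow> y \<in> carrier R \<Longrightarrow> (x \<oplus> y, x' \<oplus> y) \<in> E"
    and m_congruent: "\<And>x x' y. (x, x') \<in> E \<Longrightarrow> y \<in> carrier R \<Longrightarrow> (x \<otimes> y, x' \<otimes> y) \<in> E"
    and a_assoc: "\<And>x y z. x \<in> carrier R \<Longrightarrow> y \<in> carrier R \<Longrightarrow> z \<in> carrier R \<Longrightarrow>
      ((x \<oplus> y) \<oplus> z, x \<oplus> (y \<oplus> z)) \<in> E"
    and a_comm: "\<And>x y. x \<in> carrier R \<Longrightarrow> y \<in> carrier R \<Longrightarrow> (x \<oplus> y, y \<oplus> x) \<in> E"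
    and l_zero: "\<And>x. x \<in> carrier R \<Longrightarrow> (\<zero> \<oplus> x, x) \<in> E"
    and m_assoc: "\<And>x y z. x \<in> carrier R \<Longrightarrow> y \<in> carrier R \<Longrightarrow> z \<in> carrier R \<Longrightarrow>
      ((x \<otimes> y) \<otimes> z, x \<otimes> (y \<otimes> z)) \<in> E"
    and m_comm: "\<And>x y. x \<in> carrier R \<Longrightarrow> y \<in> carrier R \<Longrightarrow> (x \<otimes> y, y \<otimes> x) \<in> E"
    and l_one: "\<And>x. x \<in> carrier R \<Longrightarrow> (\<one> \<otimes> x, x) \<in> E"
    and l_distr: "\<And>x y z. x \<in> carrier R \<Longrightarrow> y \<in> carrier R \<Longrightarrow> z \<in> carrier R \<Longrightarrow>
      ((x \<oplus> y) \<otimes> z, x \<otimes> z \<oplus> y \<otimes> z) \<in> E"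
    and l_null: "\<And>x. x \<in> carrier R \<Longrightarrow> (\<zero> \<otimes> x, \<zero>) \<in> E"
begin

lemma carrierD: "(x, y) \<in> E \<Longrightarrow> x \<in> carrier R" "(x, y) \<in> E \<Longrightarrow> y \<in> carrier R"
  using equiv by (auto simp: equiv_def refl_on_def)

lemma class_eq: "(x, y) \<in> E \<Longrightarrow> E `` {x} = E `` {y}"
  by (rule equiv_class_eq[OF equiv])

text \<open>The second argument is changed by passing it through the first: f x y ~ f a y ~ f y a ~
  f b a ~ f a b. A generic \<open>f\<close> is used, since addition and multiplication need the same
  argument.\<close>

lemma quotient_op:
  assumes closed: "\<And>x y. x \<in> carrier R \<Longrightarrow> y \<in> carrier R \<Longrightarrow> f x y \<in> carrier R"
    and cong: "\<And>x x' y. (x, x') \<in> E \<Longrightarrow> y \<in> carrier R \<Longrightarrow> (f x y, f x' y) \<in> E"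
    and comm: "\<And>x y. x \<in> carrier R \<Longrightarrow> y \<in> carrier R \<Longrightarrow> (f x y, f y x) \<in> E"
    and x: "x \<in> carrier R" and y: "y \<in> carrier R"
  shows "(\<Union>a\<in>E `` {x}. \<Union>b\<in>E `` {y}. E `` {f a b}) = E `` {f x y}"
proof -
  have "E `` {f a b} = E `` {f x y}" if a: "(x, a) \<in> E" and b: "(y, b) \<in> E" for a b
  proof -
    note ab = carrierD[OF a] carrierD[OF b]
    have "E `` {f x y} = E `` {f a y}" using cong[OF a y] by (rule class_eq)
    also have "\<dots> = E `` {f y a}" using comm ab by (intro class_eq) auto
    also have "\<dots> = E `` {f b a}" using cong[OF b ab(2)] by (rule class_eq)
    also have "\<dots> = E `` {f a b}" using comm ab by (intro class_eq) auto
    finally show ?thesis by simp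
  qed
  moreover have "x \<in> E `` {x}" "y \<in> E `` {y}"
    using equiv x y by (auto simp: equiv_def refl_on_def)
  ultimately show ?thesis by blast
qed

lemma add_class:
  assumes "x \<in> carrier R" "y \<in> carrier R"
  shows "E `` {x} \<oplus>\<^bsub>quotient_semiring R E\<^esub> E `` {y} = E `` {x \<oplus> y}"
  using quotient_op[of "add R"] assms a_closed a_congruent a_comm
  by (simp add: quotient_semiring_def)

lemma mult_class:
  assumes "x \<in> carrier R" "y \<in> carrier R"
  shows "E `` {x} \<otimes>\<^bsub>quotient_semiring R E\<^esub> E `` {y} = E `` {x \<otimes> y}"
  using quotient_op[of "mult R"] assms m_closed m_congruent m_comm
  by (simp add: quotient_semiring_def)

lemma zero_quotient: "\<zero>\<^bsub>quotient_semiring R E\<^esub> = E `` {\<zero>}"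
  and one_quotient: "\<one>\<^bsub>quotient_semiring R E\<^esub> = E `` {\<one>}"
  and carrier_quotient: "carrier (quotient_semiring R E) = (\<lambda>x. E `` {x}) ` carrier R"
  by (auto simp: quotient_semiring_def quotient_def)

lemma quotient_commutative_semiring: "commutative_semiring (quotient_semiring R E)"
proof -
  note rules = a_closed m_closed zero_closed one_closed
    a_assoc a_comm l_zero m_assoc m_comm l_one l_distr l_null
  show ?thesis
    by (rule commutative_semiringI)
      (auto simp only: add_class mult_class zero_quotient one_quotient carrier_quotient
        a_closed m_closed zero_closed one_closed intro!: imageI class_eq rules del: equalityI)
qed

end


section \<open>Presented semirings\<close>

lemma carrier_formal_sums [simp]: "carrier (formal_sums G) = {u. set_mset u \<subseteq> carrier G}"
  and add_formal_sums [simp]: "u \<oplus>\<^bsub>formal_sums G\<^esub> v = u + v"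
  and zero_formal_sums [simp]: "\<zero>\<^bsub>formal_sums G\<^esub> = {#}"
  and one_formal_sums [simp]: "\<one>\<^bsub>formal_sums G\<^esub> = {#\<one>\<^bsub>G\<^esub>#}"
  by (simp_all add: formal_sums_def)

lemma mult_formal_sums:
  "u \<otimes>\<^bsub>formal_sums G\<^esub> v = (\<Sum>x\<in>#u. {#x \<otimes>\<^bsub>G\<^esub> y. y \<in># v#})"
  by (simp add: formal_sums_def)

lemma mult_formal_sums_simps [simp]:
  "{#} \<otimes>\<^bsub>formal_sums G\<^esub> v = {#}" "v \<otimes>\<^bsub>formal_sums G\<^esub> {#} = {#}"
  "(u + u') \<otimes>\<^bsub>formal_sums G\<^esub> v = u \<otimes>\<^bsub>formal_sums G\<^esub> v + u' \<otimes>\<^bsub>formal_sums G\<^esub> v"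
  "u \<otimes>\<^bsub>formal_sums G\<^esub> (v + v') = u \<otimes>\<^bsub>formal_sums G\<^esub> v + u \<otimes>\<^bsub>formal_sums G\<^esub> v'"
  "add_mset x u \<otimes>\<^bsub>formal_sums G\<^esub> v = image_mset (mult G x) v + u \<otimes>\<^bsub>formal_sums G\<^esub> v"
  "u \<otimes>\<^bsub>formal_sums G\<^esub> add_mset x v = image_mset (\<lambda>y. y \<otimes>\<^bsub>G\<^esub> x) u + u \<otimes>\<^bsub>formal_sums G\<^esub> v"
  by (simp_all add: mult_formal_sums sum_mset.distrib, induction u, auto)

text \<open>The generators form a monoid that is commutative only modulo the relations, as X x Y and
  Y x X are isomorphic but different sets. Stability of the relations under multiplication by one
  generator is what makes the additive congruence multiplicative.\<close>

locale semiring_presentation = monoid G for G (structure) +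
  fixes S :: "('a multiset \<times> 'a multiset) set"
  assumes relations: "(u, v) \<in> S \<Longrightarrow> set_mset u \<subseteq> carrier G \<and> set_mset v \<subseteq> carrier G"
    and relations_mult: "(u, v) \<in> S \<Longrightarrow> g \<in> carrier G \<Longrightarrow>
      ({#x \<otimes> g. x \<in># u#}, {#x \<otimes> g. x \<in># v#}) \<in> add_congruence (carrier G) S"
    and comm_mod: "x \<in> carrier G \<Longrightarrow> y \<in> carrier G \<Longrightarrow>
      ({#x \<otimes> y#}, {#y \<otimes> x#}) \<in> add_congruence (carrier G) S"
begin

abbreviation "C \<equiv> add_congruence (carrier G) S"
abbreviation "F \<equiv> formal_sums G"

lemma congruence_carrier: "(u, v) \<in> C \<Longrightarrow> set_mset u \<subseteq> carrier G \<and> set_mset v \<subseteq> carrier G"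
  by (induction rule: add_congruence.induct) (use relations in auto)

lemma congruence_equiv: "equiv (carrier F) C"
  by (rule equivI)
    (auto simp: refl_on_def dest: congruence_carrier intro!: symI transI
      intro: add_congruence.intros)

lemma congruence_add:
  assumes "(u, v) \<in> C" "(u', v') \<in> C"
  shows "(u + u', v + v') \<in> C"
proof -
  have "(u + u', v + u') \<in> C"
    using assms congruence_carrier by (intro add_congruence.plus) auto
  moreover have "(u' + v, v' + v) \<in> C"
    using assms congruence_carrier by (intro add_congruence.plus) auto
  ultimately show ?thesis by (metis add.commute add_congruence.trans)
qed

lemma mult_closed:
  "set_mset u \<subseteq> carrier G \<Longrightarrow> set_mset v \<subseteq> carrier G \<Longrightarrow> set_mset (u \<otimes>\<^bsub>F\<^esub> v) \<subseteq> carrier G"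
  by (induction u) auto

lemma relations_mult_sum:
  assumes "(u, v) \<in> S" "set_mset w \<subseteq> carrier G"
  shows "(u \<otimes>\<^bsub>F\<^esub> w, v \<otimes>\<^bsub>F\<^esub> w) \<in> C"
  using assms(2)
proof (induction w)
  case empty
  show ?case by (auto intro: add_congruence.refl)
next
  case (add g w)
  then show ?case using relations_mult[OF assms(1), of g] by (auto intro: congruence_add)
qed

lemma congruence_mult:
  assumes "(u, v) \<in> C" "set_mset w \<subseteq> carrier G"
  shows "(u \<otimes>\<^bsub>F\<^esub> w, v \<otimes>\<^bsub>F\<^esub> w) \<in> C"
  using assms
proof (induction rule: add_congruence.induct)
  case (plus u v u')
  then show ?case by (auto intro!: add_congruence.plus dest: mult_closed)
qed (auto intro: relations_mult_sum add_congruence.intros mult_closed[THEN subsetD] dest: mult_closed)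

text \<open>Two nested inductions, on \<open>u\<close> and for each new summand of \<open>u\<close>
  on \<open>v\<close>, reduce to \<open>comm_mod\<close> for a pair of generators.\<close>

lemma congruence_comm:
  assumes "set_mset u \<subseteq> carrier G" "set_mset v \<subseteq> carrier G"
  shows "(u \<otimes>\<^bsub>F\<^esub> v, v \<otimes>\<^bsub>F\<^esub> u) \<in> C"
  using assms
proof (induction u)
  case empty
  show ?case by (auto intro: add_congruence.refl)
next
  case (add x u)
  have "(image_mset (mult G x) v, image_mset (\<lambda>y. y \<otimes> x) v) \<in> C"
    using add.prems(2)
  proof (induction v)
    case empty
    show ?case by (auto intro: add_congruence.refl)
  next
    case (add y v)
    then have "(image_mset (mult G x) v + {#x \<otimes> y#}, image_mset (\<lambda>y. y \<otimes> x) v + {#y \<otimes> x#}) \<in> C"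
      using \<open>set_mset (add_mset x u) \<subseteq> carrier G\<close> by (intro congruence_add comm_mod) auto
    then show ?case by simp
  qed
  then show ?case using add by (auto intro: congruence_add)
qed

text \<open>Associativity is exact on formal sums because it is exact in the monoid of generators,
  in contrast to commutativity.\<close>

lemma mult_assoc:
  assumes "set_mset u \<subseteq> carrier G" "set_mset v \<subseteq> carrier G" "set_mset w \<subseteq> carrier G"
  shows "(u \<otimes>\<^bsub>F\<^esub> v) \<otimes>\<^bsub>F\<^esub> w = u \<otimes>\<^bsub>F\<^esub> (v \<otimes>\<^bsub>F\<^esub> w)"
  using assms
proof (induction u)
  case (add x u)
  have "image_mset (mult G x) v \<otimes>\<^bsub>F\<^esub> w = image_mset (mult G x) (v \<otimes>\<^bsub>F\<^esub> w)"
    using add.prems(2)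
  proof (induction v)
    case (add y v)
    have "image_mset (mult G (x \<otimes> y)) w = image_mset (mult G x) (image_mset (mult G y) w)"
      unfolding image_mset.compositionality o_def
      by (rule image_mset_cong) (use add.prems \<open>set_mset (add_mset x u) \<subseteq> carrier G\<close> assms(3) m_assoc in auto)
    then show ?case using add by simp
  qed simp
  then show ?case using add by simp
qed simp

lemma one_mult: "set_mset u \<subseteq> carrier G \<Longrightarrow> {#\<one>#} \<otimes>\<^bsub>F\<^esub> u = u"
  by (induction u) auto

sublocale formal: semiring_congruence "formal_sums G" "add_congruence (carrier G) S"
proof
  show "equiv (carrier F) C" by (rule congruence_equiv)
  fix u v w assume "u \<in> carrier F" "v \<in> carrier F" "w \<in> carrier F"
  then show "((u \<otimes>\<^bsub>F\<^esub> v) \<otimes>\<^bsub>F\<^esub> w, u \<otimes>\<^bsub>F\<^esub> (v \<otimes>\<^bsub>F\<^esub> w)) \<in> C"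
    and "((u \<oplus>\<^bsub>F\<^esub> v) \<otimes>\<^bsub>F\<^esub> w, u \<otimes>\<^bsub>F\<^esub> w \<oplus>\<^bsub>F\<^esub> v \<otimes>\<^bsub>F\<^esub> w) \<in> C"
    using mult_closed[of v w] mult_closed[of u w] mult_closed[of u "v \<otimes>\<^bsub>F\<^esub> w"]
    by (auto simp: mult_assoc intro!: add_congruence.refl)
qed (auto simp: add_ac one_mult[simplified] dest: mult_closed
      intro!: add_congruence.refl intro: add_congruence.plus congruence_mult congruence_comm)

lemma presented_commutative_semiring: "commutative_semiring (presented_semiring G S)"
  unfolding presented_semiring_def by (rule formal.quotient_commutative_semiring)

lemma presented_add:
  assumes "set_mset u \<subseteq> carrier G" "set_mset v \<subseteq> carrier G"
  shows "presented_class G S u \<oplus>\<^bsub>presented_semiring G S\<^esub> presented_class G S v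
    = presented_class G S (u + v)"
  using formal.add_class assms by (simp add: presented_class_def presented_semiring_def)

lemma presented_mult:
  assumes "set_mset u \<subseteq> carrier G" "set_mset v \<subseteq> carrier G"
  shows "presented_class G S u \<otimes>\<^bsub>presented_semiring G S\<^esub> presented_class G S v
    = presented_class G S (u \<otimes>\<^bsub>F\<^esub> v)"
  using formal.mult_class assms by (simp add: presented_class_def presented_semiring_def)

lemma presented_zero: "\<zero>\<^bsub>presented_semiring G S\<^esub> = presented_class G S {#}"
  and presented_one: "\<one>\<^bsub>presented_semiring G S\<^esub> = presented_class G S {#\<one>#}"
  and presented_carrier:
    "carrier (presented_semiring G S) = presented_class G S ` {u. set_mset u \<subseteq> carrier G}"
  using formal.zero_quotient formal.one_quotient formal.carrier_quotient
  by (auto simp: presented_class_def presented_semiring_def)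

lemma presented_eq: "(u, v) \<in> C \<Longrightarrow> presented_class G S u = presented_class G S v"
  unfolding presented_class_def by (rule formal.class_eq)

lemma presented_relation: "(u, v) \<in> S \<Longrightarrow> presented_class G S u = presented_class G S v"
  by (intro presented_eq add_congruence.base)

end

section \<open>Localizations, differences and rational tensors\<close>

locale semiring_with_element = commutative_semiring R for R (structure) +
  fixes s assumes element [simp]: "s \<in> carrier R"
begin

lemma fraction_rel_iff:
  "((x, k), (y, l)) \<in> fraction_rel R s \<longleftrightarrow> x \<in> carrier R \<and> y \<in> carrier R \<and>
     (\<exists>j::nat. x \<otimes> (s [^] (j + l)) = y \<otimes> (s [^] (j + k)))"
  by (simp add: fraction_rel_def)

lemma pow_add: "s [^] (a + b :: nat) = s [^] a \<otimes> s [^] b"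
  by (simp add: nat_pow_mult)

lemma fraction_rel_trans:
  assumes "((x, k), (y, l)) \<in> fraction_rel R s" "((y, l), (z, n)) \<in> fraction_rel R s"
  shows "((x, k), (z, n)) \<in> fraction_rel R s"
proof -
  from assms obtain i j :: nat where c [simp]: "x \<in> carrier R" "y \<in> carrier R" "z \<in> carrier R"
    and i: "x \<otimes> s [^] (i + l) = y \<otimes> s [^] (i + k)" and j: "y \<otimes> s [^] (j + n) = z \<otimes> s [^] (j + l)"
    unfolding fraction_rel_iff by blast
  \<comment> \<open>Without cancellation the middle denominator \<open>s [^] l\<close> has to stay
    in the witness; hence the exponent \<open>i + j + l\<close>.\<close>
  have "x \<otimes> s [^] ((i + j + l) + n) = (x \<otimes> s [^] (i + l)) \<otimes> s [^] (j + n)"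
    by (simp add: pow_add m_ac)
  also have "\<dots> = (y \<otimes> s [^] (j + n)) \<otimes> s [^] (i + k)"
    unfolding i by (simp add: pow_add m_ac)
  also have "\<dots> = z \<otimes> s [^] ((i + j + l) + k)"
    unfolding j by (simp add: pow_add m_ac)
  finally show ?thesis unfolding fraction_rel_iff using c by blast
qed

lemma fraction_rel_add:
  assumes "((x, k), (x', k')) \<in> fraction_rel R s" and [simp]: "y \<in> carrier R"
  shows "((x \<otimes> s [^] l \<oplus> y \<otimes> s [^] k, k + l), (x' \<otimes> s [^] l \<oplus> y \<otimes> s [^] k', k' + l)) \<in> fraction_rel R s"
proof -
  from assms obtain j :: nat where c [simp]: "x \<in> carrier R" "x' \<in> carrier R"
    and j: "x \<otimes> s [^] (j + k') = x' \<otimes> s [^] (j + k)"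
    unfolding fraction_rel_iff by blast
  have "(x \<otimes> s [^] l \<oplus> y \<otimes> s [^] k) \<otimes> s [^] (j + (k' + l)) =
      (x \<otimes> s [^] (j + k')) \<otimes> s [^] (l + l) \<oplus> y \<otimes> s [^] (k + k' + j + l)"
    by (simp add: pow_add m_ac l_distr r_distr)
  also have "\<dots> = (x' \<otimes> s [^] l \<oplus> y \<otimes> s [^] k') \<otimes> s [^] (j + (k + l))"
    unfolding j by (simp add: pow_add m_ac l_distr r_distr)
  finally show ?thesis unfolding fraction_rel_iff by auto
qed

lemma fraction_rel_mult:
  assumes "((x, k), (x', k')) \<in> fraction_rel R s" and [simp]: "y \<in> carrier R"
  shows "((x \<otimes> y, k + l), (x' \<otimes> y, k' + l)) \<in> fraction_rel R s"
proof -
  from assms obtain j :: nat where c [simp]: "x \<in> carrier R" "x' \<in> carrier R"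
    and j: "x \<otimes> s [^] (j + k') = x' \<otimes> s [^] (j + k)"
    unfolding fraction_rel_iff by blast
  have "(x \<otimes> y) \<otimes> s [^] (j + (k' + l)) = (x \<otimes> s [^] (j + k')) \<otimes> (y \<otimes> s [^] l)"
    by (simp add: pow_add m_ac)
  also have "\<dots> = (x' \<otimes> y) \<otimes> s [^] (j + (k + l))"
    unfolding j by (simp add: pow_add m_ac)
  finally show ?thesis unfolding fraction_rel_iff by auto
qed

lemma fraction_rel_eqI:
  "x \<in> carrier R \<Longrightarrow> y \<in> carrier R \<Longrightarrow> x \<otimes> s [^] l = y \<otimes> s [^] k \<Longrightarrow>
    ((x, k), (y, l)) \<in> fraction_rel R s"
  unfolding fraction_rel_iff by (auto intro: exI[of _ 0])

lemma fraction_rel_sym: "(p, q) \<in> fraction_rel R s \<Longrightarrow> (q, p) \<in> fraction_rel R s"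
  by (cases p; cases q; simp only: fraction_rel_iff; metis)

lemma fractions_simps:
  "carrier (fractions R s) = carrier R \<times> UNIV"
  "(x, k) \<otimes>\<^bsub>fractions R s\<^esub> (y, l) = (x \<otimes> y, k + l)"
  "(x, k) \<oplus>\<^bsub>fractions R s\<^esub> (y, l) = (x \<otimes> s [^] l \<oplus> y \<otimes> s [^] k, k + l)"
  "\<zero>\<^bsub>fractions R s\<^esub> = (\<zero>, 0)" "\<one>\<^bsub>fractions R s\<^esub> = (\<one>, 0)"
  by (simp_all add: fractions_def)

sublocale fractions: semiring_congruence "fractions R s" "fraction_rel R s"
proof
  show "equiv (carrier (fractions R s)) (fraction_rel R s)"
  proof (rule equivI)
    show "fraction_rel R s \<subseteq> carrier (fractions R s) \<times> carrier (fractions R s)"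
      by (auto simp: fraction_rel_def fractions_simps)
    show "refl_on (carrier (fractions R s)) (fraction_rel R s)"
      by (auto simp: refl_on_def fractions_simps fraction_rel_eqI)
    show "sym (fraction_rel R s)" by (auto intro: symI fraction_rel_sym)
    show "trans (fraction_rel R s)" by (auto intro!: transI intro: fraction_rel_trans)
  qed
next
  fix p q r assume "(p, q) \<in> fraction_rel R s" "r \<in> carrier (fractions R s)"
  then show "(p \<oplus>\<^bsub>fractions R s\<^esub> r, q \<oplus>\<^bsub>fractions R s\<^esub> r) \<in> fraction_rel R s"
    and "(p \<otimes>\<^bsub>fractions R s\<^esub> r, q \<otimes>\<^bsub>fractions R s\<^esub> r) \<in> fraction_rel R s"
    by (cases p; cases q; cases r; auto simp: fractions_simps intro: fraction_rel_add fraction_rel_mult)+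
next
  fix p q r
  assume "p \<in> carrier (fractions R s)" "q \<in> carrier (fractions R s)" "r \<in> carrier (fractions R s)"
  then obtain x y z k l n where c [simp]: "x \<in> carrier R" "y \<in> carrier R" "z \<in> carrier R"
    and p: "p = (x, k)" "q = (y, l)" "r = (z, n)"
    unfolding fractions_simps by auto
  show "(p \<oplus>\<^bsub>fractions R s\<^esub> q \<oplus>\<^bsub>fractions R s\<^esub> r, p \<oplus>\<^bsub>fractions R s\<^esub> (q \<oplus>\<^bsub>fractions R s\<^esub> r)) \<in> fraction_rel R s"
  proof -
    have "(x \<otimes> b \<oplus> y \<otimes> a) \<otimes> c \<oplus> z \<otimes> (a \<otimes> b) = x \<otimes> (b \<otimes> c) \<oplus> (y \<otimes> c \<oplus> z \<otimes> b) \<otimes> a"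
      if [simp]: "a \<in> carrier R" "b \<in> carrier R" "c \<in> carrier R" for a b c
      by (simp add: l_distr r_distr a_assoc m_ac)
    from this[of "s [^] k" "s [^] l" "s [^] n"] show ?thesis
      unfolding p fractions_simps pow_add by (intro fraction_rel_eqI) (simp_all add: add.assoc)
  qed
  show "((p \<oplus>\<^bsub>fractions R s\<^esub> q) \<otimes>\<^bsub>fractions R s\<^esub> r,
      p \<otimes>\<^bsub>fractions R s\<^esub> r \<oplus>\<^bsub>fractions R s\<^esub> q \<otimes>\<^bsub>fractions R s\<^esub> r) \<in> fraction_rel R s"
  proof -
    have "((x \<otimes> b \<oplus> y \<otimes> a) \<otimes> z) \<otimes> ((a \<otimes> c) \<otimes> (b \<otimes> c)) =
        ((x \<otimes> z) \<otimes> (b \<otimes> c) \<oplus> (y \<otimes> z) \<otimes> (a \<otimes> c)) \<otimes> ((a \<otimes> b) \<otimes> c)"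
      if [simp]: "a \<in> carrier R" "b \<in> carrier R" "c \<in> carrier R" for a b c
      by (simp add: l_distr r_distr m_ac)
    from this[of "s [^] k" "s [^] l" "s [^] n"] show ?thesis
      unfolding p fractions_simps by (intro fraction_rel_eqI) (simp_all add: pow_add)
  qed
qed (auto simp: fractions_simps l_distr m_ac a_ac add_ac intro!: fraction_rel_eqI)

lemma localization_commutative_semiring: "commutative_semiring (localization R s)"
  unfolding localization_def by (rule fractions.quotient_commutative_semiring)

lemma frac_mult:
  "x \<in> carrier R \<Longrightarrow> y \<in> carrier R \<Longrightarrow>
    frac R s x k \<otimes>\<^bsub>localization R s\<^esub> frac R s y l = frac R s (x \<otimes> y) (k + l)"
  using fractions.mult_class[of "(x, k)" "(y, l)"] by (simp add: frac_def localization_def fractions_simps)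

lemma frac_add:
  "x \<in> carrier R \<Longrightarrow> y \<in> carrier R \<Longrightarrow>
    frac R s x k \<oplus>\<^bsub>localization R s\<^esub> frac R s y l = frac R s (x \<otimes> s [^] l \<oplus> y \<otimes> s [^] k) (k + l)"
  using fractions.add_class[of "(x, k)" "(y, l)"] by (simp add: frac_def localization_def fractions_simps)

lemma frac_eqI:
  "x \<in> carrier R \<Longrightarrow> y \<in> carrier R \<Longrightarrow> x \<otimes> s [^] l = y \<otimes> s [^] k \<Longrightarrow> frac R s x k = frac R s y l"
  unfolding frac_def by (intro fractions.class_eq fraction_rel_eqI)

lemma frac_add_same:
  "x \<in> carrier R \<Longrightarrow> y \<in> carrier R \<Longrightarrow>
    frac R s x k \<oplus>\<^bsub>localization R s\<^esub> frac R s y k = frac R s (x \<oplus> y) k"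
  unfolding frac_add by (rule frac_eqI) (auto simp: pow_add l_distr r_distr m_ac)

lemma localization_zero: "\<zero>\<^bsub>localization R s\<^esub> = frac R s \<zero> 0"
  and localization_one: "\<one>\<^bsub>localization R s\<^esub> = frac R s \<one> 0"
  using fractions.zero_quotient fractions.one_quotient
  by (simp_all add: frac_def localization_def fractions_simps)

lemma frac_closed: "x \<in> carrier R \<Longrightarrow> frac R s x k \<in> carrier (localization R s)"
  using fractions.carrier_quotient by (auto simp: frac_def localization_def fractions_simps)

end

section \<open>Rings of differences\<close>

context commutative_semiring
begin

lemma difference_rel_iff:
  "((x, y), (x', y')) \<in> difference_rel R \<longleftrightarrow>
     x \<in> carrier R \<and> y \<in> carrier R \<and> x' \<in> carrier R \<and> y' \<in> carrier R \<and>
     (\<exists>z\<in>carrier R. (x \<oplus> y') \<oplus> z = (x' \<oplus> y) \<oplus> z)"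
  by (simp add: difference_rel_def)

lemma difference_rel_eqI:
  "x \<in> carrier R \<Longrightarrow> y \<in> carrier R \<Longrightarrow> x' \<in> carrier R \<Longrightarrow> y' \<in> carrier R \<Longrightarrow> x \<oplus> y' = x' \<oplus> y \<Longrightarrow>
    ((x, y), (x', y')) \<in> difference_rel R"
  unfolding difference_rel_iff by (auto intro: bexI[of _ "\<zero>"])

lemma difference_rel_sym: "(p, q) \<in> difference_rel R \<Longrightarrow> (q, p) \<in> difference_rel R"
  by (cases p; cases q; simp only: difference_rel_iff; metis)

lemma difference_rel_trans:
  assumes "((x, y), (x', y')) \<in> difference_rel R" "((x', y'), (x'', y'')) \<in> difference_rel R"
  shows "((x, y), (x'', y'')) \<in> difference_rel R"
proof -
  from assms obtain z w where c [simp]: "x \<in> carrier R" "y \<in> carrier R" "x' \<in> carrier R" "y' \<in> carrier R"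
      "x'' \<in> carrier R" "y'' \<in> carrier R" "z \<in> carrier R" "w \<in> carrier R"
    and z: "(x \<oplus> y') \<oplus> z = (x' \<oplus> y) \<oplus> z" and w: "(x' \<oplus> y'') \<oplus> w = (x'' \<oplus> y') \<oplus> w"
    unfolding difference_rel_iff by blast
  \<comment> \<open>Adding the two equations leaves the middle pair on both sides. It joins
    \<open>z\<close> and \<open>w\<close> in the witness, as the semiring need not be
    cancellative.\<close>
  have "(x \<oplus> y'') \<oplus> (x' \<oplus> y' \<oplus> z \<oplus> w) = ((x \<oplus> y') \<oplus> z) \<oplus> ((x' \<oplus> y'') \<oplus> w)"
    by (simp add: a_ac)
  also have "\<dots> = (x'' \<oplus> y) \<oplus> (x' \<oplus> y' \<oplus> z \<oplus> w)"
    unfolding z w by (simp add: a_ac)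
  finally show ?thesis unfolding difference_rel_iff using c by blast
qed

lemma difference_rel_add:
  assumes "((x, y), (x', y')) \<in> difference_rel R" and [simp]: "a \<in> carrier R" "b \<in> carrier R"
  shows "((x \<oplus> a, y \<oplus> b), (x' \<oplus> a, y' \<oplus> b)) \<in> difference_rel R"
proof -
  from assms obtain z where c [simp]: "x \<in> carrier R" "y \<in> carrier R" "x' \<in> carrier R" "y' \<in> carrier R"
      "z \<in> carrier R" and z: "(x \<oplus> y') \<oplus> z = (x' \<oplus> y) \<oplus> z"
    unfolding difference_rel_iff by blast
  have "((x \<oplus> a) \<oplus> (y' \<oplus> b)) \<oplus> z = ((x \<oplus> y') \<oplus> z) \<oplus> (a \<oplus> b)"
    by (simp add: a_ac)
  also have "\<dots> = ((x' \<oplus> a) \<oplus> (y \<oplus> b)) \<oplus> z"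
    unfolding z by (simp add: a_ac)
  finally show ?thesis unfolding difference_rel_iff using c assms by blast
qed

text \<open>The equation times \<open>a\<close> is added to the reversed equation times
  \<open>b\<close>; the witness is \<open>z\<close> times the sum of \<open>a\<close> and
  \<open>b\<close>.\<close>

lemma difference_rel_mult:
  assumes "((x, y), (x', y')) \<in> difference_rel R" and [simp]: "a \<in> carrier R" "b \<in> carrier R"
  shows "((x \<otimes> a \<oplus> y \<otimes> b, x \<otimes> b \<oplus> y \<otimes> a), (x' \<otimes> a \<oplus> y' \<otimes> b, x' \<otimes> b \<oplus> y' \<otimes> a)) \<in> difference_rel R"
proof -
  from assms obtain z where c [simp]: "x \<in> carrier R" "y \<in> carrier R" "x' \<in> carrier R" "y' \<in> carrier R"
      "z \<in> carrier R" and z: "(x \<oplus> y') \<oplus> z = (x' \<oplus> y) \<oplus> z"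
    unfolding difference_rel_iff by blast
  have "((x \<otimes> a \<oplus> y \<otimes> b) \<oplus> (x' \<otimes> b \<oplus> y' \<otimes> a)) \<oplus> (z \<otimes> a \<oplus> z \<otimes> b)
      = ((x \<oplus> y') \<oplus> z) \<otimes> a \<oplus> ((x' \<oplus> y) \<oplus> z) \<otimes> b"
    by (simp add: l_distr a_ac)
  also have "\<dots> = ((x' \<oplus> y) \<oplus> z) \<otimes> a \<oplus> ((x \<oplus> y') \<oplus> z) \<otimes> b"
    unfolding z ..
  also have "\<dots> = ((x' \<otimes> a \<oplus> y' \<otimes> b) \<oplus> (x \<otimes> b \<oplus> y \<otimes> a)) \<oplus> (z \<otimes> a \<oplus> z \<otimes> b)"
    by (simp add: l_distr a_ac)
  finally show ?thesis unfolding difference_rel_iff by auto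
qed

lemma differences_simps:
  "carrier (differences R) = carrier R \<times> carrier R"
  "(x, y) \<otimes>\<^bsub>differences R\<^esub> (x', y') = (x \<otimes> x' \<oplus> y \<otimes> y', x \<otimes> y' \<oplus> y \<otimes> x')"
  "(x, y) \<oplus>\<^bsub>differences R\<^esub> (x', y') = (x \<oplus> x', y \<oplus> y')"
  "\<zero>\<^bsub>differences R\<^esub> = (\<zero>, \<zero>)" "\<one>\<^bsub>differences R\<^esub> = (\<one>, \<zero>)"
  by (simp_all add: differences_def)

sublocale differences: semiring_congruence "differences R" "difference_rel R"
proof
  show "equiv (carrier (differences R)) (difference_rel R)"
  proof (rule equivI)
    show "difference_rel R \<subseteq> carrier (differences R) \<times> carrier (differences R)"
      by (auto simp: difference_rel_def differences_simps)
    show "refl_on (carrier (differences R)) (difference_rel R)"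
      by (auto simp: refl_on_def differences_simps difference_rel_eqI)
    show "sym (difference_rel R)" by (auto intro: symI difference_rel_sym)
    show "trans (difference_rel R)" by (auto intro!: transI intro: difference_rel_trans)
  qed
next
  fix p q r assume "(p, q) \<in> difference_rel R" "r \<in> carrier (differences R)"
  then show "(p \<oplus>\<^bsub>differences R\<^esub> r, q \<oplus>\<^bsub>differences R\<^esub> r) \<in> difference_rel R"
    and "(p \<otimes>\<^bsub>differences R\<^esub> r, q \<otimes>\<^bsub>differences R\<^esub> r) \<in> difference_rel R"
    by (cases p; cases q; cases r; auto simp: differences_simps intro: difference_rel_add difference_rel_mult)+
next
  fix p q r
  assume "p \<in> carrier (differences R)" "q \<in> carrier (differences R)" "r \<in> carrier (differences R)"
  then obtain a b c d e f where [simp]: "a \<in> carrier R" "b \<in> carrier R" "c \<in> carrier R"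
      "d \<in> carrier R" "e \<in> carrier R" "f \<in> carrier R"
    and p: "p = (a, b)" "q = (c, d)" "r = (e, f)"
    unfolding differences_simps by auto
  have *: "(a \<otimes> c \<oplus> b \<otimes> d) \<otimes> e \<oplus> (a \<otimes> d \<oplus> b \<otimes> c) \<otimes> f =
      a \<otimes> (c \<otimes> e \<oplus> d \<otimes> f) \<oplus> b \<otimes> (c \<otimes> f \<oplus> d \<otimes> e)"
    if [simp]: "e \<in> carrier R" "f \<in> carrier R" for e f
    by (simp add: l_distr r_distr m_assoc a_ac)
  show "(p \<otimes>\<^bsub>differences R\<^esub> q \<otimes>\<^bsub>differences R\<^esub> r, p \<otimes>\<^bsub>differences R\<^esub> (q \<otimes>\<^bsub>differences R\<^esub> r)) \<in> difference_rel R"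
    unfolding p differences_simps *[OF \<open>e \<in> carrier R\<close> \<open>f \<in> carrier R\<close>] *[OF \<open>f \<in> carrier R\<close> \<open>e \<in> carrier R\<close>]
    by (intro difference_rel_eqI) auto
  have *: "(a \<oplus> c) \<otimes> e \<oplus> (b \<oplus> d) \<otimes> f = (a \<otimes> e \<oplus> b \<otimes> f) \<oplus> (c \<otimes> e \<oplus> d \<otimes> f)"
    if [simp]: "e \<in> carrier R" "f \<in> carrier R" for e f
    by (simp add: l_distr a_ac)
  show "((p \<oplus>\<^bsub>differences R\<^esub> q) \<otimes>\<^bsub>differences R\<^esub> r,
      p \<otimes>\<^bsub>differences R\<^esub> r \<oplus>\<^bsub>differences R\<^esub> q \<otimes>\<^bsub>differences R\<^esub> r) \<in> difference_rel R"
    unfolding p differences_simps *[OF \<open>e \<in> carrier R\<close> \<open>f \<in> carrier R\<close>] *[OF \<open>f \<in> carrier R\<close> \<open>e \<in> carrier R\<close>]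
    by (intro difference_rel_eqI) auto
  show "(p \<otimes>\<^bsub>differences R\<^esub> q, q \<otimes>\<^bsub>differences R\<^esub> p) \<in> difference_rel R"
    unfolding p differences_simps m_comm[OF \<open>a \<in> carrier R\<close> \<open>c \<in> carrier R\<close>]
      m_comm[OF \<open>b \<in> carrier R\<close> \<open>d \<in> carrier R\<close>] m_comm[OF \<open>a \<in> carrier R\<close> \<open>d \<in> carrier R\<close>]
      m_comm[OF \<open>b \<in> carrier R\<close> \<open>c \<in> carrier R\<close>]
    by (intro difference_rel_eqI) (simp_all add: a_comm)
qed (auto simp: differences_simps a_ac intro!: difference_rel_eqI)

lemma groth_of_add:
  "x \<in> carrier R \<Longrightarrow> y \<in> carrier R \<Longrightarrow> groth_of R (x \<oplus> y) = groth_of R x \<oplus>\<^bsub>groth_ring R\<^esub> groth_of R y"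
  using differences.add_class[of "(x, \<zero>)" "(y, \<zero>)"]
  by (simp add: groth_of_def groth_ring_def differences_simps)

lemma groth_of_mult:
  "x \<in> carrier R \<Longrightarrow> y \<in> carrier R \<Longrightarrow> groth_of R (x \<otimes> y) = groth_of R x \<otimes>\<^bsub>groth_ring R\<^esub> groth_of R y"
  using differences.mult_class[of "(x, \<zero>)" "(y, \<zero>)"]
  by (simp add: groth_of_def groth_ring_def differences_simps)

lemma groth_of_zero: "groth_of R \<zero> = \<zero>\<^bsub>groth_ring R\<^esub>"
  and groth_of_one: "groth_of R \<one> = \<one>\<^bsub>groth_ring R\<^esub>"
  using differences.zero_quotient differences.one_quotient
  by (simp_all add: groth_of_def groth_ring_def differences_simps)

lemma groth_of_closed: "x \<in> carrier R \<Longrightarrow> groth_of R x \<in> carrier (groth_ring R)"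
  using differences.carrier_quotient by (auto simp: groth_of_def groth_ring_def differences_simps)

lemma groth_ring_opposite:
  assumes "x \<in> carrier R" "y \<in> carrier R"
  shows "difference_rel R `` {(x, y)} \<oplus>\<^bsub>groth_ring R\<^esub> difference_rel R `` {(y, x)} = \<zero>\<^bsub>groth_ring R\<^esub>"
  using assms differences.add_class[of "(x, y)" "(y, x)"] differences.zero_quotient
  by (auto simp: groth_ring_def differences_simps a_comm intro!: differences.class_eq difference_rel_eqI)

lemma groth_ring_cring: "cring (groth_ring R)"
proof -
  interpret Q: commutative_semiring "groth_ring R"
    unfolding groth_ring_def by (rule differences.quotient_commutative_semiring)
  have car: "carrier (groth_ring R) = (\<lambda>x. difference_rel R `` {x}) ` (carrier R \<times> carrier R)"
    using differences.carrier_quotient by (simp add: groth_ring_def differences_simps)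
  have "abelian_group (groth_ring R)"
  proof (rule abelian_groupI)
    fix x assume "x \<in> carrier (groth_ring R)"
    then obtain a b where "a \<in> carrier R" "b \<in> carrier R" "x = difference_rel R `` {(a, b)}"
      unfolding car by auto
    then show "\<exists>y\<in>carrier (groth_ring R). y \<oplus>\<^bsub>groth_ring R\<^esub> x = \<zero>\<^bsub>groth_ring R\<^esub>"
      using groth_ring_opposite[of b a] by (auto simp: car)
  qed (auto simp: Q.a_ac)
  then show ?thesis
    by (rule cringI) (simp_all add: Q.comm_monoid_axioms Q.l_distr)
qed

lemma groth_ring_elem:
  assumes "z \<in> carrier (groth_ring R)"
  obtains x y where "x \<in> carrier R" "y \<in> carrier R" "z = groth_of R x \<ominus>\<^bsub>groth_ring R\<^esub> groth_of R y"
proof -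
  interpret Q: cring "groth_ring R" by (rule groth_ring_cring)
  have "carrier (groth_ring R) = (\<lambda>x. difference_rel R `` {x}) ` (carrier R \<times> carrier R)"
    using differences.carrier_quotient by (simp add: groth_ring_def differences_simps)
  then obtain x y where xy: "x \<in> carrier R" "y \<in> carrier R" "z = difference_rel R `` {(x, y)}"
    using assms by auto
  have "z \<oplus>\<^bsub>groth_ring R\<^esub> groth_of R y = groth_of R x"
    using differences.add_class[of "(x, y)" "(y, \<zero>)"] xy
    by (auto simp: groth_of_def groth_ring_def differences_simps intro!: differences.class_eq difference_rel_eqI)
  then have "z = groth_of R x \<ominus>\<^bsub>groth_ring R\<^esub> groth_of R y"
    using xy assms groth_of_closed by (metis Q.add.inv_solve_right Q.minus_eq)
  with xy that show thesis by blast
qed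

end

section \<open>Tensor products with the rationals\<close>

context cring
begin

lemma rat_tensors_simps:
  "carrier (rat_tensors R) = UNIV \<times> carrier R"
  "(q, x) \<otimes>\<^bsub>rat_tensors R\<^esub> (r, y) = (q * r, x \<otimes> y)" "\<one>\<^bsub>rat_tensors R\<^esub> = (1, \<one>)"
  by (simp_all add: rat_tensors_def)

lemma tensor_relationsI:
  "x \<in> carrier R \<Longrightarrow> ({#(q + r, x)#}, {#(q, x), (r, x)#}) \<in> tensor_relations R"
  "x \<in> carrier R \<Longrightarrow> y \<in> carrier R \<Longrightarrow> ({#(q, x \<oplus> y)#}, {#(q, x), (q, y)#}) \<in> tensor_relations R"
  "x \<in> carrier R \<Longrightarrow> ({#(0, x)#}, {#}) \<in> tensor_relations R"
  "({#(q, \<zero>)#}, {#}) \<in> tensor_relations R"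
  unfolding tensor_relations_def by blast+

lemma tensor_relationsE:
  assumes "(u, v) \<in> tensor_relations R"
  obtains q r x where "x \<in> carrier R" "u = {#(q + r, x)#}" "v = {#(q, x), (r, x)#}"
  | q x y where "x \<in> carrier R" "y \<in> carrier R" "u = {#(q, x \<oplus> y)#}" "v = {#(q, x), (q, y)#}"
  | x where "x \<in> carrier R" "u = {#(0, x)#}" "v = {#}"
  | q where "u = {#(q, \<zero>)#}" "v = {#}"
  using assms unfolding tensor_relations_def by blast

sublocale tensors: semiring_presentation "rat_tensors R" "tensor_relations R"
proof -
  interpret T: monoid "rat_tensors R"
    by (rule monoidI) (auto simp: rat_tensors_simps m_assoc)
  show "semiring_presentation (rat_tensors R) (tensor_relations R)"
  proof
    fix u v g assume "(u, v) \<in> tensor_relations R" "g \<in> carrier (rat_tensors R)"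
    then show "({#x \<otimes>\<^bsub>rat_tensors R\<^esub> g. x \<in># u#}, {#x \<otimes>\<^bsub>rat_tensors R\<^esub> g. x \<in># v#})
        \<in> add_congruence (carrier (rat_tensors R)) (tensor_relations R)"
      by (cases g; elim tensor_relationsE;
          simp add: rat_tensors_simps distrib_right l_distr tensor_relationsI add_congruence.base)
  next
    fix x y assume "x \<in> carrier (rat_tensors R)" "y \<in> carrier (rat_tensors R)"
    then show "({#x \<otimes>\<^bsub>rat_tensors R\<^esub> y#}, {#y \<otimes>\<^bsub>rat_tensors R\<^esub> x#})
        \<in> add_congruence (carrier (rat_tensors R)) (tensor_relations R)"
      by (auto simp: rat_tensors_simps m_comm mult.commute intro!: add_congruence.refl)
  qed (elim tensor_relationsE; simp add: rat_tensors_simps)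
qed

lemma pure_tensor_mult:
  "x \<in> carrier R \<Longrightarrow> y \<in> carrier R \<Longrightarrow>
    pure_tensor R q x \<otimes>\<^bsub>rat_tensor R\<^esub> pure_tensor R r y = pure_tensor R (q * r) (x \<otimes> y)"
  using tensors.presented_mult[of "{#(q, x)#}" "{#(r, y)#}"]
  by (simp add: pure_tensor_def rat_tensor_def rat_tensors_simps)

lemma pure_tensor_add_left:
  assumes "x \<in> carrier R"
  shows "pure_tensor R (q + r) x = pure_tensor R q x \<oplus>\<^bsub>rat_tensor R\<^esub> pure_tensor R r x"
proof -
  have "presented_class (rat_tensors R) (tensor_relations R) {#(q + r, x)#} =
      presented_class (rat_tensors R) (tensor_relations R) {#(q, x), (r, x)#}"
    using assms by (intro tensors.presented_relation tensor_relationsI)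
  then show ?thesis
    using tensors.presented_add[of "{#(q, x)#}" "{#(r, x)#}"] assms
    by (simp add: add_mset_commute pure_tensor_def rat_tensor_def rat_tensors_simps)
qed

lemma pure_tensor_add_right:
  assumes "x \<in> carrier R" "y \<in> carrier R"
  shows "pure_tensor R q (x \<oplus> y) = pure_tensor R q x \<oplus>\<^bsub>rat_tensor R\<^esub> pure_tensor R q y"
proof -
  have "presented_class (rat_tensors R) (tensor_relations R) {#(q, x \<oplus> y)#} =
      presented_class (rat_tensors R) (tensor_relations R) {#(q, x), (q, y)#}"
    using assms by (intro tensors.presented_relation tensor_relationsI)
  then show ?thesis
    using tensors.presented_add[of "{#(q, x)#}" "{#(q, y)#}"] assms
    by (simp add: add_mset_commute pure_tensor_def rat_tensor_def rat_tensors_simps)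
qed

lemma pure_tensor_zero:
  "x \<in> carrier R \<Longrightarrow> pure_tensor R 0 x = \<zero>\<^bsub>rat_tensor R\<^esub>" "pure_tensor R q \<zero> = \<zero>\<^bsub>rat_tensor R\<^esub>"
  unfolding pure_tensor_def rat_tensor_def tensors.presented_zero
  by (intro tensors.presented_relation tensor_relationsI; assumption)+

lemma pure_tensor_one: "pure_tensor R 1 \<one> = \<one>\<^bsub>rat_tensor R\<^esub>"
  by (simp add: pure_tensor_def rat_tensor_def tensors.presented_one rat_tensors_simps)

lemma pure_tensor_closed: "x \<in> carrier R \<Longrightarrow> pure_tensor R q x \<in> carrier (rat_tensor R)"
  by (auto simp: pure_tensor_def rat_tensor_def tensors.presented_carrier rat_tensors_simps)

lemma rat_tensor_induct [consumes 1, case_names zero add]: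
  assumes z: "z \<in> carrier (rat_tensor R)" and 0: "P \<zero>\<^bsub>rat_tensor R\<^esub>"
    and add: "\<And>q x z. x \<in> carrier R \<Longrightarrow> z \<in> carrier (rat_tensor R) \<Longrightarrow> P z \<Longrightarrow>
      P (pure_tensor R q x \<oplus>\<^bsub>rat_tensor R\<^esub> z)"
  shows "P z"
proof -
  from z obtain u where u: "set_mset u \<subseteq> carrier (rat_tensors R)"
      and "z = presented_class (rat_tensors R) (tensor_relations R) u"
    by (auto simp: rat_tensor_def tensors.presented_carrier)
  moreover have "P (presented_class (rat_tensors R) (tensor_relations R) u)"
    using u
  proof (induction u)
    case empty
    then show ?case using 0 by (simp add: rat_tensor_def tensors.presented_zero)
  next
    case (add p u)
    obtain q x where p: "p = (q, x)" by force
    from add.prems have x: "x \<in> carrier R" and u: "set_mset u \<subseteq> carrier (rat_tensors R)"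
      by (auto simp: p rat_tensors_simps)
    have "P (pure_tensor R q x \<oplus>\<^bsub>rat_tensor R\<^esub> presented_class (rat_tensors R) (tensor_relations R) u)"
      using x u add.IH by (intro assms(3)) (auto simp: rat_tensor_def tensors.presented_carrier)
    then show ?case
      using tensors.presented_add[of "{#(q, x)#}" u] x u
      by (simp add: pure_tensor_def rat_tensor_def p rat_tensors_simps)
  qed
  ultimately show ?thesis by simp
qed

text \<open>The presentation by itself only gives a semiring. The tensor of -q and x is inverse to
  that of q and x, since their sum is the tensor of 0 and x, which a relation kills; inverses of
  sums are formed summand by summand.\<close>

lemma rat_tensor_ring: "ring (rat_tensor R)"
proof -
  interpret T: commutative_semiring "rat_tensor R"
    unfolding rat_tensor_def by (rule tensors.presented_commutative_semiring)
  have "\<exists>y\<in>carrier (rat_tensor R). y \<oplus>\<^bsub>rat_tensor R\<^esub> z = \<zero>\<^bsub>rat_tensor R\<^esub>"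
    if "z \<in> carrier (rat_tensor R)" for z
    using that
  proof (induction rule: rat_tensor_induct)
    case zero
    then show ?case by auto
  next
    case (add q x z)
    then obtain y where y: "y \<in> carrier (rat_tensor R)" "y \<oplus>\<^bsub>rat_tensor R\<^esub> z = \<zero>\<^bsub>rat_tensor R\<^esub>" by auto
    note c = pure_tensor_closed[OF add(1)]
    have "(pure_tensor R (- q) x \<oplus>\<^bsub>rat_tensor R\<^esub> y) \<oplus>\<^bsub>rat_tensor R\<^esub> (pure_tensor R q x \<oplus>\<^bsub>rat_tensor R\<^esub> z)
        = (pure_tensor R (- q) x \<oplus>\<^bsub>rat_tensor R\<^esub> pure_tensor R q x) \<oplus>\<^bsub>rat_tensor R\<^esub> (y \<oplus>\<^bsub>rat_tensor R\<^esub> z)"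
      using c add(2) y(1) by (simp add: T.a_ac)
    also have "\<dots> = \<zero>\<^bsub>rat_tensor R\<^esub>"
      using pure_tensor_add_left[OF add(1), of "- q" q, symmetric] y by (simp add: pure_tensor_zero add(1))
    finally show ?case using c y by (meson T.a_closed add(1) pure_tensor_closed)
  qed
  then have "abelian_group (rat_tensor R)"
    by (intro abelian_groupI) (auto simp: T.a_ac)
  then show ?thesis
    by (rule ringI) (simp_all add: T.monoid_axioms T.l_distr T.r_distr)
qed

lemma pure_tensor_uminus:
  assumes "x \<in> carrier R"
  shows "pure_tensor R q (\<ominus> x) = \<ominus>\<^bsub>rat_tensor R\<^esub> pure_tensor R q x"
proof -
  interpret T: ring "rat_tensor R" by (rule rat_tensor_ring)
  have "pure_tensor R q (\<ominus> x) \<oplus>\<^bsub>rat_tensor R\<^esub> pure_tensor R q x = \<zero>\<^bsub>rat_tensor R\<^esub>"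
    using assms pure_tensor_add_right[of "\<ominus> x" x q] by (simp add: l_neg pure_tensor_zero)
  then show ?thesis
    using assms by (intro T.minus_equality[symmetric]) (auto intro: pure_tensor_closed)
qed

end

section \<open>Rational multiples in divisible ordered abelian groups\<close>

text \<open>The definition of \<open>zmul\<close> truncates with \<open>nat\<close>. Any
  presentation of the integer as a difference of naturals computes the same value, so the module
  laws can be checked on convenient presentations.\<close>

lemma zmul_diff: "zmul (int m - int n) x = (((+) x) ^^ m) 0 - (((+) x) ^^ n) (0 :: 'a :: ab_group_add)"
proof -
  have add: "(((+) x) ^^ (i + j)) 0 = (((+) x) ^^ i) 0 + (((+) x) ^^ j) 0" for i j
    by (induction i) (auto simp: add.assoc)
  show ?thesis
  proof (cases "m \<ge> n")
    case True
    then show ?thesis using add[of "m - n" n] by (simp add: zmul_def nat_diff_distrib)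
  next
    case False
    then have "nat (int m - int n) = 0" "nat (- (int m - int n)) = n - m" by auto
    then show ?thesis using add[of "n - m" m] False by (simp add: zmul_def)
  qed
qed

lemma zmul_int: "zmul (int n) x = (((+) x) ^^ n) 0"
  using zmul_diff[of n 0 x] by simp

lemma zmul_Suc: "zmul (int (Suc n)) x = x + zmul (int n) x"
  unfolding zmul_int by simp

interpretation zmul: Modules.module "zmul :: int \<Rightarrow> 'a \<Rightarrow> 'a :: ab_group_add"
proof
  fix k l :: int and x y :: 'a
  obtain m n where k: "k = int m - int n" by (meson int_diff_cases)
  obtain m' n' where l: "l = int m' - int n'" by (meson int_diff_cases)
  have addn: "(((+) x) ^^ (i + j)) 0 = (((+) x) ^^ i) 0 + (((+) x) ^^ j) 0" for i j and x :: 'a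
    by (induction i) (auto simp: add.assoc)
  have addx: "(((+) (x + y)) ^^ i) 0 = (((+) x) ^^ i) 0 + (((+) y) ^^ i) 0" for i and x y :: 'a
    by (induction i) (auto simp: algebra_simps)
  show "zmul k (x + y) = zmul k x + zmul k y"
    by (simp add: k zmul_diff addx)
  show add: "zmul (k + l) x = zmul k x + zmul l x" for k l :: int
  proof -
    obtain m n where k: "k = int m - int n" by (meson int_diff_cases)
    obtain m' n' where l: "l = int m' - int n'" by (meson int_diff_cases)
    have "k + l = int (m + m') - int (n + n')" by (simp add: k l)
    then show ?thesis unfolding \<open>k + l = _\<close> zmul_diff addn by (simp add: k l zmul_diff)
  qed
  have neg: "zmul (- k) x = - zmul k x" for k and x :: 'a
    by (simp add: zmul_def)
  have nat: "zmul (int i) (zmul l x) = zmul (int i * l) x" for i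
  proof (induction i)
    case (Suc i)
    have "int (Suc i) * l = l + int i * l" by (simp add: algebra_simps)
    then show ?case unfolding zmul_Suc Suc by (simp add: add)
  qed (simp add: zmul_def)
  show "zmul k (zmul l x) = zmul (k * l) x"
  proof -
    have "zmul k (zmul l x) = zmul (int m) (zmul l x) - zmul (int n) (zmul l x)"
      by (simp add: k zmul_diff zmul_int)
    also have "\<dots> = zmul (int m * l) x + zmul (- (int n * l)) x"
      by (simp add: nat neg)
    also have "\<dots> = zmul (k * l) x"
      unfolding add[symmetric] by (simp add: k algebra_simps)
    finally show ?thesis .
  qed
  show "zmul 1 x = x" by (simp add: zmul_def)
qed

lemma zmul_pos: "0 < k \<Longrightarrow> 0 < x \<Longrightarrow> 0 < zmul k (x :: 'a :: linordered_ab_group_add)"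
proof -
  assume x: "0 < x" and "0 < k"
  then obtain n where k: "k = int (Suc n)" by (metis gr0_implies_Suc zero_less_imp_eq_int)
  have "0 < (((+) x) ^^ (Suc n)) 0" using x by (induction n) (auto intro: add_pos_pos)
  then show ?thesis by (simp only: k zmul_int)
qed

lemma zmul_less_iff: "0 < k \<Longrightarrow> zmul k x < zmul k y \<longleftrightarrow> x < (y :: 'a :: linordered_ab_group_add)"
  using zmul_pos[of k "y - x"] zmul_pos[of k "x - y"]
  by (cases x y rule: linorder_cases) (auto simp: zmul.scale_right_diff_distrib)

lemma zmul_cancel: "0 < k \<Longrightarrow> zmul k x = zmul k y \<longleftrightarrow> x = (y :: 'a :: linordered_ab_group_add)"
  using zmul_less_iff[of k x y] zmul_less_iff[of k y x] by (metis less_irrefl linorder_neqE)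

lemma zmul_eq_0_iff: "zmul k x = 0 \<longleftrightarrow> k = 0 \<or> x = (0 :: 'a :: linordered_ab_group_add)"
  using zmul_cancel[of k x 0] zmul_cancel[of "- k" x 0]
  by (cases k "0 :: int" rule: linorder_cases) (auto simp: zmul.scale_minus_left)

text \<open>For q = a/b in lowest terms, the y with b y = a x. It exists by divisibility and is
  unique because an ordered group is torsion-free.\<close>

definition rmul :: "rat \<Rightarrow> 'g \<Rightarrow> 'g :: doag" where
  "rmul q x = (THE y. zmul (snd (quotient_of q)) y = zmul (fst (quotient_of q)) x)"

text \<open>Frees computations from lowest terms: if a / b is the reduced form, then a k = l b, so b
  y = a x holds after multiplication by \<open>k\<close>, and \<open>k\<close> can be
  cancelled.\<close>

lemma rmul_eqI:
  assumes "0 < k" "q = of_int l / of_int k" "zmul k y = zmul l x"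
  shows "rmul q x = y"
proof -
  define a b where "a = fst (quotient_of q)" and "b = snd (quotient_of q)"
  have b: "b > 0" unfolding b_def by (rule quotient_of_denom_pos') 
  have "q = of_int a / of_int b"
    unfolding a_def b_def by (rule quotient_of_div) simp
  then have "of_int (a * k) = (of_int (l * b) :: rat)"
    using assms(1,2) b by (simp add: field_simps)
  then have ak: "a * k = l * b" by (simp only: of_int_eq_iff)
  have "zmul k (zmul b y) = zmul b (zmul l x)"
    using assms(3) by (metis mult.commute zmul.scale_scale)
  also have "\<dots> = zmul k (zmul a x)"
    using ak by (simp add: mult.commute)
  finally have "zmul b y = zmul a x" using assms(1) by (simp only: zmul_cancel)
  moreover have "z = y" if "zmul b z = zmul a x" for z
    using that b zmul_cancel[of b z y] calculation by simp
  ultimately show ?thesis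
    unfolding rmul_def a_def[symmetric] b_def[symmetric] by (rule the_equality)
qed

lemma zmul_rmul: "0 < k \<Longrightarrow> zmul k (rmul (of_int l / of_int k) x) = zmul l x"
  using divisible[of k "zmul l x"] rmul_eqI[of k _ l _ x] by metis

lemma rat_quotient:
  obtains a b where "(q :: rat) = of_int a / of_int b" "0 < b"
proof -
  obtain a b where "quotient_of q = (a, b)" by force
  then show thesis using that quotient_of_div quotient_of_denom_pos by blast
qed

lemma rat_common_denominator:
  obtains k l m where "0 < k" "(q :: rat) = of_int l / of_int k" "(r :: rat) = of_int m / of_int k"
proof -
  obtain a b where q: "q = of_int a / of_int b" "b > 0" using rat_quotient[of q] by blast
  obtain c d where r: "r = of_int c / of_int d" "d > 0" using rat_quotient by blast
  show thesis
    using q(2) r(2) by (intro that[of "b * d" "a * d" "c * b"]) (simp_all add: q(1) r(1))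
qed

interpretation rmul: Vector_Spaces.vector_space "rmul :: rat \<Rightarrow> 'g \<Rightarrow> 'g :: doag"
proof
  fix q r :: rat and x y :: 'g
  obtain k l m where k: "0 < k" "q = of_int l / of_int k" "r = of_int m / of_int k"
    by (rule rat_common_denominator)
  show "rmul q (x + y) = rmul q x + rmul q y"
    by (rule rmul_eqI[OF k(1,2)]) (simp add: zmul.scale_right_distrib k zmul_rmul)
  show "rmul (q + r) x = rmul q x + rmul r x"
    by (rule rmul_eqI[of k _ "l + m"])
      (simp_all add: zmul.scale_right_distrib zmul.scale_left_distrib zmul_rmul k add_divide_distrib)
  show "rmul q (rmul r x) = rmul (q * r) x"
  proof (rule rmul_eqI[symmetric, of "k * k" _ "l * m"])
    have "zmul (k * k) (rmul q (rmul r x)) = zmul k (zmul k (rmul q (rmul r x)))" by simp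
    also have "\<dots> = zmul k (zmul l (rmul r x))" by (simp only: k zmul_rmul)
    also have "\<dots> = zmul l (zmul k (rmul r x))" by (metis mult.commute zmul.scale_scale)
    also have "\<dots> = zmul (l * m) x" using k by (simp add: zmul_rmul)
    finally show "zmul (k * k) (rmul q (rmul r x)) = zmul (l * m) x" .
  qed (use k in auto)
  show "rmul 1 x = x" by (rule rmul_eqI[of 1 _ 1]) auto
qed

lemma rmul_of_int: "rmul (of_int k) x = zmul k x"
  by (rule rmul_eqI[of 1 _ k]) auto

section \<open>Rational multiples and the order\<close>

lemma rmul_pos: "0 < q \<Longrightarrow> 0 < x \<Longrightarrow> 0 < rmul q x"
proof -
  assume "0 < q" "0 < x"
  moreover obtain a b where q: "q = of_int a / of_int b" "b > 0" using rat_quotient by blast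
  ultimately have "a > 0" by (simp add: zero_less_divide_iff)
  then have "zmul b 0 < zmul b (rmul q x)"
    using q zmul_pos[of a x] \<open>0 < x\<close> by (simp add: zmul_rmul)
  then show "0 < rmul q x" using q(2) by (simp only: zmul_less_iff)
qed

lemma rmul_less_iff: "0 < q \<Longrightarrow> rmul q x < rmul q y \<longleftrightarrow> x < y"
  using rmul_pos[of q "y - x"] rmul_pos[of q "x - y"]
  by (cases x y rule: linorder_cases) (auto simp: rmul.scale_right_diff_distrib)

lemma rmul_le_iff: "0 < q \<Longrightarrow> rmul q x \<le> rmul q y \<longleftrightarrow> x \<le> y"
  using rmul_less_iff[of q y x] by (simp add: not_less[symmetric])

lemma less_rmul_iff: "0 < q \<Longrightarrow> x < rmul q y \<longleftrightarrow> rmul (1 / q) x < y"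
  using rmul_less_iff[of q "rmul (1 / q) x" y] by simp

lemma rmul_less_iff': "0 < q \<Longrightarrow> rmul q x < y \<longleftrightarrow> x < rmul (1 / q) y"
  using rmul_less_iff[of q x "rmul (1 / q) y"] by simp

lemma exists_greater: "\<exists>y > (x :: 'g :: doag). y > 0"
proof -
  obtain z :: 'g where z: "z > 0"
    using nontrivial by (metis linorder_neqE neg_0_less_iff_less)
  have "x \<le> max x 0" "0 \<le> max x 0" by auto
  then have "x < max x 0 + z" "0 < max x 0 + z"
    using z by (metis add_strict_increasing2 add.commute add_le_less_mono add.right_neutral)+
  then show ?thesis by blast
qed

lemma exists_between: "x < y \<Longrightarrow> \<exists>z. x < z \<and> z < (y :: 'g :: doag)"
proof -
  assume "x < y"
  then have "0 < rmul (1 / 2) (y - x)" by (intro rmul_pos) auto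
  moreover have "rmul (1 / 2) (y - x) + rmul (1 / 2) (y - x) = y - x"
    by (simp flip: rmul.scale_left_distrib)
  ultimately show ?thesis
    by (intro exI[of _ "x + rmul (1 / 2) (y - x)"])
      (metis add.commute diff_add_cancel less_add_same_cancel1 add_less_cancel_left)
qed

lemma div_hull_subspace:
  assumes "add_subgroup A"
  shows "0 \<in> div_hull A" "x \<in> div_hull A \<Longrightarrow> y \<in> div_hull A \<Longrightarrow> x + y \<in> div_hull A"
    "x \<in> div_hull A \<Longrightarrow> rmul q x \<in> div_hull A"
proof -
  have A: "zmul (int n) a \<in> A" if "a \<in> A" for n a
    using that assms by (induction n) (auto simp: zmul_Suc add_subgroup_def simp del: of_nat_Suc)
  have zA: "zmul k a \<in> A" if "a \<in> A" for k a
  proof (cases "k \<ge> 0")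
    case True
    then show ?thesis using A[OF that, of "nat k"] by simp
  next
    case False
    then have "- zmul (int (nat (- k))) a = zmul k a" by (simp add: zmul.scale_minus_left)
    then show ?thesis using A[OF that, of "nat (- k)"] assms by (metis add_subgroup_def)
  qed
  show "0 \<in> div_hull A" using assms by (auto simp: div_hull_def add_subgroup_def intro: exI[of _ 1])
  show "x + y \<in> div_hull A" if "x \<in> div_hull A" "y \<in> div_hull A"
  proof -
    from that obtain k l where kl: "k > 0" "zmul k x \<in> A" "l > 0" "zmul l y \<in> A"
      by (auto simp: div_hull_def)
    have "zmul (k * l) (x + y) = zmul l (zmul k x) + zmul k (zmul l y)"
      by (simp add: zmul.scale_right_distrib mult.commute)
    also have "\<dots> \<in> A"
      using zA[OF kl(2), of l] zA[OF kl(4), of k] assms by (simp only: add_subgroup_def)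
    finally show ?thesis using kl by (auto simp: div_hull_def intro!: exI[of _ "k * l"])
  qed
  show "rmul q x \<in> div_hull A" if "x \<in> div_hull A"
  proof -
    from that obtain k where k: "k > 0" "zmul k x \<in> A" by (auto simp: div_hull_def)
    obtain a b where q: "q = of_int a / of_int b" "b > 0" using rat_quotient by blast
    have "zmul (k * b) (rmul q x) = zmul k (zmul a x)"
      by (simp only: zmul.scale_scale[symmetric] q(1) zmul_rmul[OF q(2)])
    also have "\<dots> = zmul a (zmul k x)"
      by (simp only: zmul.scale_scale mult.commute)
    also have "\<dots> \<in> A" using k(2) zA by blast
    finally show ?thesis using k q by (auto simp: div_hull_def intro!: exI[of _ "k * b"])
  qed
qed

section \<open>Affine forms and definable sets\<close>

text \<open>\<Gamma>^m as the functions that vanish from \<open>m\<close> on. Forms in fewer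
  coordinates can be evaluated at the same points, and moving one coordinate is a function
  update.\<close>

definition coords :: "nat \<Rightarrow> (nat \<Rightarrow> 'g::zero) set" where
  "coords m = {x. \<forall>i\<ge>m. x i = 0}"

lemma coords_upd: "x \<in> coords m \<Longrightarrow> i < m \<Longrightarrow> x(i := v) \<in> coords m"
  by (auto simp: coords_def)

text \<open>\<open>D\<close> will be the rational span of the base. Taking the constants of all
  forms from it ensures that solving an inequality for one variable does not leave the class of
  forms.\<close>

locale rational_subspace =
  fixes D :: "'g::doag set"
  assumes zero_mem: "0 \<in> D"
    and add_mem: "x \<in> D \<Longrightarrow> y \<in> D \<Longrightarrow> x + y \<in> D"
    and rmul_mem: "x \<in> D \<Longrightarrow> rmul q x \<in> D"
begin

text \<open>Rational slopes in the first \<open>p\<close> coordinates and a constant in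
  \<open>D\<close>. The recursion exposes the slope in the last of these coordinates, the quantity
  on which the later induction operates.\<close>

primrec affine :: "nat \<Rightarrow> ((nat \<Rightarrow> 'g) \<Rightarrow> 'g) \<Rightarrow> bool" where
  "affine 0 f \<longleftrightarrow> (\<exists>d\<in>D. f = (\<lambda>x. d))"
| "affine (Suc p) f \<longleftrightarrow> (\<exists>r \<phi>. affine p \<phi> \<and> f = (\<lambda>x. rmul r (x p) + \<phi> x))"

lemma affine_SucI: "affine p \<phi> \<Longrightarrow> affine (Suc p) (\<lambda>x. rmul r (x p) + \<phi> x)"
  by auto

lemma affine_SucE:
  assumes "affine (Suc p) f"
  obtains r \<phi> where "affine p \<phi>" "f = (\<lambda>x. rmul r (x p) + \<phi> x)"
  using assms by auto

declare affine.simps(2) [simp del]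

lemma affine_Suc: "affine p f \<Longrightarrow> affine (Suc p) f"
  using affine_SucI[of p f 0] by simp

lemma affine_const: "d \<in> D \<Longrightarrow> affine p (\<lambda>x. d)"
  by (induction p) (auto intro: affine_Suc)

lemma affine_mono: "affine p f \<Longrightarrow> p \<le> q \<Longrightarrow> affine q f"
proof (induction q)
  case (Suc q)
  then show ?case by (cases "p = Suc q") (simp_all add: affine_Suc le_Suc_eq)
qed auto

lemma affine_add: "affine p f \<Longrightarrow> affine p g \<Longrightarrow> affine p (\<lambda>x. f x + g x)"
proof (induction p arbitrary: f g)
  case 0
  then obtain d e where "d \<in> D" "e \<in> D" "f = (\<lambda>x. d)" "g = (\<lambda>x. e)" by auto
  then show ?case using affine_const[OF add_mem[of d e], of 0] by simp
next
  case (Suc p)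
  obtain r \<phi> where f: "affine p \<phi>" "f = (\<lambda>x. rmul r (x p) + \<phi> x)"
    by (rule affine_SucE[OF Suc.prems(1)])
  obtain s \<psi> where g: "affine p \<psi>" "g = (\<lambda>x. rmul s (x p) + \<psi> x)"
    by (rule affine_SucE[OF Suc.prems(2)])
  have "affine p (\<lambda>x. \<phi> x + \<psi> x)" by (rule Suc.IH[OF f(1) g(1)])
  with f g show ?case
    using affine_SucI[of p "\<lambda>x. \<phi> x + \<psi> x" "r + s"] by (simp add: rmul.scale_left_distrib add_ac)
qed

lemma affine_rmul: "affine p f \<Longrightarrow> affine p (\<lambda>x. rmul q (f x))"
proof (induction p arbitrary: f)
  case 0
  then obtain d where "d \<in> D" "f = (\<lambda>x. d)" by auto
  then show ?case using affine_const[OF rmul_mem[of d q], of 0] by simp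
next
  case (Suc p)
  obtain r \<phi> where *: "affine p \<phi>" "f = (\<lambda>x. rmul r (x p) + \<phi> x)"
    by (rule affine_SucE[OF Suc.prems])
  have "affine p (\<lambda>x. rmul q (\<phi> x))" by (rule Suc.IH[OF *(1)])
  with * show ?case
    using affine_SucI[of p "\<lambda>x. rmul q (\<phi> x)" "q * r"] by (simp add: rmul.scale_right_distrib)
qed

lemma affine_uminus: "affine p f \<Longrightarrow> affine p (\<lambda>x. - f x)"
  using affine_rmul[of p f "- 1"] by simp

lemma affine_diff: "affine p f \<Longrightarrow> affine p g \<Longrightarrow> affine p (\<lambda>x. f x - g x)"
  using affine_add[of p f "\<lambda>x. - g x"] affine_uminus[of p g] by simp

lemma affine_zmul: "affine p f \<Longrightarrow> affine p (\<lambda>x. zmul k (f x))"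
  using affine_rmul[of p f "of_int k"] by (simp add: rmul_of_int)

lemma affine_coord: "i < p \<Longrightarrow> affine p (\<lambda>x. x i)"
proof (induction p)
  case (Suc p)
  show ?case
  proof (cases "i = p")
    case True
    have "affine p (\<lambda>x. 0)" by (intro affine_const zero_mem)
    then show ?thesis using True affine_SucI[of p "\<lambda>x. 0" 1] by simp
  next
    case False
    then show ?thesis using Suc by (intro affine_Suc) auto
  qed
qed simp

lemma affine_sum: "(\<And>i. i \<in> I \<Longrightarrow> affine p (f i)) \<Longrightarrow> affine p (\<lambda>x. \<Sum>i\<in>I. f i x)"
  by (induction I rule: infinite_finite_induct)
    (simp_all add: affine_const zero_mem affine_add)

lemmas affine_intros = affine_const affine_add affine_rmul affine_uminus affine_diff affine_coord
  affine_zmul zero_mem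

lemma affine_cong: "affine p f \<Longrightarrow> (\<And>i. i < p \<Longrightarrow> x i = y i) \<Longrightarrow> f x = f y"
proof (induction p arbitrary: f)
  case (Suc p)
  obtain r \<phi> where *: "affine p \<phi>" "f = (\<lambda>x. rmul r (x p) + \<phi> x)"
    by (rule affine_SucE[OF Suc.prems(1)])
  have "\<phi> x = \<phi> y" by (rule Suc.IH[OF *(1)]) (simp add: Suc.prems(2))
  then show ?case using * Suc.prems(2)[of p] by simp
qed auto

lemma affine_upd: "affine p f \<Longrightarrow> p \<le> i \<Longrightarrow> f (x(i := v)) = f x"
  by (rule affine_cong) auto

lemma affine_compose:
  assumes "affine p f" "\<And>i. i < p \<Longrightarrow> affine q (\<lambda>x. T x i)"
  shows "affine q (\<lambda>x. f (T x))"
  using assms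
proof (induction p arbitrary: f)
  case (Suc p)
  obtain r \<phi> where *: "affine p \<phi>" "f = (\<lambda>x. rmul r (x p) + \<phi> x)"
    by (rule affine_SucE[OF Suc.prems(1)])
  have "affine q (\<lambda>x. \<phi> (T x))" by (rule Suc.IH[OF *(1)]) (simp add: Suc.prems(2))
  then show ?case using * Suc.prems(2)[of p] by (simp add: affine_add affine_rmul)
qed (auto intro: affine_const)

text \<open>The denominator of the last slope multiplies the one found for the other slopes. This
  turns rational forms into integral ones, both for Euclid's algorithm and for definability over the
  base.\<close>

lemma affine_denominator:
  "affine p f \<Longrightarrow> \<exists>N>0. \<exists>k. \<exists>d\<in>D. \<forall>x. zmul N (f x) = (\<Sum>i<p. zmul (k i) (x i)) + d"
proof (induction p arbitrary: f)
  case 0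
  then show ?case by (intro exI[of _ 1]) auto
next
  case (Suc p)
  obtain r \<phi> where *: "affine p \<phi>" "f = (\<lambda>x. rmul r (x p) + \<phi> x)"
    by (rule affine_SucE[OF Suc.prems])
  from Suc.IH[OF *(1)] obtain N k d where N: "N > 0" "d \<in> D"
    "\<And>x. zmul N (\<phi> x) = (\<Sum>i<p. zmul (k i) (x i)) + d" by blast
  obtain a b where r: "r = of_int a / of_int b" "b > 0" using rat_quotient[of r] by blast
  have "zmul (N * b) (f x) = (\<Sum>i<Suc p. zmul (if i = p then N * a else b * k i) (x i)) + zmul b d" for x
  proof -
    have "zmul (N * b) (f x) = zmul N (zmul b (rmul r (x p))) + zmul b (zmul N (\<phi> x))"
      by (simp add: * zmul.scale_right_distrib mult.commute)
    also have "\<dots> = zmul (N * a) (x p) + zmul b ((\<Sum>i<p. zmul (k i) (x i)) + d)"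
      using r by (simp add: zmul_rmul N)
    also have "\<dots> = (\<Sum>i<Suc p. zmul (if i = p then N * a else b * k i) (x i)) + zmul b d"
      by (simp add: zmul.scale_right_distrib zmul.scale_sum_right algebra_simps)
    finally show ?thesis .
  qed
  moreover have "zmul b d \<in> D" using rmul_mem[OF N(2), of "of_int b"] by (simp add: rmul_of_int)
  ultimately show ?case using N(1) r(2)
    by (intro exI[of _ "N * b"] conjI exI[of _ "\<lambda>i. if i = p then N * a else b * k i"]
        bexI[of _ "zmul b d"] allI) auto
qed

lemma rmul_bounded:
  fixes x \<gamma> :: 'g assumes "- \<gamma> \<le> x" "x \<le> \<gamma>"
  shows "- rmul \<bar>r\<bar> \<gamma> \<le> rmul r x \<and> rmul r x \<le> rmul \<bar>r\<bar> \<gamma>"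
proof (cases r "0 :: rat" rule: linorder_cases)
  case less
  have "rmul (- r) (- \<gamma>) \<le> rmul (- r) x" "rmul (- r) x \<le> rmul (- r) \<gamma>"
    using less assms by (simp_all only: rmul_le_iff neg_0_less_iff_less)
  then have "rmul r \<gamma> \<le> - rmul r x" "rmul r \<gamma> \<le> rmul r x"
    by (simp_all add: rmul.scale_minus_left)
  then show ?thesis using less by (simp add: rmul.scale_minus_left le_minus_iff[of "rmul r x"])
next
  case greater
  have "rmul r (- \<gamma>) \<le> rmul r x" "rmul r x \<le> rmul r \<gamma>"
    using greater assms by (simp_all only: rmul_le_iff)
  then show ?thesis using greater by simp
qed simp

lemma affine_bounded:
  assumes "affine p f" "\<forall>x\<in>S. \<forall>i<p. - \<gamma> \<le> x i \<and> x i \<le> \<gamma>"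
  shows "\<exists>\<delta>. \<forall>x\<in>S. - \<delta> \<le> f x \<and> f x \<le> \<delta>"
  using assms
proof (induction p arbitrary: f)
  case 0
  then obtain d where "f = (\<lambda>x. d)" by auto
  then show ?case by (auto intro!: exI[of _ "max d (- d)"] simp: minus_max_eq_min)
next
  case (Suc p)
  obtain r \<phi> where *: "affine p \<phi>" "f = (\<lambda>x. rmul r (x p) + \<phi> x)"
    by (rule affine_SucE[OF Suc.prems(1)])
  obtain \<delta> where "\<forall>x\<in>S. - \<delta> \<le> \<phi> x \<and> \<phi> x \<le> \<delta>"
    using Suc.IH[OF *(1)] Suc.prems(2) by auto
  then have "- (rmul \<bar>r\<bar> \<gamma> + \<delta>) \<le> f x \<and> f x \<le> rmul \<bar>r\<bar> \<gamma> + \<delta>" if "x \<in> S" for x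
    using rmul_bounded[of \<gamma> "x p" r] Suc.prems(2) that unfolding * minus_add_distrib
    by (intro conjI add_mono) auto
  then show ?case by blast
qed

text \<open>The counterpart of \<open>definable\<close> with rational slopes, on functions instead
  of vectors. Strict positivity suffices as a generator: f = 0 is the complement of the union of 0 <
  f and f < 0.\<close>

inductive_set dset :: "nat \<Rightarrow> (nat \<Rightarrow> 'g) set set" for m where
  pos: "affine m f \<Longrightarrow> {x \<in> coords m. 0 < f x} \<in> dset m"
| compl: "X \<in> dset m \<Longrightarrow> coords m - X \<in> dset m"
| Un: "X \<in> dset m \<Longrightarrow> Y \<in> dset m \<Longrightarrow> X \<union> Y \<in> dset m"

lemma dset_coords: "X \<in> dset m \<Longrightarrow> X \<subseteq> coords m"
  by (induction rule: dset.induct) auto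

lemma dset_Int: "X \<in> dset m \<Longrightarrow> Y \<in> dset m \<Longrightarrow> X \<inter> Y \<in> dset m"
proof -
  assume *: "X \<in> dset m" "Y \<in> dset m"
  have "X \<inter> Y = coords m - ((coords m - X) \<union> (coords m - Y))"
    using dset_coords[OF *(1)] by auto
  then show ?thesis using * by (auto intro: dset.intros)
qed

lemma dset_diff: "X \<in> dset m \<Longrightarrow> Y \<in> dset m \<Longrightarrow> X - Y \<in> dset m"
proof -
  assume *: "X \<in> dset m" "Y \<in> dset m"
  have "X - Y = X \<inter> (coords m - Y)" using dset_coords[OF *(1)] by auto
  then show ?thesis using * by (auto intro: dset.intros dset_Int)
qed

lemma dset_empty: "{} \<in> dset m"
  using dset.pos[of m "\<lambda>x. 0"] affine_const[OF zero_mem] by simp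

lemma dset_univ: "coords m \<in> dset m"
  using dset.compl[OF dset_empty] by simp

lemma dset_less: "affine m f \<Longrightarrow> affine m g \<Longrightarrow> {x \<in> coords m. f x < g x} \<in> dset m"
  using dset.pos[OF affine_diff[of m g f]] by simp

lemma dset_zero: "affine m f \<Longrightarrow> {x \<in> coords m. f x = 0} \<in> dset m"
proof -
  assume f: "affine m f"
  have "{x \<in> coords m. f x = 0} = coords m - ({x \<in> coords m. 0 < f x} \<union> {x \<in> coords m. f x < 0})"
    by auto
  then show ?thesis using f by (auto intro!: dset.compl dset.Un dset_less dset.pos affine_const zero_mem)
qed

lemma dset_Ball:
  "finite J \<Longrightarrow> (\<And>j. j \<in> J \<Longrightarrow> {x \<in> coords m. P j x} \<in> dset m) \<Longrightarrow>
    {x \<in> coords m. \<forall>j\<in>J. P j x} \<in> dset m"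
proof (induction J rule: finite_induct)
  case (insert j J)
  have "{x \<in> coords m. \<forall>j\<in>insert j J. P j x} = {x \<in> coords m. P j x} \<inter> {x \<in> coords m. \<forall>j\<in>J. P j x}"
    by auto
  then show ?case using insert by (auto intro: dset_Int)
qed (simp add: dset_univ)

lemma dset_Collect_conj:
  "{x \<in> coords m. P x} \<in> dset m \<Longrightarrow> {x \<in> coords m. Q x} \<in> dset m \<Longrightarrow> {x \<in> coords m. P x \<and> Q x} \<in> dset m"
proof -
  assume "{x \<in> coords m. P x} \<in> dset m" "{x \<in> coords m. Q x} \<in> dset m"
  moreover have "{x \<in> coords m. P x \<and> Q x} = {x \<in> coords m. P x} \<inter> {x \<in> coords m. Q x}" by auto
  ultimately show ?thesis by (auto intro: dset_Int)
qed

lemma dset_preimage: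
  assumes "X \<in> dset m" "\<And>i. i < m \<Longrightarrow> affine n (\<lambda>x. T x i)" "\<And>x. x \<in> coords n \<Longrightarrow> T x \<in> coords m"
  shows "{x \<in> coords n. T x \<in> X} \<in> dset n"
  using assms(1)
proof (induction rule: dset.induct)
  case (pos f)
  have "{x \<in> coords n. T x \<in> {x \<in> coords m. 0 < f x}} = {x \<in> coords n. 0 < f (T x)}"
    using assms(3) by auto
  then show ?case using affine_compose[OF pos assms(2)] dset.pos by auto
next
  case (compl X)
  have "{x \<in> coords n. T x \<in> coords m - X} = coords n - {x \<in> coords n. T x \<in> X}"
    using assms(3) by auto
  then show ?case using compl by (auto intro: dset.compl)
next
  case (Un X Y)
  have "{x \<in> coords n. T x \<in> X \<union> Y} = {x \<in> coords n. T x \<in> X} \<union> {x \<in> coords n. T x \<in> Y}" by auto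
  then show ?case using Un by (auto intro: dset.Un)
qed

definition bd :: "nat \<Rightarrow> (nat \<Rightarrow> 'g) set \<Rightarrow> bool" where
  "bd m X \<longleftrightarrow> X \<in> dset m \<and> (\<exists>\<gamma>. \<forall>x\<in>X. \<forall>i<m. - \<gamma> \<le> x i \<and> x i \<le> \<gamma>)"

lemma bd_subset: "bd m X \<Longrightarrow> Y \<in> dset m \<Longrightarrow> Y \<subseteq> X \<Longrightarrow> bd m Y"
  unfolding bd_def by blast

lemma bd_dset: "bd m X \<Longrightarrow> X \<in> dset m"
  by (simp add: bd_def)

lemma bd_empty: "bd m {}"
  by (simp add: bd_def dset_empty)

lemma bd_Un: "bd m X \<Longrightarrow> bd m Y \<Longrightarrow> bd m (X \<union> Y)"
proof -
  assume *: "bd m X" "bd m Y"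
  then obtain \<gamma> \<delta> where "\<forall>x\<in>X. \<forall>i<m. - \<gamma> \<le> x i \<and> x i \<le> \<gamma>" "\<forall>x\<in>Y. \<forall>i<m. - \<delta> \<le> x i \<and> x i \<le> \<delta>"
    unfolding bd_def by blast
  then have "\<forall>x\<in>X \<union> Y. \<forall>i<m. - max \<gamma> \<delta> \<le> x i \<and> x i \<le> max \<gamma> \<delta>"
    by (auto simp: minus_max_eq_min min_le_iff_disj le_max_iff_disj)
  then show ?thesis using * unfolding bd_def by (blast intro: dset.Un)
qed

lemma bd_UN: "finite J \<Longrightarrow> (\<And>j. j \<in> J \<Longrightarrow> bd m (Y j)) \<Longrightarrow> bd m (\<Union>j\<in>J. Y j)"
  by (induction J rule: finite_induct) (auto intro: bd_empty bd_Un)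

end

section \<open>Integral linear maps\<close>

definition int_linear :: "nat \<Rightarrow> ((nat \<Rightarrow> 'g::ab_group_add) \<Rightarrow> 'g) \<Rightarrow> bool" where
  "int_linear m f \<longleftrightarrow> (\<exists>c. f = (\<lambda>x. \<Sum>j<m. zmul (c j) (x j)))"

lemma int_linear_coord: "i < m \<Longrightarrow> int_linear m (\<lambda>x. x i)"
  unfolding int_linear_def
  by (intro exI[of _ "\<lambda>j. if j = i then 1 else 0"]) (simp add: if_distrib[of "\<lambda>c. zmul c _"] cong: if_cong)

lemma int_linear_add: "int_linear m f \<Longrightarrow> int_linear m g \<Longrightarrow> int_linear m (\<lambda>x. f x + g x)"
  unfolding int_linear_def
  by (elim exE, rule_tac x = "\<lambda>j. c j + ca j" in exI) (simp add: zmul.scale_left_distrib sum.distrib)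

lemma int_linear_zmul: "int_linear m f \<Longrightarrow> int_linear m (\<lambda>x. zmul k (f x))"
  unfolding int_linear_def
  by (elim exE, rule_tac x = "\<lambda>j. k * c j" in exI) (simp add: zmul.scale_sum_right)

text \<open>An element of GL_m(Z) carried along with its inverse. Integrality of both replaces a
  condition on the determinant, and images become preimages under the inverse.\<close>

definition unimodular :: "nat \<Rightarrow> ((nat \<Rightarrow> 'g::ab_group_add) \<Rightarrow> nat \<Rightarrow> 'g) \<Rightarrow> ((nat \<Rightarrow> 'g) \<Rightarrow> nat \<Rightarrow> 'g) \<Rightarrow> bool" where
  "unimodular m T T' \<longleftrightarrow>
     (\<forall>x\<in>coords m. T x \<in> coords m \<and> T' x \<in> coords m \<and> T' (T x) = x \<and> T (T' x) = x) \<and>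
     (\<forall>i<m. int_linear m (\<lambda>x. T x i) \<and> int_linear m (\<lambda>x. T' x i))"

lemma unimodular_sym: "unimodular m T T' \<Longrightarrow> unimodular m T' T"
  by (simp add: unimodular_def)

lemma unimodular_image:
  assumes "unimodular m T T'" "X \<subseteq> coords m"
  shows "T ` X = {y \<in> coords m. T' y \<in> X}"
proof -
  have "y \<in> T ` X" if "y \<in> coords m" "T' y \<in> X" for y
    using that assms(1) unfolding unimodular_def by (metis imageI)
  then show ?thesis using assms unfolding unimodular_def by auto
qed

lemma unimodular_swap:
  assumes "i < m" "j < m"
  shows "unimodular m (\<lambda>x. x(i := x j, j := x i)) (\<lambda>x. x(i := x j, j := x i))"
proof -
  have "int_linear m (\<lambda>x. (x(i := x j, j := x i)) l)" if "l < m" for l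
    using assms that by (cases "l = i"; cases "l = j") (simp_all add: int_linear_coord)
  then show ?thesis using assms by (auto simp: unimodular_def coords_def fun_eq_iff)
qed

lemma unimodular_neg:
  assumes "i < m"
  shows "unimodular m (\<lambda>x. x(i := - x i)) (\<lambda>x. x(i := - x i))"
proof -
  have "int_linear m (\<lambda>x. (x(i := - x i)) l)" if "l < m" for l
    using assms that int_linear_zmul[OF int_linear_coord[of i m], of "-1"]
    by (cases "l = i") (simp_all add: int_linear_coord zmul.scale_minus_left)
  then show ?thesis using assms by (auto simp: unimodular_def coords_def fun_eq_iff)
qed

lemma unimodular_shear:
  assumes "i < m" "j < m" "i \<noteq> j"
  shows "unimodular m (\<lambda>x. x(i := x i + zmul k (x j))) (\<lambda>x. x(i := x i + zmul (- k) (x j)))"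
proof -
  have il: "int_linear m (\<lambda>x. (x(i := x i + zmul k (x j))) l)" if "l < m" for l k
    using assms that by (cases "l = i") (simp_all add: int_linear_coord int_linear_zmul int_linear_add)
  then show ?thesis
    unfolding unimodular_def using assms
    by (intro conjI allI impI ballI il) (simp_all add: coords_def fun_eq_iff)
qed

context rational_subspace
begin

lemma int_linear_affine: "int_linear m f \<Longrightarrow> affine m f"
  unfolding int_linear_def by (auto intro!: affine_sum affine_zmul affine_coord)

text \<open>Definable as a preimage under the inverse; bounded because every coordinate of the image
  is an affine form on a bounded set.\<close>

lemma bd_image:
  assumes "unimodular m T T'" "bd m X"
  shows "bd m (T ` X)"
proof -
  have "\<exists>\<delta>. \<forall>i<n. \<forall>x\<in>X. - \<delta> \<le> T x i \<and> T x i \<le> \<delta>" if "n \<le> m" for n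
    using that
  proof (induction n)
    case (Suc n)
    then obtain \<delta> where 1: "\<forall>i<n. \<forall>x\<in>X. - \<delta> \<le> T x i \<and> T x i \<le> \<delta>" by auto
    from assms(2) obtain \<gamma> where "\<forall>x\<in>X. \<forall>i<m. - \<gamma> \<le> x i \<and> x i \<le> \<gamma>" by (auto simp: bd_def)
    moreover have "affine m (\<lambda>x. T x n)"
      using assms(1) Suc.prems by (auto simp: unimodular_def intro: int_linear_affine)
    ultimately obtain \<epsilon> where 2: "\<forall>x\<in>X. - \<epsilon> \<le> T x n \<and> T x n \<le> \<epsilon>"
      using affine_bounded[of m "\<lambda>x. T x n"] by blast
    have "\<forall>i<Suc n. \<forall>x\<in>X. - max \<delta> \<epsilon> \<le> T x i \<and> T x i \<le> max \<delta> \<epsilon>"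
      using 1 2 by (auto simp: less_Suc_eq minus_max_eq_min min_le_iff_disj le_max_iff_disj)
    then show ?case by blast
  qed simp
  from this[of m] obtain \<delta> where "\<forall>y\<in>T ` X. \<forall>i<m. - \<delta> \<le> y i \<and> y i \<le> \<delta>" by auto
  moreover have "T ` X \<in> dset m"
    unfolding unimodular_image[OF assms(1) dset_coords[OF bd_dset[OF assms(2)]]]
    using assms by (intro dset_preimage[of _ m]) (auto simp: unimodular_def bd_def intro: int_linear_affine)
  ultimately show ?thesis unfolding bd_def by blast
qed

end

section \<open>Sets cut out up to lower-dimensional sets\<close>

text \<open>\<open>G X\<close> stands for the class of \<open>X\<close> lying in a fixed subalgebra.
  \<open>G_divide\<close> reflects the invertibility of positive integers, \<open>G_slice\<close>
  the induction on the dimension together with the elements e(d), and \<open>G_box\<close> the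
  values iota(b) - 1 of open intervals.\<close>

locale scissors_closed = rational_subspace D for D :: "'g::doag set" +
  fixes m :: nat and G :: "(nat \<Rightarrow> 'g) set \<Rightarrow> bool"
  assumes G_Un: "bd m X \<Longrightarrow> bd m Y \<Longrightarrow> X \<inter> Y = {} \<Longrightarrow> G X \<Longrightarrow> G Y \<Longrightarrow> G (X \<union> Y)"
    and G_cancel: "bd m X \<Longrightarrow> bd m Y \<Longrightarrow> X \<inter> Y = {} \<Longrightarrow> G X \<Longrightarrow> G (X \<union> Y) \<Longrightarrow> G Y"
    and G_image: "unimodular m T T' \<Longrightarrow> bd m X \<Longrightarrow> G X \<Longrightarrow> G (T ` X)"
    and G_divide: "bd m Z \<Longrightarrow> finite (J :: nat set) \<Longrightarrow> J \<noteq> {} \<Longrightarrow> (\<And>j. j \<in> J \<Longrightarrow> unimodular m (U j) (U' j)) \<Longrightarrow>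
      disjoint_family_on (\<lambda>j. U j ` Z) J \<Longrightarrow> G (\<Union>j\<in>J. U j ` Z) \<Longrightarrow> G Z"
    and G_slice: "bd m X \<Longrightarrow> m = Suc n \<Longrightarrow> d \<in> D \<Longrightarrow> X \<subseteq> {x. x n = d} \<Longrightarrow> G X"
    and G_box: "(\<And>i. i < m \<Longrightarrow> b i \<in> D) \<Longrightarrow> G {x \<in> coords m. \<forall>i<m. 0 < x i \<and> x i < b i}"
begin

lemma G_image_iff:
  assumes "unimodular m T T'" "bd m X"
  shows "G (T ` X) \<longleftrightarrow> G X"
proof
  assume "G (T ` X)"
  moreover have "T' ` T ` X = X"
    using assms dset_coords[OF bd_dset[OF assms(2)]] by (auto simp: unimodular_def image_iff subset_iff)
  ultimately show "G X"
    using G_image[OF unimodular_sym[OF assms(1)] bd_image[OF assms]] by simp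
qed (rule G_image[OF assms])

lemma dset_all:
  fixes n :: nat
  assumes "\<And>i. i < n \<Longrightarrow> {x \<in> coords k. P i x} \<in> dset k"
  shows "{x \<in> coords k. \<forall>i<n. P i x} \<in> dset k"
proof -
  have "{x \<in> coords k. \<forall>i\<in>{..<n}. P i x} \<in> dset k"
    by (rule dset_Ball) (simp_all add: assms)
  then show ?thesis by (simp add: Ball_def)
qed

lemma bd_box:
  assumes "\<And>i. i < m \<Longrightarrow> d i \<in> D"
  shows "bd m {x \<in> coords m. \<forall>i<m. 0 < x i \<and> x i < d i}"
proof -
  have "{x \<in> coords m. \<forall>i<m. 0 < x i \<and> x i < d i} \<in> dset m"
    using assms by (intro dset_all dset_Collect_conj dset_less dset.pos) (auto intro: affine_coord affine_const)
  moreover have "\<exists>\<gamma>. \<forall>i<n. d i \<le> \<gamma> \<and> 0 \<le> \<gamma>" for n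
  proof (induction n)
    case (Suc n)
    then obtain \<gamma> where "\<forall>i<n. d i \<le> \<gamma> \<and> 0 \<le> \<gamma>" by blast
    then have "\<forall>i<Suc n. d i \<le> max (max \<gamma> (d n)) 0 \<and> 0 \<le> max (max \<gamma> (d n)) 0"
      by (auto simp: less_Suc_eq le_max_iff_disj)
    then show ?case by blast
  qed auto
  then obtain \<gamma> where "\<forall>i<m. d i \<le> \<gamma> \<and> 0 \<le> \<gamma>" by blast
  then have "- \<gamma> \<le> x i \<and> x i \<le> \<gamma>" if "\<forall>i<m. 0 < x i \<and> x i < d i" "i < m" for x i
    using that order.trans[of "- \<gamma>" 0 "x i"] order.trans[of "x i" "d i" \<gamma>] by (auto simp: less_imp_le)
  then have "\<forall>x\<in>{x \<in> coords m. \<forall>i<m. 0 < x i \<and> x i < d i}. \<forall>i<m. - \<gamma> \<le> x i \<and> x i \<le> \<gamma>"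
    by blast
  ultimately show ?thesis unfolding bd_def by auto
qed

text \<open>The empty set is what remains when a box is cancelled from itself. The argument also
  covers \<open>m = 0\<close>, where the box is a point rather than empty.\<close>

lemma G_empty: "G {}"
proof -
  let ?B = "{x \<in> coords m. \<forall>i<m. 0 < x i \<and> x i < 0}"
  have "bd m ?B" "G ?B"
    using bd_box[of "\<lambda>i. 0"] G_box[of "\<lambda>i. 0"] zero_mem by simp_all
  then show ?thesis using G_cancel[OF _ bd_empty, of ?B] by simp
qed

section \<open>Subsets of rational hyperplanes\<close>

lemma sum_upd_coeff:
  fixes x :: "nat \<Rightarrow> 'g"
  assumes "i < m"
  shows "(\<Sum>l<m. zmul ((k(i := v)) l) (x l)) = (\<Sum>l<m. zmul (k l) (x l)) + zmul (v - k i) (x i)"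
proof -
  have "(\<Sum>l<m. zmul ((k(i := v)) l) (x l)) = zmul v (x i) + (\<Sum>l\<in>{..<m} - {i}. zmul (k l) (x l))"
    using assms by (subst sum.remove[of _ i]) (auto intro!: sum.cong)
  moreover have "(\<Sum>l<m. zmul (k l) (x l)) = zmul (k i) (x i) + (\<Sum>l\<in>{..<m} - {i}. zmul (k l) (x l))"
    using assms by (intro sum.remove) auto
  ultimately show ?thesis by (simp add: zmul.scale_left_diff_distrib)
qed

lemma sum_upd_coord:
  fixes x :: "nat \<Rightarrow> 'g"
  assumes "i < m"
  shows "(\<Sum>l<m. zmul (k l) ((x(i := v)) l)) = (\<Sum>l<m. zmul (k l) (x l)) + zmul (k i) (v - x i)"
proof -
  have "(\<Sum>l<m. zmul (k l) ((x(i := v)) l)) = zmul (k i) v + (\<Sum>l\<in>{..<m} - {i}. zmul (k l) (x l))"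
    using assms by (subst sum.remove[of _ i]) (auto intro!: sum.cong)
  moreover have "(\<Sum>l<m. zmul (k l) (x l)) = zmul (k i) (x i) + (\<Sum>l\<in>{..<m} - {i}. zmul (k l) (x l))"
    using assms by (intro sum.remove) auto
  ultimately show ?thesis by (simp add: zmul.scale_right_diff_distrib)
qed

text \<open>Swapping coordinate \<open>i\<close> with the last one brings the slice into the
  position required by \<open>G_slice\<close>.\<close>

lemma G_coordinate_slice:
  assumes X: "bd m X" and i: "i < m" and e: "e \<in> D" and sub: "X \<subseteq> {x. x i = e}"
  shows "G X"
proof -
  obtain n where n: "m = Suc n" using i by (cases m) auto
  define T where "T = (\<lambda>x::nat \<Rightarrow> 'g. x(i := x n, n := x i))"
  have T: "unimodular m T T" unfolding T_def using i n by (intro unimodular_swap) auto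
  have "T ` X \<subseteq> {x. x n = e}" using sub by (auto simp: T_def)
  then have "G (T ` X)" using G_slice[OF bd_image[OF T X] n e] by simp
  then show ?thesis using G_image_iff[OF T X] by simp
qed

text \<open>Euclid's algorithm on the coefficients, realised by transvections.\<close>

lemma G_hyperplane:
  assumes "bd m X" "d \<in> D" "X \<subseteq> {x \<in> coords m. (\<Sum>l<m. zmul (k l) (x l)) + d = 0}"
    and "(\<exists>i<m. k i \<noteq> 0) \<or> d \<noteq> 0"
  shows "G X"
  using assms
\<comment> \<open>The sum of the absolute values of the coefficients drops with every subtraction of
  one coefficient from another.\<close>
proof (induction "\<Sum>l<m. nat \<bar>k l\<bar>" arbitrary: k X rule: less_induct)
  case less
  consider (none) "\<forall>i<m. k i = 0" | (one) i where "i < m" "k i \<noteq> 0" "\<forall>j<m. j \<noteq> i \<longrightarrow> k j = 0"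
    | (two) i j where "i < m" "j < m" "i \<noteq> j" "k i \<noteq> 0" "k j \<noteq> 0" "\<bar>k j\<bar> \<le> \<bar>k i\<bar>"
    by (metis linear)
  then show ?case
  proof cases
    case none
    then have "X = {}" using less.prems(3,4) by auto
    then show ?thesis by (simp add: G_empty)
  next
    case one
    have "X \<subseteq> {x. x i = rmul (- 1 / of_int (k i)) d}"
    proof
      fix x assume "x \<in> X"
      then have "(\<Sum>l<m. zmul (k l) (x l)) + d = 0" using less.prems(3) by auto
      moreover have "(\<Sum>l<m. zmul (k l) (x l)) = zmul (k i) (x i)"
        using one by (subst sum.remove[of _ i]) (auto intro!: sum.neutral)
      ultimately have "d = - rmul (of_int (k i)) (x i)"
        by (simp add: rmul_of_int eq_neg_iff_add_eq_0 add.commute)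
      then show "x \<in> {x. x i = rmul (- 1 / of_int (k i)) d}" using one by simp
    qed
    then show ?thesis by (rule G_coordinate_slice[OF less.prems(1) one(1) rmul_mem[OF less.prems(2)]])
  next
    case two
    \<comment> \<open>The shear adds s x_i to x_j, so in the new coordinates the coefficient of x_i
      is k_i - s k_j. With this sign it is smaller in absolute value by the absolute value of
      k_j.\<close>
    define s :: int where "s = sgn (k i) * sgn (k j)"
    define T T' where "T = (\<lambda>x::nat \<Rightarrow> 'g. x(j := x j + zmul s (x i)))"
      and "T' = (\<lambda>x::nat \<Rightarrow> 'g. x(j := x j + zmul (- s) (x i)))"
    define k' where "k' = k(i := k i - s * k j)"
    have T: "unimodular m T T'" unfolding T_def T'_def using two by (intro unimodular_shear) auto
    have "s * k j = sgn (k i) * \<bar>k j\<bar>" by (simp add: s_def abs_sgn mult.assoc mult.commute)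
    then have "\<bar>k i - s * k j\<bar> < \<bar>k i\<bar>"
      using two by (cases "k i > 0") (auto simp: sgn_if)
    then have "nat \<bar>k' l\<bar> \<le> nat \<bar>k l\<bar>" "nat \<bar>k' i\<bar> < nat \<bar>k i\<bar>" for l
      by (auto simp: k'_def)
    then have lt: "(\<Sum>l<m. nat \<bar>k' l\<bar>) < (\<Sum>l<m. nat \<bar>k l\<bar>)"
      using two by (intro sum_strict_mono_ex1) auto
    have "T x \<in> {x \<in> coords m. (\<Sum>l<m. zmul (k' l) (x l)) + d = 0}" if "x \<in> X" for x
    proof -
      have x: "x \<in> coords m" "(\<Sum>l<m. zmul (k l) (x l)) + d = 0" using that less.prems(3) by auto
      have "(\<Sum>l<m. zmul (k' l) (T x l)) = (\<Sum>l<m. zmul (k l) (T x l)) - zmul (s * k j) (T x i)"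
        using two unfolding k'_def by (subst sum_upd_coeff) (auto simp: zmul.scale_minus_left)
      also have "\<dots> = (\<Sum>l<m. zmul (k l) (x l)) + zmul (k j) (zmul s (x i)) - zmul (s * k j) (x i)"
        using two unfolding T_def by (subst sum_upd_coord) auto
      finally show ?thesis
        using x T by (auto simp: unimodular_def mult.commute)
    qed
    then have sub: "T ` X \<subseteq> {x \<in> coords m. (\<Sum>l<m. zmul (k' l) (x l)) + d = 0}" by auto
    \<comment> \<open>The coefficient of x_j is unchanged, so the new equation is not the trivial
      one.\<close>
    have nz: "(\<exists>i<m. k' i \<noteq> 0) \<or> d \<noteq> 0" using two by (auto simp: k'_def intro!: exI[of _ j])
    have "G (T ` X)"
      by (rule less.hyps[OF lt bd_image[OF T less.prems(1)] less.prems(2) sub nz])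
    then show ?thesis using G_image_iff[OF T less.prems(1)] by simp
  qed
qed

lemma G_null:
  assumes "bd m X" "affine m f" "f \<noteq> (\<lambda>x. 0)" "X \<subseteq> {x \<in> coords m. f x = 0}"
  shows "G X"
proof -
  obtain N k d where N: "N > 0" "d \<in> D" "\<And>x. zmul N (f x) = (\<Sum>i<m. zmul (k i) (x i)) + d"
    using affine_denominator[OF assms(2)] by blast
  have "(\<exists>i<m. k i \<noteq> 0) \<or> d \<noteq> 0"
  proof (rule ccontr)
    assume "\<not> ?thesis"
    then have "zmul N (f x) = 0" for x using N(3)[of x] by simp
    then have "f = (\<lambda>x. 0)" using N(1) by (auto simp: zmul_eq_0_iff)
    with assms(3) show False by simp
  qed
  moreover have "X \<subseteq> {x \<in> coords m. (\<Sum>l<m. zmul (k l) (x l)) + d = 0}"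
  proof
    fix x assume "x \<in> X"
    then have "x \<in> coords m" "f x = 0" using assms(4) by auto
    then show "x \<in> {x \<in> coords m. (\<Sum>l<m. zmul (k l) (x l)) + d = 0}"
      using N(3)[of x] by simp
  qed
  ultimately show ?thesis using G_hyperplane[OF assms(1) N(2)] by blast
qed

definition thin :: "(nat \<Rightarrow> 'g) set \<Rightarrow> bool" where
  "thin S \<longleftrightarrow> (\<exists>F. finite F \<and> (\<forall>f\<in>F. affine m f \<and> f \<noteq> (\<lambda>x. 0)) \<and>
     S \<subseteq> (\<Union>f\<in>F. {x \<in> coords m. f x = 0}))"

lemma thinI:
  "finite F \<Longrightarrow> (\<And>f. f \<in> F \<Longrightarrow> affine m f) \<Longrightarrow> (\<lambda>x. 0) \<notin> F \<Longrightarrow>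
    (\<And>x. x \<in> S \<Longrightarrow> x \<in> coords m \<and> (\<exists>f\<in>F. f x = 0)) \<Longrightarrow> thin S"
  unfolding thin_def by (rule exI[of _ F]) auto

lemma thinE:
  assumes "thin S"
  obtains F where "finite F" "\<forall>f\<in>F. affine m f" "(\<lambda>x. 0) \<notin> F"
    "\<forall>x\<in>S. x \<in> coords m \<and> (\<exists>f\<in>F. f x = 0)"
proof -
  from assms obtain F where "finite F" "\<forall>f\<in>F. affine m f \<and> f \<noteq> (\<lambda>x. 0)"
    "S \<subseteq> (\<Union>f\<in>F. {x \<in> coords m. f x = 0})"
    unfolding thin_def by (elim exE conjE)
  then show thesis by (intro that[of F]) auto
qed

lemma thin_subset: "thin S \<Longrightarrow> S' \<subseteq> S \<Longrightarrow> thin S'"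
  by (erule thinE, rule thinI) auto

lemma thin_empty: "thin {}"
  by (rule thinI[of "{}"]) auto

lemma thin_Un:
  assumes "thin S" "thin S'"
  shows "thin (S \<union> S')"
proof -
  obtain F where F: "finite F" "\<forall>f\<in>F. affine m f" "(\<lambda>x. 0) \<notin> F"
    "\<forall>x\<in>S. x \<in> coords m \<and> (\<exists>f\<in>F. f x = 0)"
    using assms(1) by (rule thinE)
  obtain F' where F': "finite F'" "\<forall>f\<in>F'. affine m f" "(\<lambda>x. 0) \<notin> F'"
    "\<forall>x\<in>S'. x \<in> coords m \<and> (\<exists>f\<in>F'. f x = 0)"
    using assms(2) by (rule thinE)
  show ?thesis
    by (rule thinI[of "F \<union> F'"]) (use F F' in auto)
qed

lemma thin_UN: "finite I \<Longrightarrow> (\<And>i. i \<in> I \<Longrightarrow> thin (S i)) \<Longrightarrow> thin (\<Union>i\<in>I. S i)"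
  by (induction I rule: finite_induct) (auto intro: thin_empty thin_Un)

lemma thin_eq:
  assumes "affine m f" "affine m g" "f \<noteq> g"
  shows "thin {x \<in> coords m. f x = g x}"
proof (rule thinI)
  show "affine m h" if "h \<in> {\<lambda>x. f x - g x}" for h
    using that affine_diff[OF assms(1,2)] by simp
  show "(\<lambda>x. 0) \<notin> {\<lambda>x. f x - g x}"
    using assms(3) by (auto simp: fun_eq_iff)
qed auto

text \<open>As \<open>g\<close> does not see x_i, moving x_i off the value of \<open>g\<close>
  leaves that value unchanged; hence x_i - g is not the zero form.\<close>

lemma thin_graph:
  assumes "i < m" "affine m g" "\<And>x v. g (x(i := v)) = g x"
  shows "thin {x \<in> coords m. x i = g x}"
proof (rule thin_eq)
  obtain e :: 'g where e: "e \<noteq> 0" using nontrivial by blast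
  define x where "x = (\<lambda>j. 0 :: 'g)(i := g (\<lambda>j. 0) + e)"
  have "x i \<noteq> g x" using e assms(3) by (simp add: x_def)
  then show "(\<lambda>x. x i) \<noteq> g" by metis
qed (use assms affine_coord in auto)

text \<open>Induction on the number of hyperplanes: \<open>G_null\<close> handles the part inside
  one of them, and the rest lies in the others.\<close>

lemma G_thin:
  assumes "bd m X" "thin X"
  shows "G X"
proof -
  obtain F where F: "finite F" "\<forall>f\<in>F. affine m f" "(\<lambda>x. 0) \<notin> F"
    "\<forall>x\<in>X. x \<in> coords m \<and> (\<exists>f\<in>F. f x = 0)"
    using assms(2) by (rule thinE)
  from F assms(1) show ?thesis
  proof (induction F arbitrary: X rule: finite_induct)
    case empty
    then show ?case by (simp add: G_empty)
  next
    case (insert f F)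
    let ?Z = "{x \<in> coords m. f x = 0}"
    have f: "affine m f" "f \<noteq> (\<lambda>x. 0)" using insert.prems by auto
    have Z: "?Z \<in> dset m" using f by (intro dset_zero)
    have bds: "bd m (X \<inter> ?Z)" "bd m (X - ?Z)"
      using dset_Int[OF bd_dset[OF insert.prems(4)] Z] dset_diff[OF bd_dset[OF insert.prems(4)] Z]
      by (intro bd_subset[OF insert.prems(4)]; blast)+
    have "G (X \<inter> ?Z)"
      by (rule G_null[OF bds(1) f]) auto
    moreover have "G (X - ?Z)"
      by (rule insert.IH[OF _ _ _ bds(2)]) (use insert.prems in auto)
    ultimately have "G ((X \<inter> ?Z) \<union> (X - ?Z))"
      using bds by (intro G_Un) auto
    moreover have "(X \<inter> ?Z) \<union> (X - ?Z) = X" by blast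
    ultimately show ?case by (simp only:)
  qed
qed

section \<open>Dissections up to thin sets\<close>

lemma G_almost_eq:
  assumes "bd m X" "bd m Y" "Y \<subseteq> X" "thin (X - Y)"
  shows "G X \<longleftrightarrow> G Y"
proof -
  have b: "bd m (X - Y)"
    using dset_diff[OF bd_dset[OF assms(1)] bd_dset[OF assms(2)]]
    by (intro bd_subset[OF assms(1)]) auto
  have g: "G (X - Y)" using G_thin[OF b assms(4)] .
  have "X = (X - Y) \<union> Y" using assms(3) by auto
  then show ?thesis using G_Un[OF b assms(2) _ g] G_cancel[OF b assms(2) _ g] by auto
qed

lemma G_disjoint_UN:
  assumes "finite J" "\<And>j. j \<in> J \<Longrightarrow> bd m (Y j)" "disjoint_family_on Y J" "\<And>j. j \<in> J \<Longrightarrow> G (Y j)"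
  shows "G (\<Union>j\<in>J. Y j)"
  using assms
proof (induction J rule: finite_induct)
  case (insert j J)
  have "disjoint_family_on Y J" using insert.prems(2) by (auto simp: disjoint_family_on_def)
  then have "G (\<Union>j\<in>J. Y j)" using insert by auto
  moreover have "Y j \<inter> (\<Union>j\<in>J. Y j) = {}"
    using insert.prems(2) insert.hyps(2) by (auto simp: disjoint_family_on_def)
  ultimately show ?case using insert by (auto intro!: G_Un bd_UN)
qed (simp add: G_empty)

lemma G_pieces:
  assumes "bd m X" "finite J" "\<And>j. j \<in> J \<Longrightarrow> bd m (Y j)" "\<And>j. j \<in> J \<Longrightarrow> Y j \<subseteq> X"
    "disjoint_family_on Y J" "thin (X - (\<Union>j\<in>J. Y j))" "\<And>j. j \<in> J \<Longrightarrow> G (Y j)"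
  shows "G X"
proof -
  have "bd m (\<Union>j\<in>J. Y j)" using assms by (intro bd_UN) auto
  moreover have "G (\<Union>j\<in>J. Y j)" using assms by (intro G_disjoint_UN) auto
  ultimately show ?thesis using G_almost_eq[OF assms(1), of "\<Union>j\<in>J. Y j"] assms by blast
qed

text \<open>Two out of three, up to a thin set: the whole and one part determine the other part, and
  the two parts determine the whole.\<close>

lemma G_two:
  assumes "bd m X" "bd m Y" "bd m Z" "Y \<subseteq> X" "Z \<subseteq> X" "Y \<inter> Z = {}" "thin (X - (Y \<union> Z))"
  shows "G Y \<Longrightarrow> G Z \<Longrightarrow> G X" "G X \<Longrightarrow> G Y \<Longrightarrow> G Z" "G X \<Longrightarrow> G Z \<Longrightarrow> G Y"
proof -
  have "G X \<longleftrightarrow> G (Y \<union> Z)" using assms by (intro G_almost_eq bd_Un) auto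
  then show "G Y \<Longrightarrow> G Z \<Longrightarrow> G X" "G X \<Longrightarrow> G Y \<Longrightarrow> G Z" "G X \<Longrightarrow> G Z \<Longrightarrow> G Y"
    using G_Un[of Y Z] G_cancel[of Y Z] G_cancel[of Z Y] assms by (auto simp: Un_commute Int_commute)
qed

end

section \<open>Cells and summation by parts\<close>

context scissors_closed
begin

definition bounded_forms :: "nat \<Rightarrow> ((nat \<Rightarrow> 'g) \<Rightarrow> 'g) set \<Rightarrow> bool" where
  "bounded_forms p L \<longleftrightarrow> finite L \<and> (\<forall>l\<in>L. affine p l) \<and>
     (\<exists>\<gamma>. \<forall>x\<in>coords m. (\<forall>l\<in>L. 0 < l x) \<longrightarrow> (\<forall>i<p. - \<gamma> \<le> x i \<and> x i \<le> \<gamma>))"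

text \<open>The last conjunct bounds the base of a cell; the fibres are boxes of dimension \<open>m - p\<close>.\<close>

definition cell :: "nat \<Rightarrow> ((nat \<Rightarrow> 'g) \<Rightarrow> 'g) set \<Rightarrow> (nat \<Rightarrow> (nat \<Rightarrow> 'g) \<Rightarrow> 'g) \<Rightarrow> (nat \<Rightarrow> 'g) set" where
  "cell p L f = {x \<in> coords m. (\<forall>l\<in>L. 0 < l x) \<and> (\<forall>i. p \<le> i \<and> i < m \<longrightarrow> 0 < x i \<and> x i < f i x)}"

definition good_cells :: "nat \<Rightarrow> bool" where
  "good_cells p \<longleftrightarrow> (\<forall>L f. bounded_forms p L \<longrightarrow> (\<forall>i. p \<le> i \<and> i < m \<longrightarrow> affine p (f i)) \<longrightarrow> G (cell p L f))"

lemma good_cellsD: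
  "good_cells p \<Longrightarrow> bounded_forms p L \<Longrightarrow> (\<And>i. p \<le> i \<Longrightarrow> i < m \<Longrightarrow> affine p (f i)) \<Longrightarrow> G (cell p L f)"
  unfolding good_cells_def by simp

lemma bounded_formsI:
  "finite L \<Longrightarrow> (\<And>l. l \<in> L \<Longrightarrow> affine p l) \<Longrightarrow>
    (\<And>x i. x \<in> coords m \<Longrightarrow> \<forall>l\<in>L. 0 < l x \<Longrightarrow> i < p \<Longrightarrow> - \<gamma> \<le> x i \<and> x i \<le> \<gamma>) \<Longrightarrow> bounded_forms p L"
  unfolding bounded_forms_def by blast

lemma bounded_formsE:
  assumes "bounded_forms p L"
  obtains \<gamma> where "finite L" "\<forall>l\<in>L. affine p l"
    "\<forall>x\<in>{x \<in> coords m. \<forall>l\<in>L. 0 < l x}. \<forall>i<p. - \<gamma> \<le> x i \<and> x i \<le> \<gamma>"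
  using assms unfolding bounded_forms_def by blast

lemma bounded_forms_Un:
  assumes "bounded_forms p L" "finite L'" "\<And>l. l \<in> L' \<Longrightarrow> affine p l"
  shows "bounded_forms p (L \<union> L')"
proof -
  obtain \<gamma> where \<gamma>: "finite L" "\<forall>l\<in>L. affine p l"
    "\<forall>x\<in>{x \<in> coords m. \<forall>l\<in>L. 0 < l x}. \<forall>i<p. - \<gamma> \<le> x i \<and> x i \<le> \<gamma>"
    using assms(1) by (rule bounded_formsE)
  then show ?thesis using assms(2,3) by (intro bounded_formsI[of _ _ \<gamma>]) auto
qed

lemma bounded_forms_insert: "bounded_forms p L \<Longrightarrow> affine p l \<Longrightarrow> bounded_forms p (insert l L)"
  using bounded_forms_Un[of p L "{l}"] by simp

lemma uniform_bound:
  fixes n :: nat and S :: "'b set" and u :: "nat \<Rightarrow> 'b \<Rightarrow> 'g"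
  assumes "\<And>i. i < n \<Longrightarrow> \<exists>\<delta>. \<forall>x\<in>S. - \<delta> \<le> u i x \<and> u i x \<le> \<delta>"
  shows "\<exists>\<delta>. \<forall>i<n. \<forall>x\<in>S. - \<delta> \<le> u i x \<and> u i x \<le> \<delta>"
  using assms
proof (induction n)
  case (Suc n)
  then obtain \<delta> where 1: "\<forall>i<n. \<forall>x\<in>S. - \<delta> \<le> u i x \<and> u i x \<le> \<delta>" by auto
  obtain \<epsilon> where 2: "\<forall>x\<in>S. - \<epsilon> \<le> u n x \<and> u n x \<le> \<epsilon>" using Suc.prems by auto
  have "\<forall>i<Suc n. \<forall>x\<in>S. - max \<delta> \<epsilon> \<le> u i x \<and> u i x \<le> max \<delta> \<epsilon>"
    using 1 2 by (auto simp: less_Suc_eq minus_max_eq_min min_le_iff_disj le_max_iff_disj)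
  then show ?case by blast
qed simp

text \<open>The base is bounded by assumption. On a bounded base the forms \<open>f i\<close> are
  bounded, hence so are the fibre coordinates between 0 and \<open>f i\<close>.\<close>

lemma bd_cell:
  assumes "bounded_forms p L" "\<And>i. p \<le> i \<Longrightarrow> i < m \<Longrightarrow> affine p (f i)" "p \<le> m"
  shows "bd m (cell p L f)"
proof -
  obtain \<gamma> where L: "finite L" "\<forall>l\<in>L. affine p l"
    and \<gamma>: "\<forall>x\<in>{x \<in> coords m. \<forall>l\<in>L. 0 < l x}. \<forall>i<p. - \<gamma> \<le> x i \<and> x i \<le> \<gamma>"
    using assms(1) by (rule bounded_formsE)
  have "{x \<in> coords m. p \<le> i \<longrightarrow> 0 < x i \<and> x i < f i x} \<in> dset m" if "i < m" for i
  proof (cases "p \<le> i")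
    case True
    have "affine m (f i)" using assms True that affine_mono by blast
    then show ?thesis using True that
      by (auto intro!: dset_Collect_conj dset.pos dset_less affine_coord)
  qed (auto intro: dset_univ)
  then have "{x \<in> coords m. (\<forall>l\<in>L. 0 < l x) \<and> (\<forall>i<m. p \<le> i \<longrightarrow> 0 < x i \<and> x i < f i x)} \<in> dset m"
    using L assms(3) affine_mono by (intro dset_Collect_conj dset_Ball dset_all dset.pos) auto
  moreover have "cell p L f = {x \<in> coords m. (\<forall>l\<in>L. 0 < l x) \<and> (\<forall>i<m. p \<le> i \<longrightarrow> 0 < x i \<and> x i < f i x)}"
    unfolding cell_def by auto
  ultimately have "cell p L f \<in> dset m" by simp
  moreover have "\<exists>\<delta>. \<forall>i<m. \<forall>x\<in>cell p L f. - \<delta> \<le> x i \<and> x i \<le> \<delta>"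
  proof (rule uniform_bound)
    fix i assume i: "i < m"
    show "\<exists>\<delta>. \<forall>x\<in>cell p L f. - \<delta> \<le> x i \<and> x i \<le> \<delta>"
    proof (cases "i < p")
      case True
      then show ?thesis using \<gamma> by (intro exI[of _ \<gamma>]) (auto simp: cell_def)
    next
      case False
      then have "affine p (f i)" using assms i by simp
      from affine_bounded[OF this \<gamma>] obtain \<delta>
        where \<delta>: "\<forall>x\<in>{x \<in> coords m. \<forall>l\<in>L. 0 < l x}. - \<delta> \<le> f i x \<and> f i x \<le> \<delta>" by blast
      have "- \<delta> \<le> x i \<and> x i \<le> \<delta>" if "x \<in> cell p L f" for x
      proof -
        have "0 < x i" "x i < f i x" "f i x \<le> \<delta>" using that \<delta> False i by (auto simp: cell_def)
        then have "x i < \<delta>" "0 < \<delta>" by order+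
        then have "- \<delta> < 0" by simp
        then show ?thesis using \<open>0 < x i\<close> \<open>x i < \<delta>\<close> by (meson less_imp_le order.strict_trans)
      qed
      then show ?thesis by blast
    qed
  qed
  ultimately show ?thesis unfolding bd_def by blast
qed

text \<open>Raises the level of a bounded base by one: over \<open>C\<close> the first
  \<open>p\<close> coordinates are bounded, so the forms \<open>u\<close> and \<open>v\<close> are
  bounded there, and x_p lies between them.\<close>

lemma bounded_forms_between:
  assumes C: "bounded_forms p C" and uv: "affine p u" "affine p v"
    and L: "finite L" "\<And>l. l \<in> L \<Longrightarrow> affine (Suc p) l"
    and sub: "\<And>x. \<forall>l\<in>L. 0 < l x \<Longrightarrow> (\<forall>c\<in>C. 0 < c x) \<and> u x < x p \<and> x p < v x"
  shows "bounded_forms (Suc p) L"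
proof -
  obtain \<gamma> where \<gamma>: "\<forall>x\<in>{x \<in> coords m. \<forall>c\<in>C. 0 < c x}. \<forall>i<p. - \<gamma> \<le> x i \<and> x i \<le> \<gamma>"
    using C by (rule bounded_formsE)
  obtain \<delta> where \<delta>: "\<forall>x\<in>{x \<in> coords m. \<forall>c\<in>C. 0 < c x}. - \<delta> \<le> u x \<and> u x \<le> \<delta>"
    using affine_bounded[OF uv(1) \<gamma>] by blast
  obtain \<epsilon> where \<epsilon>: "\<forall>x\<in>{x \<in> coords m. \<forall>c\<in>C. 0 < c x}. - \<epsilon> \<le> v x \<and> v x \<le> \<epsilon>"
    using affine_bounded[OF uv(2) \<gamma>] by blast
  let ?M = "max \<gamma> (max \<delta> \<epsilon>)"
  show ?thesis
  proof (rule bounded_formsI[of _ _ ?M])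
    fix x i assume x: "x \<in> coords m" "\<forall>l\<in>L. 0 < l x" and i: "i < Suc p"
    then have *: "x \<in> {x \<in> coords m. \<forall>c\<in>C. 0 < c x}" "u x < x p" "x p < v x" using sub by auto
    show "- ?M \<le> x i \<and> x i \<le> ?M"
    proof (cases "i = p")
      case True
      have "- \<delta> \<le> u x" "v x \<le> \<epsilon>" using \<delta> \<epsilon> * by blast+
      then have "- \<delta> \<le> x p" "x p \<le> \<epsilon>" using * by order+
      then show ?thesis using True by (auto simp: minus_max_eq_min min_le_iff_disj le_max_iff_disj)
    next
      case False
      then have "- \<gamma> \<le> x i" "x i \<le> \<gamma>" using \<gamma> * i by (blast dest: less_antisym)+
      then show ?thesis by (auto simp: minus_max_eq_min min_le_iff_disj le_max_iff_disj)
    qed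
  qed (use L in auto)
qed

text \<open>At level 0 all forms are constant. The conditions in \<open>L\<close> hold everywhere or
  one of them fails everywhere, so the cell is a box or empty.\<close>

lemma good_cells_0: "good_cells 0"
  unfolding good_cells_def
proof (intro allI impI)
  fix L f assume L: "bounded_forms 0 L" and f: "\<forall>i. 0 \<le> i \<and> i < m \<longrightarrow> affine 0 (f i)"
  define d where "d = (\<lambda>i. f i (\<lambda>_. 0))"
  have fd: "f i x = d i \<and> d i \<in> D" if i: "i < m" for i x
  proof -
    have "affine 0 (f i)" using f i by blast
    then obtain e where "e \<in> D" "f i = (\<lambda>x. e)" unfolding affine.simps(1) by (elim bexE)
    then show ?thesis by (simp add: d_def)
  qed
  have l: "l x = l (\<lambda>_. 0)" if "l \<in> L" for l x
  proof -
    have "affine 0 l" using L that by (simp add: bounded_forms_def)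
    then show ?thesis by (rule affine_cong) simp
  qed
  show "G (cell 0 L f)"
  proof (cases "\<forall>l\<in>L. 0 < l (\<lambda>_. 0)")
    case True
    have "0 < l x" if "l \<in> L" for l x using True l[OF that, of x] that by simp
    then have "cell 0 L f = {x \<in> coords m. \<forall>i<m. 0 < x i \<and> x i < d i}"
      using fd by (simp add: cell_def cong: conj_cong)
    then show ?thesis using fd G_box[of d] by simp
  next
    case False
    then obtain k where "k \<in> L" "\<not> 0 < k (\<lambda>_. 0)" by blast
    then have "\<not> 0 < k x" for x using l by metis
    then have "cell 0 L f = {}" using \<open>k \<in> L\<close> by (auto simp: cell_def)
    then show ?thesis by (simp add: G_empty)
  qed
qed

text \<open>A normal form for Boolean combinations that avoids formulas: \<open>X\<close> is a union
  of classes of points at which the same forms of \<open>F\<close> are positive. Complements keep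
  the family, and unions merge two families.\<close>

definition sign_determined :: "((nat \<Rightarrow> 'g) \<Rightarrow> 'g) set \<Rightarrow> (nat \<Rightarrow> 'g) set \<Rightarrow> bool" where
  "sign_determined F X \<longleftrightarrow> finite F \<and> (\<forall>f\<in>F. affine m f) \<and>
    (\<forall>x\<in>coords m. \<forall>y\<in>coords m. (\<forall>f\<in>F. 0 < f x \<longleftrightarrow> 0 < f y) \<longrightarrow> (x \<in> X \<longleftrightarrow> y \<in> X))"

lemma sign_determinedI:
  assumes "finite F" "\<And>f. f \<in> F \<Longrightarrow> affine m f"
    and "\<And>x y. x \<in> coords m \<Longrightarrow> y \<in> coords m \<Longrightarrow> \<forall>f\<in>F. 0 < f x \<longleftrightarrow> 0 < f y \<Longrightarrow> x \<in> X \<longleftrightarrow> y \<in> X"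
  shows "sign_determined F X"
  unfolding sign_determined_def by (intro conjI ballI impI) (rule assms; assumption)+

lemma sign_determined_finite: "sign_determined F X \<Longrightarrow> finite F"
  unfolding sign_determined_def by (elim conjE)

lemma sign_determined_affine:
  assumes "sign_determined F X" "f \<in> F"
  shows "affine m f"
proof -
  have "\<forall>f\<in>F. affine m f" using assms(1) unfolding sign_determined_def by (elim conjE)
  then show ?thesis using assms(2) by (rule bspec)
qed

lemma sign_determinedD:
  assumes "sign_determined F X" "x \<in> coords m" "y \<in> coords m" "\<And>f. f \<in> F \<Longrightarrow> 0 < f x \<longleftrightarrow> 0 < f y"
  shows "x \<in> X \<longleftrightarrow> y \<in> X"
proof -
  have "\<forall>x\<in>coords m. \<forall>y\<in>coords m. (\<forall>f\<in>F. 0 < f x \<longleftrightarrow> 0 < f y) \<longrightarrow> (x \<in> X \<longleftrightarrow> y \<in> X)"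
    using assms(1) unfolding sign_determined_def by (elim conjE)
  from bspec[OF bspec[OF this assms(2)] assms(3)] show ?thesis
    by (rule mp) (rule ballI, rule assms(4))
qed

lemma dset_signs:
  assumes "X \<in> dset m"
  shows "\<exists>F. sign_determined F X"
  using assms
proof (induction rule: dset.induct)
  case (pos f)
  have "sign_determined {f} {x \<in> coords m. 0 < f x}"
    by (rule sign_determinedI) (use pos in simp_all)
  then show ?case ..
next
  case (compl X)
  from compl.IH obtain F where F: "sign_determined F X" ..
  have "sign_determined F (coords m - X)"
  proof (rule sign_determinedI)
    fix x y assume xy: "x \<in> coords m" "y \<in> coords m" "\<forall>f\<in>F. 0 < f x \<longleftrightarrow> 0 < f y"
    have "x \<in> X \<longleftrightarrow> y \<in> X" by (rule sign_determinedD[OF F xy(1,2)]) (use xy(3) in simp)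
    then show "x \<in> coords m - X \<longleftrightarrow> y \<in> coords m - X" using xy(1,2) by blast
  qed (rule sign_determined_finite[OF F], rule sign_determined_affine[OF F])
  then show ?case ..
next
  case (Un X Y)
  from Un.IH(1) obtain F where F: "sign_determined F X" ..
  from Un.IH(2) obtain F' where F': "sign_determined F' Y" ..
  have "sign_determined (F \<union> F') (X \<union> Y)"
  proof (rule sign_determinedI)
    fix x y assume xy: "x \<in> coords m" "y \<in> coords m" "\<forall>f\<in>F \<union> F'. 0 < f x \<longleftrightarrow> 0 < f y"
    have "x \<in> X \<longleftrightarrow> y \<in> X" by (rule sign_determinedD[OF F xy(1,2)]) (use xy(3) in simp)
    moreover have "x \<in> Y \<longleftrightarrow> y \<in> Y" by (rule sign_determinedD[OF F' xy(1,2)]) (use xy(3) in simp)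
    ultimately show "x \<in> X \<union> Y \<longleftrightarrow> y \<in> X \<union> Y" by blast
  next
    show "finite (F \<union> F')" using sign_determined_finite[OF F] sign_determined_finite[OF F'] by simp
    show "affine m f" if "f \<in> F \<union> F'" for f
      using that sign_determined_affine[OF F] sign_determined_affine[OF F'] by (elim UnE)
  qed
  then show ?case ..
qed

text \<open>The open polyhedra \<open>P \<sigma>\<close> prescribe a strict sign for every form. One
  that meets \<open>X\<close> lies inside \<open>X\<close>, and what they miss of \<open>X\<close>
  lies on the hyperplanes f = 0.\<close>

lemma good_cells_imp_all:
  assumes "good_cells m" "bd m X"
  shows "G X"
proof -
  from dset_signs[OF bd_dset[OF assms(2)]] obtain F0 where "sign_determined F0 X" ..
  then have signs: "sign_determined F0 X" .
  have F0: "finite F0" "\<forall>f\<in>F0. affine m f"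
    using sign_determined_finite[OF signs] sign_determined_affine[OF signs] by blast+
  \<comment> \<open>The zero form does not separate points, and its zero set is everything; it has
    to go before the zero sets can be declared thin.\<close>
  define F where "F = F0 - {\<lambda>x. 0}"
  have F: "finite F" "\<forall>f\<in>F. affine m f" "(\<lambda>x. 0) \<notin> F" using F0 by (auto simp: F_def)
  have same: "x \<in> X \<longleftrightarrow> y \<in> X"
    if "x \<in> coords m" "y \<in> coords m" "\<forall>f\<in>F. 0 < f x \<longleftrightarrow> 0 < f y" for x y
  proof -
    have "0 < f x \<longleftrightarrow> 0 < f y" if "f \<in> F0" for f
    proof (cases "f = (\<lambda>x. 0)")
      case False
      then have "f \<in> F" using that by (simp add: F_def)
      with \<open>\<forall>f\<in>F. 0 < f x \<longleftrightarrow> 0 < f y\<close> show ?thesis by simp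
    qed simp
    then show ?thesis by (rule sign_determinedD[OF signs that(1,2)])
  qed
  define L where "L = (\<lambda>\<sigma>. \<sigma> \<union> (\<lambda>f x. - f x) ` (F - \<sigma>))"
  define P where "P = (\<lambda>\<sigma>. cell m (L \<sigma>) (\<lambda>_ _. 0))"
  have P: "x \<in> P \<sigma> \<longleftrightarrow> x \<in> coords m \<and> (\<forall>f\<in>\<sigma>. 0 < f x) \<and> (\<forall>f\<in>F - \<sigma>. f x < 0)" for x \<sigma>
    unfolding P_def cell_def L_def ball_Un by (simp add: not_less) auto
  have Ppos: "0 < f x" if "x \<in> P \<sigma>" "f \<in> \<sigma>" for x f \<sigma> using that by (simp add: P)
  have Pneg: "f x < 0" if "x \<in> P \<sigma>" "f \<in> F" "f \<notin> \<sigma>" for x f \<sigma> using that by (simp add: P)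
  define J where "J = {\<sigma>. \<sigma> \<subseteq> F \<and> P \<sigma> \<inter> X \<noteq> {}}"
  have PX: "P \<sigma> \<subseteq> X" if "\<sigma> \<in> J" for \<sigma>
  proof
    fix x assume x: "x \<in> P \<sigma>"
    obtain y where y: "y \<in> P \<sigma>" "y \<in> X" using \<open>\<sigma> \<in> J\<close> by (auto simp: J_def)
    have "0 < f x \<longleftrightarrow> 0 < f y" if "f \<in> F" for f
      using Ppos[OF x] Ppos[OF y(1)] Pneg[OF x that] Pneg[OF y(1) that]
      by (cases "f \<in> \<sigma>") (auto dest: order.asym)
    then show "x \<in> X" using same[of x y] x y by (simp add: P)
  qed
  obtain \<gamma> where \<gamma>: "\<forall>x\<in>X. \<forall>i<m. - \<gamma> \<le> x i \<and> x i \<le> \<gamma>" using assms(2) by (auto simp: bd_def)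
  \<comment> \<open>The sign conditions alone need not bound anything; the bound is inherited from
    \<open>X\<close>, which contains the polyhedron.\<close>
  have Lb: "bounded_forms m (L \<sigma>)" if "\<sigma> \<in> J" for \<sigma>
  proof (rule bounded_formsI[of _ _ \<gamma>])
    show "finite (L \<sigma>)" using that F finite_subset by (auto simp: L_def J_def)
    show "affine m l" if "l \<in> L \<sigma>" for l
    proof -
      consider "l \<in> F" | f where "f \<in> F" "l = (\<lambda>x. - f x)"
        using \<open>l \<in> L \<sigma>\<close> \<open>\<sigma> \<in> J\<close> by (auto simp: L_def J_def)
      then show ?thesis by cases (simp_all add: F(2) affine_uminus)
    qed
    show "- \<gamma> \<le> x i \<and> x i \<le> \<gamma>" if "x \<in> coords m" "\<forall>l\<in>L \<sigma>. 0 < l x" "i < m" for x i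
    proof -
      have "x \<in> P \<sigma>" using that by (auto simp: P_def cell_def)
      then show ?thesis using PX[OF \<open>\<sigma> \<in> J\<close>] \<gamma> that by blast
    qed
  qed
  show ?thesis
  proof (rule G_pieces[OF assms(2), of J P])
    show "finite J" using F(1) by (simp add: J_def)
    show "bd m (P \<sigma>)" if "\<sigma> \<in> J" for \<sigma>
      unfolding P_def by (rule bd_cell[OF Lb[OF that]]) simp_all
    show "G (P \<sigma>)" if "\<sigma> \<in> J" for \<sigma>
      unfolding P_def by (rule good_cellsD[OF assms(1) Lb[OF that]]) simp
    show "P \<sigma> \<subseteq> X" if "\<sigma> \<in> J" for \<sigma> using PX[OF that] .
    show "disjoint_family_on P J"
      unfolding disjoint_family_on_def
    proof (intro ballI impI)
      fix \<sigma> \<tau> assume "\<sigma> \<in> J" "\<tau> \<in> J" "\<sigma> \<noteq> \<tau>"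
      then obtain f where f: "f \<in> F" "(f \<in> \<sigma> \<and> f \<notin> \<tau>) \<or> (f \<in> \<tau> \<and> f \<notin> \<sigma>)" by (auto simp: J_def)
      have "False" if "x \<in> P \<rho>" "x \<in> P \<rho>'" "f \<in> \<rho>" "f \<notin> \<rho>'" for x \<rho> \<rho>'
        using Ppos[OF that(1,3)] Pneg[OF that(2) f(1) that(4)] by simp
      then show "P \<sigma> \<inter> P \<tau> = {}" using f(2) by blast
    qed
    show "thin (X - (\<Union>\<sigma>\<in>J. P \<sigma>))"
    proof (rule thinI[OF F(1)])
      fix x assume x: "x \<in> X - (\<Union>\<sigma>\<in>J. P \<sigma>)"
      then have xc: "x \<in> coords m" using dset_coords[OF bd_dset[OF assms(2)]] by auto
      have "\<exists>f\<in>F. f x = 0"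
      proof (rule ccontr)
        assume nz: "\<not> ?thesis"
        have xP: "x \<in> P {f \<in> F. 0 < f x}" using nz xc by (simp add: P not_less le_less)
        then have "x \<in> P {f \<in> F. 0 < f x} \<inter> X" using x by blast
        then have "{f \<in> F. 0 < f x} \<in> J" unfolding J_def by (simp, metis empty_iff)
        then show False using x xP by simp
      qed
      then show "x \<in> coords m \<and> (\<exists>f\<in>F. f x = 0)" using xc by simp
    qed (use F in auto)
  qed
qed

text \<open>Fourier--Motzkin: \<open>Ls\<close> and \<open>Us\<close> are the lower and upper bounds on \<open>x\<^sub>p\<close> contained in \<open>L\<close>.\<close>

definition slice_bounds ::
  "nat \<Rightarrow> ((nat \<Rightarrow> 'g) \<Rightarrow> 'g) set \<Rightarrow> ((nat \<Rightarrow> 'g) \<Rightarrow> 'g) set \<Rightarrow> ((nat \<Rightarrow> 'g) \<Rightarrow> 'g) set \<Rightarrow> ((nat \<Rightarrow> 'g) \<Rightarrow> 'g) set \<Rightarrow> bool" where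
  "slice_bounds p L L0 Ls Us \<longleftrightarrow> finite L0 \<and> finite Ls \<and> finite Us \<and>
    (\<forall>l\<in>L0. affine p l) \<and> (\<forall>l\<in>Ls. affine p l) \<and> (\<forall>l\<in>Us. affine p l) \<and>
    (\<forall>x. (\<forall>l\<in>L. 0 < l x) \<longleftrightarrow> (\<forall>l\<in>L0. 0 < l x) \<and> (\<forall>g\<in>Ls. g x < x p) \<and> (\<forall>h\<in>Us. x p < h x))"

text \<open>Each form is solved for x_p: a positive slope gives a lower bound, a negative slope an
  upper bound, and slope 0 a condition on the earlier coordinates.\<close>

lemma ex_slice_bounds:
  assumes "finite L" "\<forall>l\<in>L. affine (Suc p) l"
  shows "\<exists>L0 Ls Us. slice_bounds p L L0 Ls Us"
  using assms
proof (induction L rule: finite_induct)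
  case empty
  have "slice_bounds p {} {} {} {}" by (simp add: slice_bounds_def)
  then show ?case by blast
next
  case (insert l L)
  from insert.IH insert.prems obtain L0 Ls Us where IH: "slice_bounds p L L0 Ls Us" by auto
  have "affine (Suc p) l" using insert.prems by simp
  then obtain r \<phi> where l: "affine p \<phi>" "l = (\<lambda>x. rmul r (x p) + \<phi> x)" by (rule affine_SucE)
  consider "r = 0" | "r > 0" | "r < 0" by linarith
  then show ?case
  proof cases
    case 1
    then have "l = \<phi>" by (simp add: l)
    then have "slice_bounds p (insert l L) (insert \<phi> L0) Ls Us"
      using IH l(1) by (simp add: slice_bounds_def conj_ac)
    then show ?thesis by blast
  next
    case 2
    define g where "g = (\<lambda>x. rmul (1 / r) (- \<phi> x))"
    have "affine p g" unfolding g_def using l by (intro affine_rmul affine_uminus)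
    moreover have "0 < l x \<longleftrightarrow> g x < x p" for x
    proof -
      have "0 < l x \<longleftrightarrow> - \<phi> x < rmul r (x p)" 
        using add_less_cancel_right[of "- \<phi> x" "\<phi> x" "rmul r (x p)"] by (simp add: l)
      then show ?thesis by (simp only: g_def less_rmul_iff[OF 2])
    qed
    ultimately have "slice_bounds p (insert l L) L0 (insert g Ls) Us"
      using IH by (simp add: slice_bounds_def conj_ac)
    then show ?thesis by blast
  next
    case 3
    define h where "h = (\<lambda>x. rmul (1 / - r) (\<phi> x))"
    have "affine p h" unfolding h_def using l by (intro affine_rmul)
    moreover have "0 < l x \<longleftrightarrow> x p < h x" for x
    proof -
      have "0 < l x \<longleftrightarrow> rmul (- r) (x p) < \<phi> x"
        using add_less_cancel_left[of "rmul r (x p)" "- rmul r (x p)" "\<phi> x"]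
        by (simp add: l rmul.scale_minus_left)
      moreover have "0 < - r" using 3 by simp
      ultimately show ?thesis by (simp only: h_def rmul_less_iff')
    qed
    ultimately have "slice_bounds p (insert l L) L0 Ls (insert h Us)"
      using IH by (simp add: slice_bounds_def conj_ac)
    then show ?thesis by blast
  qed
qed

text \<open>Discrete integration by parts: split a box according to which coordinate, measured by its
  own affine scale, is the largest one.\<close>

lemma by_parts:
  fixes f :: "nat \<Rightarrow> (nat \<Rightarrow> 'g) \<Rightarrow> 'g"
  assumes p: "p < m" and H: "good_cells p" and C: "bounded_forms p C"
    and g: "affine p g" and h: "affine p h" and gh: "\<And>x. \<forall>c\<in>C. 0 < c x \<Longrightarrow> g x < h x"
    and J: "J \<subseteq> {p..<m}" "p \<in> J"
    and a: "\<And>j. j \<in> J \<Longrightarrow> 0 < a j" and \<phi>: "\<And>j. j \<in> J \<Longrightarrow> affine p (\<phi> j)"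
    and f: "\<And>i. i \<in> {p..<m} - J \<Longrightarrow> affine p (f i)"
    and \<tau>_def: "\<tau> = (\<lambda>j x. rmul (1 / a j) (x j - \<phi> j x))"
    and Y_def: "Y = (\<lambda>j. {x \<in> coords m. (\<forall>c\<in>C. 0 < c x) \<and> (\<forall>i\<in>{p..<m}. 0 < x i) \<and> g x < \<tau> j x \<and> \<tau> j x < h x \<and>
      (\<forall>i\<in>J - {j}. \<tau> i x < \<tau> j x) \<and> (\<forall>i\<in>{p..<m} - J. x i < f i x)})"
    and bdY: "\<And>j. j \<in> J \<Longrightarrow> bd m (Y j)"
  shows "disjoint_family_on Y J" "G (\<Union>j\<in>J. Y j)"
proof -
  \<comment> \<open>The sides of the box at height \<open>u\<close>: those in \<open>J\<close> grow
    with \<open>u\<close> at slope \<open>a i\<close>, the others keep the length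
    \<open>f i\<close>.\<close>
  define bound where "bound = (\<lambda>u i. if i \<in> J then (\<lambda>x. rmul (a i) (u x) + \<phi> i x) else f i)"
  have bound: "affine p (bound u i)" if "affine p u" "i \<in> {p..<m}" for u i
    using that \<phi> f by (cases "i \<in> J") (simp_all add: bound_def affine_add affine_rmul)
  define Bx where "Bx = (\<lambda>u. cell p C (bound u))"
  have bd: "bd m (Bx u)" "G (Bx u)" if "affine p u" for u
    unfolding Bx_def using bound[OF that] p bd_cell[OF C] good_cellsD[OF H C] by simp_all
  \<comment> \<open>\<open>\<tau> j x\<close> is the height at which the growing side
    \<open>j\<close> reaches the point, the solution s of x_j = a_j s + \<phi>_j.\<close>
  have \<tau>_less: "\<tau> j x < s \<longleftrightarrow> x j < rmul (a j) s + \<phi> j x" if "j \<in> J" for j x s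
    unfolding \<tau>_def using less_rmul_iff[OF a[OF that], of "x j - \<phi> j x" s] by (simp add: diff_less_eq)
  have \<tau>_eq: "x j = rmul (a j) s + \<phi> j x" if "j \<in> J" "\<tau> j x = s" for j x s
  proof -
    have "rmul (a j) s = x j - \<phi> j x" using a[OF that(1)] by (simp add: that(2)[symmetric] \<tau>_def)
    then show ?thesis by simp
  qed
  have Bx: "x \<in> Bx u \<longleftrightarrow> x \<in> coords m \<and> (\<forall>c\<in>C. 0 < c x) \<and> (\<forall>i\<in>{p..<m}. 0 < x i) \<and>
      (\<forall>i\<in>J. \<tau> i x < u x) \<and> (\<forall>i\<in>{p..<m} - J. x i < f i x)" for x u
  proof -
    have "(\<forall>i\<in>{p..<m}. x i < bound u i x) \<longleftrightarrow> (\<forall>i\<in>J. \<tau> i x < u x) \<and> (\<forall>i\<in>{p..<m} - J. x i < f i x)"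
      using J(1) by (auto simp: bound_def \<tau>_less)
    then show ?thesis unfolding Bx_def cell_def by auto
  qed
  show disj: "disjoint_family_on Y J"
    unfolding disjoint_family_on_def
  proof (intro ballI impI)
    fix i j assume ij: "i \<in> J" "j \<in> J" "i \<noteq> j"
    have False if "x \<in> Y i" "x \<in> Y j" for x
    proof -
      have "\<tau> j x < \<tau> i x" "\<tau> i x < \<tau> j x" using that ij by (simp_all add: Y_def)
      then show False by simp
    qed
    then show "Y i \<inter> Y j = {}" by blast
  qed
  have fin: "finite J" using J(1) finite_subset by blast
  show "G (\<Union>j\<in>J. Y j)"
  \<comment> \<open>The boxes at heights \<open>g\<close> and \<open>h\<close> are cells of level
    \<open>p\<close>, hence good by hypothesis; cancelling the lower one from the upper one leaves
    the pieces.\<close>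
  proof (rule G_two(2)[where X = "Bx h" and Y = "Bx g" and Z = "\<Union>j\<in>J. Y j"])
    show "bd m (Bx h)" "bd m (Bx g)" "G (Bx h)" "G (Bx g)" using bd g h by auto
    show "bd m (\<Union>j\<in>J. Y j)" using fin bdY by (rule bd_UN)
    show "Bx g \<subseteq> Bx h"
    proof
      fix x assume x: "x \<in> Bx g"
      then have "g x < h x" using gh by (simp add: Bx)
      then show "x \<in> Bx h" using x unfolding Bx by (blast intro: less_trans)
    qed
    show "(\<Union>j\<in>J. Y j) \<subseteq> Bx h"
    proof
      fix x assume "x \<in> (\<Union>j\<in>J. Y j)"
      then obtain j where j: "j \<in> J" and x: "x \<in> Y j" by blast
      have "\<tau> i x < h x" if "i \<in> J" for i
      proof (cases "i = j")
        case False
        then have "\<tau> i x < \<tau> j x" "\<tau> j x < h x" using x that by (simp_all add: Y_def)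
        then show ?thesis by (rule less_trans)
      qed (use x in \<open>simp add: Y_def\<close>)
      then show "x \<in> Bx h" using x by (simp add: Bx Y_def)
    qed
    show "Bx g \<inter> (\<Union>j\<in>J. Y j) = {}"
    proof -
      have False if "x \<in> Bx g" "j \<in> J" "x \<in> Y j" for x j
      proof -
        have "\<tau> j x < g x" "g x < \<tau> j x" using that by (simp_all add: Bx Y_def)
        then show False by simp
      qed
      then show ?thesis by blast
    qed
    show "thin (Bx h - (Bx g \<union> (\<Union>j\<in>J. Y j)))"
    proof (rule thin_subset)
      \<comment> \<open>What escapes the pieces: the last coordinate enters exactly at height
        \<open>g\<close>, or two coordinates enter at the same height.\<close>
      show "thin ((\<Union>j\<in>J. {x \<in> coords m. x j = rmul (a j) (g x) + \<phi> j x}) \<union>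
        (\<Union>j\<in>J. \<Union>i\<in>J - {j}. {x \<in> coords m. x j = rmul (a j) (\<tau> i x) + \<phi> j x}))"
      proof (intro thin_Un thin_UN fin finite_Diff)
        fix j assume j: "j \<in> J"
        then have jm: "j < m" "p \<le> j" using J(1) by auto
        have pm: "p \<le> m" using p by simp
        have up: "u (x(j := v)) = u x" if "affine p u" for u x v
          using affine_upd[OF that jm(2)] .
        show "thin {x \<in> coords m. x j = rmul (a j) (g x) + \<phi> j x}"
        proof (rule thin_graph[OF jm(1)])
          show "affine m (\<lambda>x. rmul (a j) (g x) + \<phi> j x)"
            using g \<phi>[OF j] pm affine_mono by (simp add: affine_add affine_rmul)
        qed (simp add: up g \<phi>[OF j])
        fix i assume i: "i \<in> J - {j}"
        then have im: "i < m" "i \<noteq> j" "i \<in> J" using J(1) by auto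
        show "thin {x \<in> coords m. x j = rmul (a j) (\<tau> i x) + \<phi> j x}"
        proof (rule thin_graph[OF jm(1)])
          have "affine m (\<phi> i)" "affine m (\<phi> j)" using \<phi>[OF j] \<phi>[OF im(3)] pm affine_mono by blast+
          then show "affine m (\<lambda>x. rmul (a j) (\<tau> i x) + \<phi> j x)"
            unfolding \<tau>_def by (simp add: affine_add affine_rmul affine_diff affine_coord im(1))
        qed (simp add: up \<tau>_def \<phi>[OF j] \<phi>[OF im(3)] im(2))
      qed
      show "Bx h - (Bx g \<union> (\<Union>j\<in>J. Y j)) \<subseteq>
        (\<Union>j\<in>J. {x \<in> coords m. x j = rmul (a j) (g x) + \<phi> j x}) \<union>
        (\<Union>j\<in>J. \<Union>i\<in>J - {j}. {x \<in> coords m. x j = rmul (a j) (\<tau> i x) + \<phi> j x})"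
      proof
        fix x assume x: "x \<in> Bx h - (Bx g \<union> (\<Union>j\<in>J. Y j))"
        then have xc: "x \<in> coords m" and xh: "x \<in> Bx h" by (simp_all add: Bx)
        define M where "M = Max ((\<lambda>i. \<tau> i x) ` J)"
        have "M \<in> (\<lambda>i. \<tau> i x) ` J" unfolding M_def using fin J(2) by (intro Max_in) auto
        then obtain j where j: "j \<in> J" "\<tau> j x = M" by auto
        have max: "\<tau> i x \<le> \<tau> j x" if "i \<in> J" for i
          unfolding j(2) M_def using that fin by (intro Max_ge) auto
        consider "\<tau> j x = g x" | "\<tau> j x < g x" | i where "i \<in> J - {j}" "\<tau> i x = \<tau> j x"
          | "g x < \<tau> j x" "\<forall>i\<in>J - {j}. \<tau> i x \<noteq> \<tau> j x" by (meson linorder_neqE)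
        then show "x \<in> (\<Union>j\<in>J. {x \<in> coords m. x j = rmul (a j) (g x) + \<phi> j x}) \<union>
          (\<Union>j\<in>J. \<Union>i\<in>J - {j}. {x \<in> coords m. x j = rmul (a j) (\<tau> i x) + \<phi> j x})"
        proof cases
          case 1
          then show ?thesis using \<tau>_eq[OF j(1) 1] j(1) xc by blast
        next
          case 2
          have "\<tau> i x < g x" if "i \<in> J" for i using max[OF that] 2 by (rule le_less_trans)
          then have "x \<in> Bx g" using xh by (simp add: Bx)
          then show ?thesis using x by blast
        next
          case 3
          have "x j = rmul (a j) (\<tau> i x) + \<phi> j x" by (rule \<tau>_eq[OF j(1)]) (simp add: 3)
          then show ?thesis using 3(1) j(1) xc by blast
        next
          case 4
          then have "\<forall>i\<in>J - {j}. \<tau> i x < \<tau> j x" using max by (simp add: less_le)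
          then have "x \<in> Y j" using 4 xh j(1) by (simp add: Bx Y_def)
          then show ?thesis using x j(1) by blast
        qed
      qed
    qed
  qed
qed

end

section \<open>Induction on the denominators of the slopes\<close>

lemma ex_maximizer:
  fixes u :: "'a \<Rightarrow> 'b::linorder"
  assumes "finite S" "S \<noteq> {}"
  shows "\<exists>j\<in>S. \<forall>i\<in>S. u i \<le> u j"
proof -
  have "Max (u ` S) \<in> u ` S" using assms by (intro Max_in) auto
  then obtain j where "j \<in> S" "u j = Max (u ` S)" by auto
  then show ?thesis using assms(1) by (intro bexI[of _ j]) auto
qed

context scissors_closed
begin

text \<open>Only the slope in x_p is tied to the denominator \<open>N\<close>. The rest
  \<open>\<phi>\<close> may have arbitrary rational slopes, because the induction on
  \<open>N\<close> concerns x_p alone.\<close>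

definition slope_form :: "nat \<Rightarrow> nat \<Rightarrow> ((nat \<Rightarrow> 'g) \<Rightarrow> 'g) \<Rightarrow> bool" where
  "slope_form N p u \<longleftrightarrow> (\<exists>r \<phi>. affine p \<phi> \<and> u = (\<lambda>x. rmul r (x p) + \<phi> x) \<and> of_nat N * r \<in> \<int>)"

lemma slope_formI: "affine p \<phi> \<Longrightarrow> of_nat N * r \<in> \<int> \<Longrightarrow> slope_form N p (\<lambda>x. rmul r (x p) + \<phi> x)"
  unfolding slope_form_def by (intro exI[of _ r] exI[of _ \<phi>]) simp

lemma slope_formE:
  assumes "slope_form N p u"
  obtains r \<phi> where "affine p \<phi>" "u = (\<lambda>x. rmul r (x p) + \<phi> x)" "of_nat N * r \<in> \<int>"
  using assms unfolding slope_form_def by (elim exE conjE)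

lemma slope_form_affine: "slope_form N p u \<Longrightarrow> affine (Suc p) u"
  by (erule slope_formE) (simp add: affine_SucI)

definition good_slopes :: "nat \<Rightarrow> nat \<Rightarrow> bool" where
  "good_slopes p N \<longleftrightarrow> (\<forall>L f. bounded_forms (Suc p) L \<longrightarrow>
     (\<forall>i. Suc p \<le> i \<and> i < m \<longrightarrow> slope_form N p (f i)) \<longrightarrow> G (cell (Suc p) L f))"

lemma good_slopesD:
  "good_slopes p N \<Longrightarrow> bounded_forms (Suc p) L \<Longrightarrow>
    (\<And>i. Suc p \<le> i \<Longrightarrow> i < m \<Longrightarrow> slope_form N p (f i)) \<Longrightarrow> G (cell (Suc p) L f)"
  unfolding good_slopes_def by simp

text \<open>Here x_p counts as one more side of the growing box, and the cell in question is the
  piece \<open>Y p\<close>. Sides of slope 1 are equal to x_p, so their pieces are copies of it;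
  sides of slope 0 do not grow; every other piece has a smaller denominator.\<close>

lemma good_slab:
  fixes f \<phi> :: "nat \<Rightarrow> (nat \<Rightarrow> 'g) \<Rightarrow> 'g" and r :: "nat \<Rightarrow> rat"
  assumes p: "p < m" and H: "good_cells p" and N: "0 < N"
    and IH: "\<And>N'. 0 < N' \<Longrightarrow> N' < N \<Longrightarrow> good_slopes p N'"
    and C: "bounded_forms p C" and g: "affine p g" and h: "affine p h"
    and gh: "\<And>x. \<forall>c\<in>C. 0 < c x \<Longrightarrow> g x < h x"
    and \<phi>: "\<And>i. i \<in> {Suc p..<m} \<Longrightarrow> affine p (\<phi> i)"
    and f: "\<And>i. i \<in> {Suc p..<m} \<Longrightarrow> f i = (\<lambda>x. rmul (r i) (x p) + \<phi> i x)"
    and r: "\<And>i. i \<in> {Suc p..<m} \<Longrightarrow> 0 \<le> r i \<and> r i \<le> 1 \<and> of_nat N * r i \<in> \<int>"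
    and r1: "\<And>i. i \<in> {Suc p..<m} \<Longrightarrow> r i = 1 \<Longrightarrow> \<phi> i = (\<lambda>x. 0)"
  shows "G (cell (Suc p) (C \<union> {\<lambda>x. x p, \<lambda>x. x p - g x, \<lambda>x. h x - x p}) f)"
proof -
  \<comment> \<open>x_p enters the box as the side 0 < x_p < s, that is, with slope 1 and zero
    rest.\<close>
  define a where "a = r(p := 1)"
  define \<psi> where "\<psi> = \<phi>(p := \<lambda>x. 0)"
  define J where "J = insert p {i \<in> {Suc p..<m}. 0 < r i}"
  have J: "J \<subseteq> {p..<m}" "p \<in> J" using p by (auto simp: J_def)
  have fin: "finite J" using J(1) finite_subset by blast
  have a: "0 < a j \<and> a j \<le> 1 \<and> of_nat N * a j \<in> \<int>" if "j \<in> J" for j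
    using that r[of j] by (auto simp: a_def J_def)
  have \<psi>: "affine p (\<psi> j)" if "j \<in> J" for j
    using that \<phi>[of j] affine_const[OF zero_mem] by (auto simp: \<psi>_def J_def)
  have a1: "\<psi> j = (\<lambda>x. 0)" if "j \<in> J" "a j = 1" for j
    using that r1[of j] by (auto simp: \<psi>_def a_def J_def)
  have f_act: "f j = (\<lambda>x. rmul (a j) (x p) + \<psi> j x)" if "j \<in> J" "j \<noteq> p" for j
    using that f[of j] by (auto simp: \<psi>_def a_def J_def)
  have f_pas: "affine p (f i)" if "i \<in> {p..<m} - J" for i
  proof -
    have i: "i \<in> {Suc p..<m}" "r i = 0" using that r[of i] by (auto simp: J_def)
    then show ?thesis using f[OF i(1)] \<phi>[OF i(1)] by simp
  qed
  define \<tau> where "\<tau> = (\<lambda>j x. rmul (1 / a j) (x j - \<psi> j x))"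
  define Y where "Y = (\<lambda>j. {x \<in> coords m. (\<forall>c\<in>C. 0 < c x) \<and> (\<forall>i\<in>{p..<m}. 0 < x i) \<and> g x < \<tau> j x \<and> \<tau> j x < h x \<and>
      (\<forall>i\<in>J - {j}. \<tau> i x < \<tau> j x) \<and> (\<forall>i\<in>{p..<m} - J. x i < f i x)})"
  \<comment> \<open>\<open>F j u\<close> is the length of side \<open>j\<close> at height
    \<open>u\<close>.\<close>
  define F where "F = (\<lambda>j (u :: (nat \<Rightarrow> 'g) \<Rightarrow> 'g) x. rmul (a j) (u x) + \<psi> j x)"
  \<comment> \<open>The base after the exchange: the new x_p is the old x_j, which runs from the
    length of side \<open>j\<close> at height \<open>g\<close> to its length at height
    \<open>h\<close>.\<close>
  define L where "L = (\<lambda>j. C \<union> {\<lambda>x. x p, \<lambda>x. x p - F j g x, \<lambda>x. F j h x - x p})"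
  \<comment> \<open>The height is recovered from the new x_p as (x_p - \<psi>_j) / a_j. Place
    \<open>j\<close> now holds the old x_p, hence the side \<open>p\<close> there.\<close>
  define f' where "f' = (\<lambda>j i. if i \<in> J then F (if i = j then p else i) (\<lambda>x. rmul (1 / a j) (x p - \<psi> j x)) else f i)"
  define Z where "Z = (\<lambda>j. cell (Suc p) (L j) (f' j))"
  have F: "affine p (F j u)" if "j \<in> J" "affine p u" for j u
    unfolding F_def using that \<psi> by (simp add: affine_add affine_rmul)
  have Lb: "bounded_forms (Suc p) (L j)" if j: "j \<in> J" for j
  proof (rule bounded_forms_between[OF C F[OF j g] F[OF j h]])
    show "finite (L j)" using C by (simp add: L_def bounded_forms_def)
    show "affine (Suc p) l" if "l \<in> L j" for l
    proof -
      consider "l \<in> C" | "l = (\<lambda>x. x p)" | "l = (\<lambda>x. x p - F j g x)" | "l = (\<lambda>x. F j h x - x p)"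
        using \<open>l \<in> L j\<close> by (auto simp: L_def)
      then show ?thesis
      proof cases
        case 1
        then show ?thesis using C affine_Suc by (simp add: bounded_forms_def)
      qed (use F[OF j] g h in \<open>simp_all add: affine_diff affine_coord affine_Suc\<close>)
    qed
    show "(\<forall>c\<in>C. 0 < c x) \<and> F j g x < x p \<and> x p < F j h x" if "\<forall>l\<in>L j. 0 < l x" for x
      using that by (simp add: L_def ball_Un)
  qed
  \<comment> \<open>Multiplying the new slope a_i / a_j by N' = N a_j gives N a_i, an integer by
    assumption on the old slopes.\<close>
  have slope_f': "slope_form N' p (f' j i)"
    if j: "j \<in> J" and N': "of_nat N' = of_nat N * a j" and i: "Suc p \<le> i" "i < m" for j i N'
  proof (cases "i \<in> J")
    case True
    define i' where "i' = (if i = j then p else i)"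
    have i': "i' \<in> J" using True J(2) by (simp add: i'_def)
    have "F i' (\<lambda>x. rmul (1 / a j) (x p - \<psi> j x)) =
      (\<lambda>x. rmul (a i' / a j) (x p) + (rmul (- (a i' / a j)) (\<psi> j x) + \<psi> i' x))"
      by (simp add: F_def fun_eq_iff rmul.scale_right_diff_distrib rmul.scale_minus_left)
    moreover have "of_nat N' * (a i' / a j) \<in> \<int>" using a[OF j] a[OF i'] by (simp add: N')
    moreover have "affine p (\<lambda>x. rmul (- (a i' / a j)) (\<psi> j x) + \<psi> i' x)"
      using \<psi>[OF j] \<psi>[OF i'] by (intro affine_add affine_rmul)
    ultimately show ?thesis using True by (simp only: f'_def i'_def[symmetric] if_True slope_formI)
  next
    case False
    then have "affine p (f i)" using i f_pas by simp
    from slope_formI[OF this, of N' 0] show ?thesis using False by (simp add: f'_def)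
  qed
  have Z_affine: "affine (Suc p) (f' j i)" if j: "j \<in> J" and i: "Suc p \<le> i" "i < m" for j i
  proof (cases "i \<in> J")
    case True
    define i' where "i' = (if i = j then p else i)"
    have i': "i' \<in> J" using True J(2) by (simp add: i'_def)
    have "affine (Suc p) (F i' (\<lambda>x. rmul (1 / a j) (x p - \<psi> j x)))"
      unfolding F_def using \<psi>[OF j] \<psi>[OF i'] by (simp add: affine_add affine_rmul affine_diff affine_coord affine_Suc)
    then show ?thesis using True by (simp add: f'_def i'_def)
  next
    case False
    then show ?thesis using i f_pas by (simp add: f'_def affine_Suc)
  qed
  have Z_bd: "bd m (Z j)" if "j \<in> J" for j
    unfolding Z_def using Lb[OF that] Z_affine[OF that] p by (intro bd_cell) auto
  \<comment> \<open>If a_j = 1 then the rest \<psi>_j vanishes, so side \<open>j\<close> equals side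
    \<open>p\<close> and the exchange does not alter the shape of the cell.\<close>
  have Z1: "Z j = Z p" if j: "j \<in> J" "a j = 1" for j
  proof -
    have ap: "a p = 1" "\<psi> p = (\<lambda>x. 0)" by (simp_all add: a_def \<psi>_def)
    have Fj: "F j u = u" "F p u = u" for u using a1[OF j] j(2) ap by (simp_all add: F_def)
    have "f' j i = f' p i" if "Suc p \<le> i" for i
    proof (cases "i = j")
      case True
      have "f' p j = F j (\<lambda>x. x p)" "f' j j = F p (\<lambda>x. x p)"
        using j a1[OF j] ap True that by (simp_all add: f'_def)
      then show ?thesis unfolding Fj using True by simp
    next
      case False
      then show ?thesis using j a1[OF j] ap that by (simp add: f'_def)
    qed
    moreover have "L j = L p" by (simp add: L_def Fj)
    ultimately show ?thesis unfolding Z_def cell_def by simp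
  qed
  have Zp: "Z p = cell (Suc p) (C \<union> {\<lambda>x. x p, \<lambda>x. x p - g x, \<lambda>x. h x - x p}) f"
  proof -
    have ap: "a p = 1" "\<psi> p = (\<lambda>x. 0)" by (simp_all add: a_def \<psi>_def)
    have "f' p i = f i" if "Suc p \<le> i" "i < m" for i
      using that f_act[of i] ap by (simp add: f'_def F_def)
    then show ?thesis unfolding Z_def cell_def L_def by (simp add: F_def ap)
  qed
  define sw where "sw = (\<lambda>j (x :: nat \<Rightarrow> 'g). x(p := x j, j := x p))"
  have sw: "unimodular m (sw j) (sw j)" if "j \<in> J" for j
    unfolding sw_def using that J p by (intro unimodular_swap) auto
  have less_\<tau>: "s < \<tau> j x \<longleftrightarrow> rmul (a j) s + \<psi> j x < x j"
    and \<tau>_less: "\<tau> j x < s \<longleftrightarrow> x j < rmul (a j) s + \<psi> j x" if "j \<in> J" for j x s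
    unfolding \<tau>_def using less_rmul_iff[of "a j" "x j - \<psi> j x" s] rmul_less_iff'[of "a j" s "x j - \<psi> j x"] a[OF that]
    by (simp_all add: diff_less_eq less_diff_eq)
  \<comment> \<open>Exchanging x_j and x_p turns the condition that \<open>j\<close> enters last
    into the fibre bounds of \<open>Z j\<close>.\<close>
  have Y: "Y j = sw j ` Z j" if j: "j \<in> J" for j
  proof -
    have "y \<in> Y j \<longleftrightarrow> sw j y \<in> Z j" if y: "y \<in> coords m" for y
    proof -
      define x where "x = sw j y"
      have xc: "x \<in> coords m" using sw[OF j] y by (simp add: unimodular_def x_def)
      have jp: "p \<le> j" "j < m" using j J(1) by auto
      have xi: "x p = y j" "x j = y p" "\<And>i. i \<noteq> p \<Longrightarrow> i \<noteq> j \<Longrightarrow> x i = y i" by (simp_all add: x_def sw_def)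
      have u: "u x = u y" if "affine p u" for u
        using that jp by (intro affine_cong[OF that]) (simp add: xi)
      have Cxy: "(\<forall>c\<in>C. 0 < c x) \<longleftrightarrow> (\<forall>c\<in>C. 0 < c y)"
      proof -
        have "affine p c" if "c \<in> C" for c using C that by (simp add: bounded_forms_def)
        then have "0 < c x \<longleftrightarrow> 0 < c y" if "c \<in> C" for c by (subst u) (simp_all add: that)
        then show ?thesis by (rule ball_cong[OF HOL.refl])
      qed
      have pos: "0 < x p \<and> (\<forall>i. Suc p \<le> i \<and> i < m \<longrightarrow> 0 < x i) \<longleftrightarrow> (\<forall>i\<in>{p..<m}. 0 < y i)"
      proof -
        have "0 < x p \<and> (\<forall>i. Suc p \<le> i \<and> i < m \<longrightarrow> 0 < x i) \<longleftrightarrow> (\<forall>i\<in>{p..<m}. 0 < x i)"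
          using p by (auto simp: Suc_le_eq le_less[of p])
        also have "\<dots> \<longleftrightarrow> (\<forall>i\<in>{p..<m}. 0 < y i)"
          using xi jp p by (metis atLeastLessThan_iff order_refl)
        finally show ?thesis .
      qed
      have lo: "0 < x p - F j g x \<longleftrightarrow> g y < \<tau> j y" and hi: "0 < F j h x - x p \<longleftrightarrow> \<tau> j y < h y"
        by (simp_all add: F_def u g h \<psi> j xi less_\<tau> \<tau>_less)
      have fi: "x i < f' j i x \<longleftrightarrow> (if i \<in> J then \<tau> (if i = j then p else i) y < \<tau> j y else y i < f i y)"
        if i: "Suc p \<le> i" "i < m" for i
      proof (cases "i \<in> J")
        case True
        define i' where "i' = (if i = j then p else i)"
        have i': "i' \<in> J" "x i = y i'" using True J(2) i by (auto simp: i'_def xi)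
        have "x i < f' j i x \<longleftrightarrow> y i' < rmul (a i') (\<tau> j y) + \<psi> i' y"
          using True i' by (simp add: f'_def i'_def[symmetric] F_def u \<psi> j xi \<tau>_def)
        also have "\<dots> \<longleftrightarrow> \<tau> i' y < \<tau> j y" by (simp only: \<tau>_less[OF i'(1)])
        finally show ?thesis using True by (simp only: i'_def if_True)
      next
        case False
        then have "i \<noteq> j" "i \<noteq> p" using i j by auto
        then show ?thesis using False i by (simp add: f'_def u f_pas xi)
      qed
      have upper: "(\<forall>i. Suc p \<le> i \<and> i < m \<longrightarrow> x i < f' j i x) \<longleftrightarrow>
          (\<forall>i\<in>J - {j}. \<tau> i y < \<tau> j y) \<and> (\<forall>i\<in>{p..<m} - J. y i < f i y)" (is "?l \<longleftrightarrow> ?r")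
      proof
        assume l: ?l
        have "\<tau> i y < \<tau> j y" if i: "i \<in> J - {j}" for i
        proof (cases "i = p")
          case True
          then have "Suc p \<le> j" "j < m" "j \<in> J" using i jp j by auto
          then show ?thesis using l fi[of j] True by simp
        next
          case False
          then have "Suc p \<le> i" "i < m" using i J(1) by auto
          then show ?thesis using l fi[of i] i by simp
        qed
        moreover have "y i < f i y" if i: "i \<in> {p..<m} - J" for i
        proof -
          have "i \<noteq> p" using i J(2) by auto
          then have "Suc p \<le> i" "i < m" using i by auto
          then show ?thesis using l fi[of i] i by simp
        qed
        ultimately show ?r by blast
      next
        assume rr: ?r
        show ?l
        proof (intro allI impI)
          fix i assume i: "Suc p \<le> i \<and> i < m"
          show "x i < f' j i x"
          proof (cases "i \<in> J")
            case True
            have "(if i = j then p else i) \<in> J - {j}" using True i J(2) by auto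
            then show ?thesis using rr fi[of i] i True by simp
          next
            case False
            then show ?thesis using rr fi[of i] i by simp
          qed
        qed
      qed
      have "x \<in> Z j \<longleftrightarrow> (\<forall>c\<in>C. 0 < c x) \<and> (0 < x p \<and> (\<forall>i. Suc p \<le> i \<and> i < m \<longrightarrow> 0 < x i)) \<and>
          0 < x p - F j g x \<and> 0 < F j h x - x p \<and> (\<forall>i. Suc p \<le> i \<and> i < m \<longrightarrow> x i < f' j i x)"
        unfolding Z_def cell_def L_def using xc by (simp add: ball_Un) blast
      also have "\<dots> \<longleftrightarrow> y \<in> Y j"
        unfolding Cxy pos lo hi upper Y_def using y by simp
      finally show ?thesis by (simp add: x_def)
    qed
    moreover have "Y j \<subseteq> coords m" by (auto simp: Y_def)
    ultimately show ?thesis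
      unfolding unimodular_image[OF sw[OF j] dset_coords[OF bd_dset[OF Z_bd[OF j]]]] by blast
  qed
  have bdY: "bd m (Y j)" if "j \<in> J" for j
    unfolding Y[OF that] using bd_image[OF sw[OF that] Z_bd[OF that]] .
  have apos: "0 < a j" if "j \<in> J" for j using a[OF that] by simp
  have disj: "disjoint_family_on Y J"
    by (rule by_parts(1)[OF p H C g h _ J _ _ _ \<tau>_def Y_def]; (rule gh apos \<psi> f_pas bdY; assumption))
  have GY: "G (\<Union>j\<in>J. Y j)"
    by (rule by_parts(2)[OF p H C g h _ J _ _ _ \<tau>_def Y_def]; (rule gh apos \<psi> f_pas bdY; assumption))
  define J1 where "J1 = {j \<in> J. a j = 1}"
  have J1: "J1 \<subseteq> J" "finite J1" "p \<in> J1" using fin J(2) by (auto simp: J1_def a_def)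
  have GZ: "G (Z j)" if j: "j \<in> J - J1" for j
  proof -
    have jJ: "j \<in> J" and aj: "0 < a j" "a j < 1" using j a[of j] by (auto simp: J1_def)
    obtain k where k: "of_nat N * a j = of_int k" using a[OF jJ] by (auto elim: Ints_cases)
    have "0 < of_nat N * a j" "of_nat N * a j < of_nat N" using aj N by simp_all
    then have "0 < rat_of_int k" "rat_of_int k < rat_of_int (int N)" unfolding k by simp_all
    then have "0 < k" "k < int N" by (simp_all only: of_int_0_less_iff of_int_less_iff)
    \<comment> \<open>N a_j is an integer strictly between 0 and \<open>N\<close>, so it is an
      admissible smaller denominator.\<close>
    then obtain N' where N': "k = int N'" "0 < N'" "N' < N" by (metis of_nat_0_less_iff of_nat_less_iff pos_int_cases)
    show ?thesis
      unfolding Z_def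
      by (rule good_slopesD[OF IH[OF N'(2,3)] Lb[OF jJ] slope_f'[OF jJ]]) (simp_all add: k N'(1))
  qed
  have "G (\<Union>j\<in>J - J1. Y j)"
  proof (rule G_disjoint_UN)
    show "G (Y j)" if "j \<in> J - J1" for j
      using GZ[OF that] Y[of j] G_image[OF sw Z_bd] that by simp
    show "disjoint_family_on Y (J - J1)" using disj by (rule disjoint_family_on_mono[rotated]) auto
  qed (use fin bdY in auto)
  moreover have "(\<Union>j\<in>J - J1. Y j) \<inter> (\<Union>j\<in>J1. Y j) = {}"
  proof -
    have "Y j \<inter> Y k = {}" if "j \<in> J - J1" "k \<in> J1" for j k
      by (rule disjoint_family_onD[OF disj]) (use that J1(1) in auto)
    then show ?thesis by (simp add: Int_UN_distrib2)
  qed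
  moreover have "(\<Union>j\<in>J. Y j) = (\<Union>j\<in>J - J1. Y j) \<union> (\<Union>j\<in>J1. Y j)" using J1(1) by blast
  moreover have "bd m (\<Union>j\<in>J - J1. Y j)" "bd m (\<Union>j\<in>J1. Y j)"
    using fin bdY J1 by (auto intro!: bd_UN)
  ultimately have "G (\<Union>j\<in>J1. Y j)" using G_cancel GY by metis
  moreover have YZ: "Y j = sw j ` Z p" if "j \<in> J1" for j
    using that Y[of j] Z1[of j] by (simp add: J1_def)
  ultimately have "G (\<Union>j\<in>J1. sw j ` Z p)" by simp
  moreover have "disjoint_family_on (\<lambda>j. sw j ` Z p) J1"
    using disj J1(1) YZ unfolding disjoint_family_on_def by (metis subset_iff)
  \<comment> \<open>Only copies of \<open>Z p\<close> remain. Their number is not 0, since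
    \<open>p\<close> itself belongs to \<open>J1\<close>.\<close>
  ultimately have "G (Z p)"
    using J1 sw by (intro G_divide[OF Z_bd[OF J(2)], of J1 sw sw]) auto
  then show ?thesis by (simp only: Zp)
qed

end

section \<open>Reduction of arbitrary slopes to slopes between 0 and 1\<close>

lemma unimodular_reflect:
  assumes "i < m" "j < m" "i \<noteq> j"
  shows "unimodular m (\<lambda>x. x(i := zmul k (x j) - x i)) (\<lambda>x. x(i := zmul k (x j) - x i))"
proof -
  have il: "int_linear m (\<lambda>x. (x(i := zmul k (x j) - x i)) l)" if "l < m" for l
  proof (cases "l = i")
    case True
    have "int_linear m (\<lambda>x. zmul k (x j) + zmul (- 1) (x i))"
      using assms by (intro int_linear_add int_linear_zmul int_linear_coord)
    then show ?thesis using True by (simp add: zmul.scale_minus_left)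
  qed (use assms that in \<open>simp add: int_linear_coord\<close>)
  then show ?thesis
    unfolding unimodular_def using assms
    by (intro conjI allI impI ballI il) (simp_all add: coords_def fun_eq_iff)
qed

lemma ex_common_denominator: "\<exists>N>0. \<forall>i<n. of_nat N * (r i :: rat) \<in> \<int>" for n :: nat
proof (induction n)
  case (Suc n)
  then obtain N where N: "N > 0" "\<forall>i<n. of_nat N * r i \<in> \<int>" by blast
  obtain a b where r: "r n = of_int a / of_int b" "b > 0" using rat_quotient[of "r n"] by blast
  obtain k where k: "b = int k" using r(2) by (metis zero_less_imp_eq_int)
  have "of_nat (N * k) * r i \<in> \<int>" if "i < Suc n" for i
  proof (cases "i = n")
    case True
    have "of_nat (N * k) * r n = of_int (int N * a)" using r by (simp add: k)
    then show ?thesis using True by (simp only: Ints_of_int)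
  next
    case False
    then have "of_nat N * r i \<in> \<int>" using N(2) that by simp
    from Ints_mult[OF Ints_of_nat[of k] this] have "of_nat k * (of_nat N * r i) \<in> \<int>" .
    then show ?thesis by (simp add: mult_ac)
  qed
  then show ?case using N(1) r(2) k by (intro exI[of _ "N * k"]) auto
qed auto

context scissors_closed
begin

text \<open>Slope \<open>1\<close> is only admitted for \<open>x\<^sub>p\<close> itself, because the exchange of \<open>x\<^sub>i\<close> and \<open>x\<^sub>p\<close> then
  preserves the cell.\<close>

definition normal_form :: "nat \<Rightarrow> nat \<Rightarrow> ((nat \<Rightarrow> 'g) \<Rightarrow> 'g) \<Rightarrow> rat \<Rightarrow> ((nat \<Rightarrow> 'g) \<Rightarrow> 'g) \<Rightarrow> bool" where
  "normal_form N p u r \<phi> \<longleftrightarrow> affine p \<phi> \<and> u = (\<lambda>x. rmul r (x p) + \<phi> x) \<and>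
     0 \<le> r \<and> r \<le> 1 \<and> of_nat N * r \<in> \<int> \<and> (r = 1 \<longrightarrow> \<phi> = (\<lambda>x. 0))"

definition normal :: "nat \<Rightarrow> nat \<Rightarrow> ((nat \<Rightarrow> 'g) \<Rightarrow> 'g) \<Rightarrow> bool" where
  "normal N p u \<longleftrightarrow> (\<exists>r \<phi>. normal_form N p u r \<phi>)"

lemma normalI: "affine p \<phi> \<Longrightarrow> 0 \<le> r \<Longrightarrow> r < 1 \<Longrightarrow> of_nat N * r \<in> \<int> \<Longrightarrow> normal N p (\<lambda>x. rmul r (x p) + \<phi> x)"
  unfolding normal_def normal_form_def by (intro exI[of _ r] exI[of _ \<phi>]) simp

lemma normal_coord: "normal N p (\<lambda>x. x p)"
  unfolding normal_def normal_form_def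
  by (intro exI[of _ 1] exI[of _ "\<lambda>x. 0"]) (simp add: affine_const zero_mem)

lemma normal_slope_form: "normal N p u \<Longrightarrow> slope_form N p u"
  unfolding normal_def normal_form_def slope_form_def by (elim exE conjE, intro exI conjI)

text \<open>The base is cut according to which lower bound of x_p is the largest and which upper
  bound the least; over each part the cell is a slab.\<close>

lemma good_normal:
  assumes p: "p < m" and H: "good_cells p" and N: "0 < N"
    and IH: "\<And>N'. 0 < N' \<Longrightarrow> N' < N \<Longrightarrow> good_slopes p N'"
    and L: "bounded_forms (Suc p) L" and s: "(\<lambda>x. x p) \<in> L"
    and f: "\<And>i. i \<in> {Suc p..<m} \<Longrightarrow> normal N p (f i)"
  shows "G (cell (Suc p) L f)"
proof -
  define r where "r = (\<lambda>i. SOME r. \<exists>\<phi>. normal_form N p (f i) r \<phi>)"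
  define \<phi> where "\<phi> = (\<lambda>i. SOME \<phi>. normal_form N p (f i) (r i) \<phi>)"
  have nf: "normal_form N p (f i) (r i) (\<phi> i)" if "i \<in> {Suc p..<m}" for i
  proof -
    have "\<exists>\<phi>. normal_form N p (f i) (r i) \<phi>"
      unfolding r_def by (rule someI_ex) (use f[OF that] in \<open>simp add: normal_def\<close>)
    then show ?thesis unfolding \<phi>_def by (rule someI_ex)
  qed
  have f_affine: "affine (Suc p) (f i)" if "i \<in> {Suc p..<m}" for i
    using slope_form_affine[OF normal_slope_form[OF f[OF that]]] .
  define X where "X = cell (Suc p) L f"
  have bdX: "bd m X" unfolding X_def using L f_affine p by (intro bd_cell) auto
  obtain \<gamma> where Lfin: "finite L" "\<forall>l\<in>L. affine (Suc p) l"
    and \<gamma>: "\<forall>x\<in>{x \<in> coords m. \<forall>l\<in>L. 0 < l x}. \<forall>i<Suc p. - \<gamma> \<le> x i \<and> x i \<le> \<gamma>"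
    using L by (rule bounded_formsE)
  have bnd: "- \<gamma> \<le> x i \<and> x i \<le> \<gamma>" if "x \<in> coords m" "\<forall>l\<in>L. 0 < l x" "i < Suc p" for x i
    using bspec[OF \<gamma>, of x] that by simp
  obtain L0 Ls Us where "slice_bounds p L L0 Ls Us" using ex_slice_bounds[OF Lfin] by (elim exE)
  then have fin: "finite L0" "finite Ls" "finite Us"
    and aff: "\<And>l. l \<in> L0 \<Longrightarrow> affine p l" "\<And>l. l \<in> Ls \<Longrightarrow> affine p l" "\<And>l. l \<in> Us \<Longrightarrow> affine p l"
    and iff: "\<And>x. (\<forall>l\<in>L. 0 < l x) \<longleftrightarrow> (\<forall>l\<in>L0. 0 < l x) \<and> (\<forall>g\<in>Ls. g x < x p) \<and> (\<forall>h\<in>Us. x p < h x)"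
    by (simp_all add: slice_bounds_def)
  have inv: "l (x(p := v)) = l x" if "affine p l" for l x v
    using that by (rule affine_upd) simp
  have raise: "(\<forall>l\<in>L. 0 < l (x(p := v))) \<longleftrightarrow> (\<forall>l\<in>L0. 0 < l x) \<and> (\<forall>g\<in>Ls. g x < v) \<and> (\<forall>h\<in>Us. v < h x)" for x v
  proof -
    have 1: "(\<forall>l\<in>L0. 0 < l (x(p := v))) \<longleftrightarrow> (\<forall>l\<in>L0. 0 < l x)"
      by (rule ball_cong[OF HOL.refl]) (simp add: inv aff)
    have 2: "(\<forall>l\<in>Ls. l (x(p := v)) < v) \<longleftrightarrow> (\<forall>l\<in>Ls. l x < v)"
      by (rule ball_cong[OF HOL.refl]) (simp add: inv aff)
    have 3: "(\<forall>l\<in>Us. v < l (x(p := v))) \<longleftrightarrow> (\<forall>l\<in>Us. v < l x)"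
      by (rule ball_cong[OF HOL.refl]) (simp add: inv aff)
    show ?thesis unfolding iff using 1 2 3 by simp
  qed
  \<comment> \<open>A missing bound would allow x_p to be moved: down to 0, against the form x_p in
    \<open>L\<close>, or up beyond the bound \<open>\<gamma>\<close>.\<close>
  have nonempty: "Ls \<noteq> {} \<and> Us \<noteq> {}" if x: "x \<in> coords m" "\<forall>l\<in>L. 0 < l x" for x
  proof
    show "Ls \<noteq> {}"
    proof
      assume e: "Ls = {}"
      have "0 < x p" using x(2) s by (rule bspec)
      moreover have "\<forall>h\<in>Us. x p < h x" using x(2) by (simp add: iff)
      ultimately have "\<forall>h\<in>Us. 0 < h x" using less_trans by blast
      then have "\<forall>l\<in>L. 0 < l (x(p := 0))" using x(2) by (simp add: raise iff e)
      from bspec[OF this s] show False by simp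
    qed
    show "Us \<noteq> {}"
    proof
      assume e: "Us = {}"
      obtain v where v: "v > max (x p) \<gamma>" using exists_greater by blast
      then have v': "x p < v" "\<gamma> < v" by simp_all
      have "\<forall>g\<in>Ls. g x < x p" using x(2) by (simp add: iff)
      then have "\<forall>g\<in>Ls. g x < v" using v'(1) less_trans by blast
      then have "\<forall>l\<in>L. 0 < l (x(p := v))" using x(2) by (simp add: raise iff e)
      moreover have "x(p := v) \<in> coords m" using x(1) p by (rule coords_upd)
      ultimately have "(x(p := v)) p \<le> \<gamma>" using bnd[of "x(p := v)" p] by simp
      then show False using v'(2) by simp
    qed
  qed
  \<comment> \<open>Eliminates x_p: \<open>g\<close> is strictly the largest lower bound,
    \<open>h\<close> strictly the least upper bound, and there is room between them.\<close>
  define C where "C = (\<lambda>g h. L0 \<union> (\<lambda>g' x. g x - g' x) ` (Ls - {g}) \<union> (\<lambda>h' x. h' x - h x) ` (Us - {h}) \<union> {\<lambda>x. h x - g x})"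
  have C: "(\<forall>c\<in>C g h. 0 < c x) \<longleftrightarrow> (\<forall>l\<in>L0. 0 < l x) \<and> (\<forall>g'\<in>Ls - {g}. g' x < g x) \<and>
      (\<forall>h'\<in>Us - {h}. h x < h' x) \<and> g x < h x" for g h x
    unfolding C_def ball_Un by simp
  have C_L: "\<forall>l\<in>L. 0 < l (x(p := v))" if "\<forall>c\<in>C g h. 0 < c x" "g x < v" "v < h x" for g h x v
  proof -
    have "g' x < v" if "g' \<in> Ls" for g'
      using that \<open>\<forall>c\<in>C g h. 0 < c x\<close> \<open>g x < v\<close> unfolding C by (cases "g' = g") (auto intro: less_trans)
    moreover have "v < h' x" if "h' \<in> Us" for h'
      using that \<open>\<forall>c\<in>C g h. 0 < c x\<close> \<open>v < h x\<close> unfolding C by (cases "h' = h") (auto intro: less_trans)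
    ultimately show ?thesis using that(1) unfolding raise C by simp
  qed
  have C_bounded: "bounded_forms p (C g h)" if gh: "g \<in> Ls" "h \<in> Us" for g h
  proof (rule bounded_formsI[of _ _ \<gamma>])
    show "finite (C g h)" using fin by (simp add: C_def)
    have "\<forall>l\<in>C g h. affine p l" unfolding C_def by (simp add: ball_Un aff gh affine_diff)
    then show "affine p l" if "l \<in> C g h" for l using that by (rule bspec)
    fix x i assume x: "x \<in> coords m" "\<forall>l\<in>C g h. 0 < l x" and i: "i < p"
    have "g x < h x" using x(2) unfolding C by simp
    \<comment> \<open>By density some value of x_p between the two bounds completes the base point
      to one satisfying \<open>L\<close>, from which the bound on the earlier coordinates is
      inherited.\<close>
    then obtain v where v: "g x < v" "v < h x" using exists_between by blast
    have "\<forall>l\<in>L. 0 < l (x(p := v))" using C_L[OF x(2) v] .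
    moreover have "x(p := v) \<in> coords m" using x(1) p by (rule coords_upd)
    ultimately have "- \<gamma> \<le> (x(p := v)) i \<and> (x(p := v)) i \<le> \<gamma>" using bnd[of "x(p := v)" i] i by simp
    then show "- \<gamma> \<le> x i \<and> x i \<le> \<gamma>" using i by simp
  qed
  define P where "P = (\<lambda>gh. cell (Suc p) (C (fst gh) (snd gh) \<union>
      {\<lambda>x. x p, \<lambda>x. x p - fst gh x, \<lambda>x. snd gh x - x p}) f)"
  have P: "x \<in> P gh \<longleftrightarrow> x \<in> coords m \<and> (\<forall>c\<in>C (fst gh) (snd gh). 0 < c x) \<and> 0 < x p \<and> fst gh x < x p \<and> x p < snd gh x \<and>
      (\<forall>i. Suc p \<le> i \<and> i < m \<longrightarrow> 0 < x i \<and> x i < f i x)" for x gh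
    unfolding P_def cell_def ball_Un by auto
  have "G X"
  proof (rule G_pieces[OF bdX, of "Ls \<times> Us" P])
    show "finite (Ls \<times> Us)" using fin by simp
  next
    fix gh assume "gh \<in> Ls \<times> Us"
    then have gh: "fst gh \<in> Ls" "snd gh \<in> Us" by auto
    note Cb = C_bounded[OF gh]
    show "P gh \<subseteq> X"
    proof
      fix x assume x: "x \<in> P gh"
      then have "\<forall>l\<in>L. 0 < l (x(p := x p))" unfolding P by (intro C_L) auto
      then show "x \<in> X" using x unfolding P X_def cell_def by simp
    qed
    show "bd m (P gh)" unfolding P_def
    proof (rule bd_cell)
      show "bounded_forms (Suc p) (C (fst gh) (snd gh) \<union> {\<lambda>x. x p, \<lambda>x. x p - fst gh x, \<lambda>x. snd gh x - x p})"
      proof (rule bounded_forms_between[OF Cb aff(2)[OF gh(1)] aff(3)[OF gh(2)]])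
        show "finite (C (fst gh) (snd gh) \<union> {\<lambda>x. x p, \<lambda>x. x p - fst gh x, \<lambda>x. snd gh x - x p})"
          using Cb by (simp add: bounded_forms_def)
        have "\<forall>l\<in>C (fst gh) (snd gh). affine (Suc p) l"
          using Cb by (simp add: bounded_forms_def affine_Suc)
        then have "\<forall>l\<in>C (fst gh) (snd gh) \<union> {\<lambda>x. x p, \<lambda>x. x p - fst gh x, \<lambda>x. snd gh x - x p}. affine (Suc p) l"
          by (simp add: ball_Un affine_Suc affine_diff affine_coord aff gh)
        then show "affine (Suc p) l"
          if "l \<in> C (fst gh) (snd gh) \<union> {\<lambda>x. x p, \<lambda>x. x p - fst gh x, \<lambda>x. snd gh x - x p}" for l
          using that by (rule bspec)
      qed (simp add: ball_Un)
    qed (use f_affine p in auto)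
    show "G (P gh)" unfolding P_def
    proof (rule good_slab[OF p H N IH Cb aff(2)[OF gh(1)] aff(3)[OF gh(2)], of \<phi> f r])
      show "fst gh x < snd gh x" if "\<forall>c\<in>C (fst gh) (snd gh). 0 < c x" for x using that unfolding C by simp
    qed (use nf in \<open>auto simp: normal_form_def\<close>)
  next
    show "disjoint_family_on P (Ls \<times> Us)"
      unfolding disjoint_family_on_def
    proof (intro ballI impI)
      fix gh gh' assume *: "gh \<in> Ls \<times> Us" "gh' \<in> Ls \<times> Us" "gh \<noteq> gh'"
      have False if x: "x \<in> P gh" "x \<in> P gh'" for x
      proof -
        have "fst gh = fst gh'"
        proof (rule ccontr)
          assume "fst gh \<noteq> fst gh'"
          then have "fst gh x < fst gh' x" "fst gh' x < fst gh x" using x * unfolding P C by auto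
          then show False by simp
        qed
        moreover have "snd gh = snd gh'"
        proof (rule ccontr)
          assume "snd gh \<noteq> snd gh'"
          then have "snd gh x < snd gh' x" "snd gh' x < snd gh x" using x * unfolding P C by auto
          then show False by simp
        qed
        ultimately show False using *(3) by (simp add: prod_eq_iff)
      qed
      then show "P gh \<inter> P gh' = {}" by blast
    qed
    show "thin (X - (\<Union>gh\<in>Ls \<times> Us. P gh))"
    proof (rule thin_subset)
      \<comment> \<open>The missed points have a tie between two lower bounds or between two upper
        bounds.\<close>
      show "thin ((\<Union>g\<in>Ls. \<Union>g'\<in>Ls - {g}. {x \<in> coords m. g x = g' x}) \<union>
          (\<Union>h\<in>Us. \<Union>h'\<in>Us - {h}. {x \<in> coords m. h x = h' x}))"
      proof (intro thin_Un thin_UN fin finite_Diff)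
        fix g g' assume "g \<in> Ls" "g' \<in> Ls - {g}"
        then show "thin {x \<in> coords m. g x = g' x}"
          using p aff(2) affine_mono[of p _ m] by (intro thin_eq) auto
      next
        fix g g' assume "g \<in> Us" "g' \<in> Us - {g}"
        then show "thin {x \<in> coords m. g x = g' x}"
          using p aff(3) affine_mono[of p _ m] by (intro thin_eq) auto
      qed
      show "X - (\<Union>gh\<in>Ls \<times> Us. P gh) \<subseteq> (\<Union>g\<in>Ls. \<Union>g'\<in>Ls - {g}. {x \<in> coords m. g x = g' x}) \<union>
          (\<Union>h\<in>Us. \<Union>h'\<in>Us - {h}. {x \<in> coords m. h x = h' x})"
      proof
        fix x assume x: "x \<in> X - (\<Union>gh\<in>Ls \<times> Us. P gh)"
        then have xX: "x \<in> coords m" "\<forall>l\<in>L. 0 < l x" "\<forall>i. Suc p \<le> i \<and> i < m \<longrightarrow> 0 < x i \<and> x i < f i x"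
          by (simp_all add: X_def cell_def)
        have ne: "Ls \<noteq> {}" "Us \<noteq> {}" using nonempty[OF xX(1,2)] by simp_all
        obtain g where g: "g \<in> Ls" "\<forall>g'\<in>Ls. g' x \<le> g x"
          using ex_maximizer[OF fin(2) ne(1), of "\<lambda>g. g x"] by (elim bexE)
        obtain h where h: "h \<in> Us" "\<forall>h'\<in>Us. - h' x \<le> - h x"
          using ex_maximizer[OF fin(3) ne(2), of "\<lambda>h. - h x"] by (elim bexE)
        have xp: "0 < x p" "g x < x p" "x p < h x"
          using bspec[OF xX(2) s] xX(2) g(1) h(1) by (simp_all add: iff)
        consider g' where "g' \<in> Ls - {g}" "g x = g' x" | h' where "h' \<in> Us - {h}" "h x = h' x"
          | "\<forall>g'\<in>Ls - {g}. g' x \<noteq> g x" "\<forall>h'\<in>Us - {h}. h x \<noteq> h' x" by metis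
        then show "x \<in> (\<Union>g\<in>Ls. \<Union>g'\<in>Ls - {g}. {x \<in> coords m. g x = g' x}) \<union>
          (\<Union>h\<in>Us. \<Union>h'\<in>Us - {h}. {x \<in> coords m. h x = h' x})"
        proof cases
          case 1
          then show ?thesis using g(1) xX(1) by (intro UnI1 UN_I[OF g(1)] UN_I[OF 1(1)]) simp
        next
          case 2
          then show ?thesis using h(1) xX(1) by (intro UnI2 UN_I[OF h(1)] UN_I[OF 2(1)]) simp
        next
          case 3
          have "\<forall>g'\<in>Ls - {g}. g' x < g x" using 3(1) g(2) by (simp add: less_le)
          moreover have "\<forall>h'\<in>Us - {h}. h x < h' x" using 3(2) h(2) by (simp add: less_le)
          moreover have "g x < h x" using xp by order
          moreover have "\<forall>l\<in>L0. 0 < l x" using xX(2) by (simp add: iff)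
          ultimately have "x \<in> P (g, h)" using xX xp by (simp add: P C)
          then show ?thesis using x g(1) h(1) by blast
        qed
      qed
    qed
  qed
  then show ?thesis by (simp only: X_def)
qed

end

lemma zmul_nonneg: "0 \<le> k \<Longrightarrow> 0 \<le> x \<Longrightarrow> 0 \<le> zmul k (x :: 'a :: linordered_ab_group_add)"
  using zmul_pos[of k x] by (cases "k = 0"; cases "x = 0") (simp_all add: less_imp_le le_less)

context scissors_closed
begin

lemma cell_upd:
  assumes "q \<le> k" "k < m"
  shows "x \<in> cell q L (f(k := u)) \<longleftrightarrow> x \<in> coords m \<and> (\<forall>l\<in>L. 0 < l x) \<and>
    (\<forall>i. q \<le> i \<and> i < m \<and> i \<noteq> k \<longrightarrow> 0 < x i \<and> x i < f i x) \<and> 0 < x k \<and> x k < u x"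
proof -
  have "(\<forall>i. q \<le> i \<and> i < m \<longrightarrow> 0 < x i \<and> x i < (f(k := u)) i x) \<longleftrightarrow>
      (\<forall>i. q \<le> i \<and> i < m \<and> i \<noteq> k \<longrightarrow> 0 < x i \<and> x i < f i x) \<and> 0 < x k \<and> x k < u x"
    (is "?l \<longleftrightarrow> ?r")
  proof
    assume l: ?l
    have "0 < x i \<and> x i < f i x" if "q \<le> i \<and> i < m \<and> i \<noteq> k" for i
      using l[rule_format, of i] that by simp
    then show ?r using l[rule_format, of k] assms by simp
  next
    assume ?r
    then show ?l by (metis fun_upd_apply)
  qed
  then show ?thesis unfolding cell_def by simp
qed

lemma bd_cell_upd:
  assumes "bounded_forms q L" "\<And>i. i \<in> {q..<m} \<Longrightarrow> affine q (f i)" "affine q u" "q \<le> m"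
  shows "bd m (cell q L (f(k := u)))"
proof (rule bd_cell[OF assms(1) _ assms(4)])
  show "affine q ((f(k := u)) i)" if "q \<le> i" "i < m" for i
    using assms(2)[of i] assms(3) that by (cases "i = k") simp_all
qed

text \<open>Forms of level \<open>q\<close> do not see coordinate \<open>k\<close>, since q \<le> k.
  Moving it affects only its own two bounds.\<close>

lemma cell_move:
  assumes k: "q \<le> k" "k < m" and L: "bounded_forms q L"
    and f: "\<And>i. i \<in> {q..<m} \<Longrightarrow> affine q (f i)" and u: "affine q u" and x: "x \<in> coords m"
  shows "x(k := v) \<in> cell q L (f(k := u)) \<longleftrightarrow> (\<forall>l\<in>L. 0 < l x) \<and>
    (\<forall>i. q \<le> i \<and> i < m \<and> i \<noteq> k \<longrightarrow> 0 < x i \<and> x i < f i x) \<and> 0 < v \<and> v < u x"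
proof -
  have inv: "l (x(k := v)) = l x" if "affine q l" for l using that k(1) by (rule affine_upd)
  have "\<forall>l\<in>L. affine q l" using L by (simp add: bounded_forms_def)
  then have "(\<forall>l\<in>L. 0 < l (x(k := v))) \<longleftrightarrow> (\<forall>l\<in>L. 0 < l x)"
    by (intro ball_cong[OF HOL.refl]) (simp add: inv)
  moreover have "(\<forall>i. q \<le> i \<and> i < m \<and> i \<noteq> k \<longrightarrow> 0 < (x(k := v)) i \<and> (x(k := v)) i < f i (x(k := v))) \<longleftrightarrow>
    (\<forall>i. q \<le> i \<and> i < m \<and> i \<noteq> k \<longrightarrow> 0 < x i \<and> x i < f i x)"
  proof -
    have "f i (x(k := v)) = f i x" if "q \<le> i" "i < m" for i using that f by (intro inv) simp
    then show ?thesis by (metis fun_upd_apply)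
  qed
  moreover have "x(k := v) \<in> coords m" using x k(2) by (rule coords_upd)
  ultimately show ?thesis unfolding cell_upd[OF k] inv[OF u] by simp
qed

lemma affine_multiple: "p < q \<Longrightarrow> affine q (\<lambda>x. zmul (int M) (x p))"
  by (intro affine_zmul affine_coord)

text \<open>Write s for x_p. The fibre 0 < x_k < u + M s is cut at M s, and its upper part is the
  shear of the fibre 0 < x_k < u. Positivity of \<open>u\<close> and s on the base keeps the cut
  inside the fibre.\<close>

lemma shear_cell:
  fixes M :: nat
  assumes k: "Suc p \<le> k" "k < m" and L: "bounded_forms (Suc p) L"
    and f: "\<And>i. i \<in> {Suc p..<m} \<Longrightarrow> affine (Suc p) (f i)" and u: "affine (Suc p) u"
    and s: "(\<lambda>x. x p) \<in> L" and uL: "u \<in> L"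
  defines "X \<equiv> cell (Suc p) L (f(k := \<lambda>x. u x + zmul (int M) (x p)))"
    and "Y \<equiv> cell (Suc p) L (f(k := \<lambda>x. zmul (int M) (x p)))"
    and "Z \<equiv> cell (Suc p) L (f(k := u))"
  shows "G Y \<Longrightarrow> G Z \<Longrightarrow> G X" "G X \<Longrightarrow> G Y \<Longrightarrow> G Z"
proof -
  define T T' where "T = (\<lambda>x :: nat \<Rightarrow> 'g. x(k := x k + zmul (int M) (x p)))"
    and "T' = (\<lambda>x :: nat \<Rightarrow> 'g. x(k := x k + zmul (- int M) (x p)))"
  have T: "unimodular m T T'" unfolding T_def T'_def using k by (intro unimodular_shear) auto
  have pm: "Suc p \<le> m" using k by simp
  have ms: "affine (Suc p) (\<lambda>x. zmul (int M) (x p))" by (rule affine_multiple) simp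
  have bds: "bd m X" "bd m Y" "bd m Z"
    unfolding X_def Y_def Z_def using L f u ms pm by (intro bd_cell_upd affine_add; simp)+
  have TZ: "y \<in> T ` Z \<longleftrightarrow> y \<in> coords m \<and> (\<forall>l\<in>L. 0 < l y) \<and>
      (\<forall>i. Suc p \<le> i \<and> i < m \<and> i \<noteq> k \<longrightarrow> 0 < y i \<and> y i < f i y) \<and>
      zmul (int M) (y p) < y k \<and> y k < u y + zmul (int M) (y p)" for y
  proof (cases "y \<in> coords m")
    case True
    have "y \<in> T ` Z \<longleftrightarrow> T' y \<in> Z"
      using True unimodular_image[OF T dset_coords[OF bd_dset[OF bds(3)]]] by simp
    also have "\<dots> \<longleftrightarrow> (\<forall>l\<in>L. 0 < l y) \<and>
      (\<forall>i. Suc p \<le> i \<and> i < m \<and> i \<noteq> k \<longrightarrow> 0 < y i \<and> y i < f i y) \<and>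
      0 < y k + zmul (- int M) (y p) \<and> y k + zmul (- int M) (y p) < u y"
      unfolding T'_def Z_def by (rule cell_move[OF k L f u True])
    finally show ?thesis using True by (simp add: zmul.scale_minus_left diff_less_eq)
  next
    case False
    then show ?thesis using dset_coords[OF bd_dset[OF bd_image[OF T bds(3)]]] by blast
  qed
  have pos: "0 < y p" "0 < u y" "0 \<le> zmul (int M) (y p)" if "\<forall>l\<in>L. 0 < l y" for y
    using bspec[OF that s] bspec[OF that uL] by (simp_all add: zmul_nonneg)
  have sub: "Y \<subseteq> X" "T ` Z \<subseteq> X" "Y \<inter> T ` Z = {}"
  proof -
    show "Y \<subseteq> X"
    proof
      fix y assume y: "y \<in> Y"
      then have "zmul (int M) (y p) < u y + zmul (int M) (y p)" using pos(2) by (simp add: Y_def cell_upd k)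
      then show "y \<in> X" using y by (auto simp: Y_def X_def cell_upd k intro: less_trans)
    qed
    show "T ` Z \<subseteq> X"
    proof
      fix y assume y: "y \<in> T ` Z"
      then have "0 < y k" using pos(3)[of y] unfolding TZ by (auto intro: le_less_trans)
      then show "y \<in> X" using y unfolding TZ X_def cell_upd[OF k] by simp
    qed
    show "Y \<inter> T ` Z = {}"
    proof -
      have False if "y \<in> Y" "y \<in> T ` Z" for y
        using that unfolding TZ by (auto simp: Y_def cell_upd k)
      then show ?thesis by blast
    qed
  qed
  have thin: "thin (X - (Y \<union> T ` Z))"
  proof (rule thin_subset)
    show "thin {x \<in> coords m. x k = zmul (int M) (x p)}"
      using k by (intro thin_graph affine_multiple) auto
    show "X - (Y \<union> T ` Z) \<subseteq> {x \<in> coords m. x k = zmul (int M) (x p)}"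
      unfolding X_def Y_def
      by (auto simp: TZ cell_upd k)
  qed
  note two = G_two[OF bds(1,2) bd_image[OF T bds(3)] sub thin]
  show "G Y \<Longrightarrow> G Z \<Longrightarrow> G X" "G X \<Longrightarrow> G Y \<Longrightarrow> G Z"
    using two G_image_iff[OF T bds(3)] by simp_all
qed

text \<open>With s = x_p, the fibre 0 < x_k < M s is cut at \<open>u\<close>, and x_k \<mapsto> M s
  - x_k takes the upper part to the fibre below \<open>v\<close>. It replaces the shear where
  \<open>u\<close> falls short of the multiple of s.\<close>

lemma reflect_cell:
  assumes k: "Suc p \<le> k" "k < m" and L: "bounded_forms (Suc p) L"
    and f: "\<And>i. i \<in> {Suc p..<m} \<Longrightarrow> affine (Suc p) (f i)" and u: "affine (Suc p) u" and v: "affine (Suc p) v"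
    and uv: "\<And>x. u x + v x = zmul (int M) (x p)" and uL: "u \<in> L" and vL: "v \<in> L"
    and good: "G (cell (Suc p) L (f(k := \<lambda>x. zmul (int M) (x p))))" "G (cell (Suc p) L (f(k := v)))"
  shows "G (cell (Suc p) L (f(k := u)))"
proof -
  define X where "X = cell (Suc p) L (f(k := \<lambda>x. zmul (int M) (x p)))"
  define Y where "Y = cell (Suc p) L (f(k := u))"
  define Z where "Z = cell (Suc p) L (f(k := v))"
  define T where "T = (\<lambda>x :: nat \<Rightarrow> 'g. x(k := zmul (int M) (x p) - x k))"
  have T: "unimodular m T T" unfolding T_def using k by (intro unimodular_reflect) auto
  have pm: "Suc p \<le> m" using k by simp
  have ms: "affine (Suc p) (\<lambda>x. zmul (int M) (x p))" by (rule affine_multiple) simp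
  have bds: "bd m X" "bd m Y" "bd m Z"
    unfolding X_def Y_def Z_def using L f u v ms pm by (intro bd_cell_upd; simp)+
  have TZ: "y \<in> T ` Z \<longleftrightarrow> y \<in> coords m \<and> (\<forall>l\<in>L. 0 < l y) \<and>
      (\<forall>i. Suc p \<le> i \<and> i < m \<and> i \<noteq> k \<longrightarrow> 0 < y i \<and> y i < f i y) \<and>
      u y < y k \<and> y k < zmul (int M) (y p)" for y
  proof (cases "y \<in> coords m")
    case True
    have "y \<in> T ` Z \<longleftrightarrow> T y \<in> Z"
      using True unimodular_image[OF T dset_coords[OF bd_dset[OF bds(3)]]] by simp
    also have "\<dots> \<longleftrightarrow> (\<forall>l\<in>L. 0 < l y) \<and>
      (\<forall>i. Suc p \<le> i \<and> i < m \<and> i \<noteq> k \<longrightarrow> 0 < y i \<and> y i < f i y) \<and>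
      0 < zmul (int M) (y p) - y k \<and> zmul (int M) (y p) - y k < v y"
      unfolding T_def Z_def by (rule cell_move[OF k L f v True])
    finally show ?thesis using True by (auto simp flip: uv simp: diff_less_eq add.commute)
  next
    case False
    then show ?thesis using dset_coords[OF bd_dset[OF bd_image[OF T bds(3)]]] by blast
  qed
  have pos: "0 < u y" "u y < zmul (int M) (y p)" if "\<forall>l\<in>L. 0 < l y" for y
    using bspec[OF that uL] bspec[OF that vL] by (simp_all flip: uv)
  have sub: "Y \<subseteq> X" "T ` Z \<subseteq> X" "Y \<inter> T ` Z = {}"
  proof -
    show "Y \<subseteq> X"
    proof
      fix y assume y: "y \<in> Y"
      then have "u y < zmul (int M) (y p)" using pos(2) by (simp add: Y_def cell_upd k)
      then show "y \<in> X" using y by (auto simp: Y_def X_def cell_upd k intro: less_trans)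
    qed
    show "T ` Z \<subseteq> X"
    proof
      fix y assume y: "y \<in> T ` Z"
      then have "0 < y k" using pos(1)[of y] unfolding TZ by (auto intro: less_trans)
      then show "y \<in> X" using y unfolding TZ X_def cell_upd[OF k] by simp
    qed
    show "Y \<inter> T ` Z = {}"
    proof -
      have False if "y \<in> Y" "y \<in> T ` Z" for y
        using that unfolding TZ by (auto simp: Y_def cell_upd k)
      then show ?thesis by blast
    qed
  qed
  have thin: "thin (X - (Y \<union> T ` Z))"
  proof (rule thin_subset)
    have inv: "u (x(k := w)) = u x" for x w using u k(1) by (rule affine_upd)
    show "thin {x \<in> coords m. x k = u x}"
      using k affine_mono[OF u pm] inv by (intro thin_graph) auto
    show "X - (Y \<union> T ` Z) \<subseteq> {x \<in> coords m. x k = u x}"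
      unfolding X_def Y_def
      by (auto simp: TZ cell_upd k)
  qed
  show ?thesis
    using G_two(3)[OF bds(1,2) bd_image[OF T bds(3)] sub thin] G_image_iff[OF T bds(3)] good
    by (simp add: X_def Y_def Z_def)
qed

text \<open>The fibre bounds are normalised one at a time. \<open>R k\<close> assumes that the
  bounds before \<open>k\<close> are normal; the descent starts at \<open>m\<close>, where all are,
  and ends at \<open>Suc p\<close>, where none is assumed to be.\<close>

lemma good_positive:
  assumes p: "p < m" and H: "good_cells p" and N: "0 < N"
    and IH: "\<And>N'. 0 < N' \<Longrightarrow> N' < N \<Longrightarrow> good_slopes p N'"
    and L: "bounded_forms (Suc p) L" and s: "(\<lambda>x. x p) \<in> L"
    and f: "\<And>i. i \<in> {Suc p..<m} \<Longrightarrow> slope_form N p (f i)"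
  shows "G (cell (Suc p) L f)"
proof -
  define R where "R = (\<lambda>k. \<forall>L f. bounded_forms (Suc p) L \<longrightarrow> (\<lambda>x. x p) \<in> L \<longrightarrow>
    (\<forall>i\<in>{Suc p..<m}. slope_form N p (f i)) \<longrightarrow> (\<forall>i\<in>{Suc p..<k}. normal N p (f i)) \<longrightarrow> G (cell (Suc p) L f))"
  have RD: "G (cell (Suc p) L f)"
    if "R k" "bounded_forms (Suc p) L" "(\<lambda>x. x p) \<in> L"
      "\<And>i. i \<in> {Suc p..<m} \<Longrightarrow> slope_form N p (f i)" "\<And>i. i \<in> {Suc p..<k} \<Longrightarrow> normal N p (f i)" for k L f
    using that unfolding R_def by simp
  have "R (Suc p)"
  proof (rule inc_induct[of "Suc p" m])
    show "Suc p \<le> m" using p by simp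
    show "R m" unfolding R_def
      by (intro allI impI good_normal[OF p H N IH]; simp)
    fix k assume k: "Suc p \<le> k" "k < m" and Rk: "R (Suc k)"
    show "R k" unfolding R_def
    proof (intro allI impI)
      fix L f assume L: "bounded_forms (Suc p) L" and s: "(\<lambda>x. x p) \<in> L"
        and f: "\<forall>i\<in>{Suc p..<m}. slope_form N p (f i)" and nf: "\<forall>i\<in>{Suc p..<k}. normal N p (f i)"
      have fa: "affine (Suc p) (f i)" if "i \<in> {Suc p..<m}" for i
        using bspec[OF f that] by (rule slope_form_affine)
      have K: "G (cell (Suc p) L' (f(k := u)))"
        if "bounded_forms (Suc p) L'" "(\<lambda>x. x p) \<in> L'" "normal N p u" for L' u
      proof (rule RD[OF Rk that(1,2)])
        show "slope_form N p ((f(k := u)) i)" if "i \<in> {Suc p..<m}" for i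
          using bspec[OF f that] normal_slope_form[OF \<open>normal N p u\<close>] by (cases "i = k") simp_all
        show "normal N p ((f(k := u)) i)" if "i \<in> {Suc p..<Suc k}" for i
          using bspec[OF nf, of i] \<open>normal N p u\<close> that by (cases "i = k") simp_all
      qed
      \<comment> \<open>A bound M s with s = x_p is built from M layers of the normal bound s, each
        put into place by a shear.\<close>
      have KM: "G (cell (Suc p) L' (f(k := \<lambda>x. zmul (int M) (x p))))"
        if L': "bounded_forms (Suc p) L'" "(\<lambda>x. x p) \<in> L'" for L' M
      proof (induction M)
        case 0
        have "cell (Suc p) L' (f(k := \<lambda>x. zmul (int 0) (x p))) = {}"
        proof -
          have False if "x \<in> cell (Suc p) L' (f(k := \<lambda>x. zmul (int 0) (x p)))" for x
            using that unfolding cell_upd[OF k] by (auto dest: order.asym)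
          then show ?thesis by blast
        qed
        then show ?case by (simp only: G_empty)
      next
        case (Suc M)
        have "G (cell (Suc p) L' (f(k := \<lambda>x. x p + zmul (int M) (x p))))"
          by (rule shear_cell(1)[OF k L'(1) fa affine_coord L'(2) L'(2) Suc.IH K[OF L' normal_coord]]) simp_all
        then show ?case by (simp only: zmul_Suc)
      qed
      obtain r \<phi> where \<phi>: "affine p \<phi>" and fk: "f k = (\<lambda>x. rmul r (x p) + \<phi> x)" and r: "of_nat N * r \<in> \<int>"
        by (rule slope_formE[OF bspec[OF f, of k]]) (use k in simp)
      \<comment> \<open>Shears remove the integer part of the slope; the fractional part is what
        \<open>normal\<close> admits.\<close>
      define r' where "r' = r - of_int \<lfloor>r\<rfloor>"
      have r': "0 \<le> r'" "r' < 1" unfolding r'_def by linarith+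
      have Nr': "of_nat N * r' \<in> \<int>" unfolding r'_def right_diff_distrib using r by (intro Ints_diff) auto
      define f' where "f' = (\<lambda>x. rmul r' (x p) + \<phi> x)"
      have nf': "normal N p f'" unfolding f'_def by (rule normalI[OF \<phi> r' Nr'])
      have af': "affine (Suc p) f'" using nf' by (intro slope_form_affine normal_slope_form)
      have afk: "affine (Suc p) (f k)" using fa k by simp
      \<comment> \<open>In the cell 0 < x_k < f_k, so adding f_k to the base changes nothing; the
        shear and the reflection require it there.\<close>
      define L1 where "L1 = insert (f k) L"
      have L1: "bounded_forms (Suc p) L1" "(\<lambda>x. x p) \<in> L1" "f k \<in> L1"
        unfolding L1_def using bounded_forms_insert[OF L afk] s by simp_all
      have e1: "cell (Suc p) L f = cell (Suc p) L1 f"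
      proof -
        have "0 < f k x" if "x \<in> cell (Suc p) L f" for x
          using that k by (auto simp: cell_def intro: less_trans)
        then show ?thesis unfolding L1_def cell_def by auto
      qed
      have fid: "f(k := f k) = f" by simp
      have "G (cell (Suc p) L1 (f(k := f k)))"
      proof (cases "\<lfloor>r\<rfloor> < 0")
        case True
        \<comment> \<open>With a negative integer part, f' = f_k + M x_p is the longer fibre, and
          the cell of f_k is what is left after cancelling the part of length M x_p.\<close>
        then obtain M where M: "- \<lfloor>r\<rfloor> = int M" by (metis neg_0_less_iff_less zero_less_imp_eq_int)
        have "f' = (\<lambda>x. f k x + zmul (int M) (x p))"
          unfolding f'_def fk r'_def M[symmetric]
          by (simp add: rmul.scale_left_diff_distrib rmul_of_int zmul.scale_minus_left algebra_simps)
        then have G1: "G (cell (Suc p) L1 (f(k := \<lambda>x. f k x + zmul (int M) (x p))))"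
          using K[OF L1(1,2) nf'] by simp
        show ?thesis
          by (rule shear_cell(2)[OF k L1(1) fa afk L1(2,3) G1 KM[OF L1(1,2)]])
      next
        case False
        then obtain M where M: "\<lfloor>r\<rfloor> = int M" by (metis nonneg_int_cases not_less)
        have fkM: "f k = (\<lambda>x. f' x + zmul (int M) (x p))"
          unfolding f'_def fk r'_def M by (simp add: rmul.scale_left_diff_distrib rmul_of_int flip: M)
        show ?thesis
        proof (cases "f' = (\<lambda>x. 0)")
          case True
          then show ?thesis using KM[OF L1(1,2), of M] by (simp add: fkM)
        next
          case f'0: False
          \<comment> \<open>The sign of f' is open, so the base is cut along f' = 0: the shear
            serves f' > 0 and the reflection f' < 0. The cut is thin because f' is not the zero
            form.\<close>
          define L2 where "L2 = insert f' L1"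
          define L3 where "L3 = insert (\<lambda>x. - f' x) L1"
          have L2: "bounded_forms (Suc p) L2" "(\<lambda>x. x p) \<in> L2" "f' \<in> L2"
            unfolding L2_def using bounded_forms_insert[OF L1(1) af'] L1 by simp_all
          have am: "affine (Suc p) (\<lambda>x. - f' x)" using af' by (rule affine_uminus)
          have L3: "bounded_forms (Suc p) L3" "(\<lambda>x. x p) \<in> L3" "f k \<in> L3" "(\<lambda>x. - f' x) \<in> L3"
            unfolding L3_def using bounded_forms_insert[OF L1(1) am] L1 by simp_all
          have G2: "G (cell (Suc p) L2 (f(k := f k)))"
            using shear_cell(1)[OF k L2(1) fa af' L2(2,3) KM[OF L2(1,2), of M] K[OF L2(1,2) nf']]
            by (simp only: fkM[symmetric])
          have Gm: "G (cell (Suc p) L3 (f(k := \<lambda>x. - f' x)))"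
          proof (cases "r' = 0")
            case True
            have "normal N p (\<lambda>x. rmul 0 (x p) + - \<phi> x)"
              using \<phi> by (intro normalI affine_uminus) auto
            moreover have "(\<lambda>x. - f' x) = (\<lambda>x. rmul 0 (x p) + - \<phi> x)" by (simp add: f'_def True)
            ultimately show ?thesis using K[OF L3(1,2)] by simp
          next
            case False
            \<comment> \<open>The slope of - f' lies strictly between -1 and 0. One more x_p raises
              it to 1 - r', which is normal, and a shear takes the surplus off again.\<close>
            have "of_nat N * (1 - r') \<in> \<int>" unfolding right_diff_distrib using Nr' by (intro Ints_diff) auto
            then have "normal N p (\<lambda>x. rmul (1 - r') (x p) + - \<phi> x)"
              using \<phi> r' False by (intro normalI affine_uminus) auto
            moreover have "(\<lambda>x. - f' x + zmul (int 1) (x p)) = (\<lambda>x. rmul (1 - r') (x p) + - \<phi> x)"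
              by (simp add: f'_def rmul.scale_left_diff_distrib algebra_simps)
            ultimately have G1: "G (cell (Suc p) L3 (f(k := \<lambda>x. - f' x + zmul (int 1) (x p))))"
              using K[OF L3(1,2)] by simp
            show ?thesis
              by (rule shear_cell(2)[OF k L3(1) fa am L3(2,4) G1 KM[OF L3(1,2)]])
          qed
          have G3: "G (cell (Suc p) L3 (f(k := f k)))"
            by (rule reflect_cell[OF k L3(1) fa afk am _ L3(3,4) KM[OF L3(1,2)] Gm]) (simp_all add: fkM)
          show ?thesis
          proof (rule G_two(1)[OF _ _ _ _ _ _ _ G2 G3])
            have pm: "Suc p \<le> m" using p by simp
            show "bd m (cell (Suc p) L1 (f(k := f k)))" "bd m (cell (Suc p) L2 (f(k := f k)))"
              "bd m (cell (Suc p) L3 (f(k := f k)))"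
              by (rule bd_cell_upd[OF _ fa afk pm], fact, assumption)+
            show "cell (Suc p) L2 (f(k := f k)) \<subseteq> cell (Suc p) L1 (f(k := f k))"
              "cell (Suc p) L3 (f(k := f k)) \<subseteq> cell (Suc p) L1 (f(k := f k))"
              unfolding cell_def L2_def L3_def by auto
            show "cell (Suc p) L2 (f(k := f k)) \<inter> cell (Suc p) L3 (f(k := f k)) = {}"
              unfolding cell_def L2_def L3_def by auto
            show "thin (cell (Suc p) L1 (f(k := f k)) - (cell (Suc p) L2 (f(k := f k)) \<union> cell (Suc p) L3 (f(k := f k))))"
            proof (rule thin_subset[OF thin_eq[OF affine_mono[OF af' pm] affine_const[OF zero_mem] f'0]])
              show "cell (Suc p) L1 (f(k := f k)) - (cell (Suc p) L2 (f(k := f k)) \<union> cell (Suc p) L3 (f(k := f k)))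
                \<subseteq> {x \<in> coords m. f' x = 0}"
                unfolding cell_def L2_def L3_def by auto
            qed
          qed
        qed
      qed
      then show "G (cell (Suc p) L f)" unfolding e1 fid .
    qed
  qed
  then show ?thesis by (rule RD[OF _ L s f]) simp_all
qed

text \<open>Removes the assumption 0 < x_p by cutting the base at x_p = 0. The change of sign of x_p
  takes the negative half to the positive one and a slope r to - r, with the same
  denominator.\<close>

lemma good_slopes_step:
  assumes p: "p < m" and H: "good_cells p" and N: "0 < N"
    and IH: "\<And>N'. 0 < N' \<Longrightarrow> N' < N \<Longrightarrow> good_slopes p N'"
  shows "good_slopes p N"
  unfolding good_slopes_def
proof (intro allI impI)
  fix L f assume L: "bounded_forms (Suc p) L" and f: "\<forall>i. Suc p \<le> i \<and> i < m \<longrightarrow> slope_form N p (f i)"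
  have fs: "slope_form N p (f i)" if "i \<in> {Suc p..<m}" for i using f that by simp
  note fa = slope_form_affine[OF fs]
  have cs: "affine (Suc p) (\<lambda>x. x p)" and cm: "affine (Suc p) (\<lambda>x. - x p)"
    by (simp_all add: affine_coord affine_uminus)
  define L1 where "L1 = insert (\<lambda>x. x p) L"
  define L2 where "L2 = insert (\<lambda>x. - x p) L"
  have L1: "bounded_forms (Suc p) L1" and L2: "bounded_forms (Suc p) L2"
    unfolding L1_def L2_def using bounded_forms_insert[OF L] cs cm by simp_all
  have pm: "Suc p \<le> m" using p by simp
  have bds: "bd m (cell (Suc p) L f)" "bd m (cell (Suc p) L1 f)" "bd m (cell (Suc p) L2 f)"
    using bd_cell[OF L _ pm] bd_cell[OF L1 _ pm] bd_cell[OF L2 _ pm] fa by simp_all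
  have G1: "G (cell (Suc p) L1 f)"
    by (rule good_positive[OF p H N IH L1 _ fs]) (simp_all add: L1_def)
  define T where "T = (\<lambda>x :: nat \<Rightarrow> 'g. x(p := - x p))"
  have T: "unimodular m T T" unfolding T_def using p by (rule unimodular_neg)
  have TT: "T (T x) = x" for x by (simp add: T_def)
  have Tc: "T x \<in> coords m" if "x \<in> coords m" for x using T that by (simp add: unimodular_def)
  define L' where "L' = (\<lambda>l x. l (T x)) ` L2"
  define f' where "f' = (\<lambda>i x. f i (T x))"
  have aT: "affine (Suc p) (\<lambda>x. l (T x))" if "affine (Suc p) l" for l
  proof (rule affine_compose[OF that])
    show "affine (Suc p) (\<lambda>x. T x i)" if "i < Suc p" for i
      using that by (cases "i = p") (simp_all add: T_def affine_coord affine_uminus)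
  qed
  have L': "bounded_forms (Suc p) L'"
  proof -
    obtain \<gamma> where L2fin: "finite L2" "\<forall>l\<in>L2. affine (Suc p) l"
      and \<gamma>: "\<forall>x\<in>{x \<in> coords m. \<forall>l\<in>L2. 0 < l x}. \<forall>i<Suc p. - \<gamma> \<le> x i \<and> x i \<le> \<gamma>"
      using L2 by (rule bounded_formsE)
    show ?thesis
    proof (rule bounded_formsI[of _ _ \<gamma>])
      show "finite L'" using L2fin by (simp add: L'_def)
      have "\<forall>l\<in>L'. affine (Suc p) l" unfolding L'_def using L2fin(2) aT by simp
      then show "affine (Suc p) l" if "l \<in> L'" for l using that by (rule bspec)
      fix x i assume x: "x \<in> coords m" "\<forall>l\<in>L'. 0 < l x" and i: "i < Suc p"
      have "\<forall>l\<in>L2. 0 < l (T x)" using x(2) by (simp add: L'_def)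
      then have "\<forall>i<Suc p. - \<gamma> \<le> T x i \<and> T x i \<le> \<gamma>" using bspec[OF \<gamma>, of "T x"] Tc[OF x(1)] by simp
      then have "- \<gamma> \<le> T x i \<and> T x i \<le> \<gamma>" using i by simp
      then show "- \<gamma> \<le> x i \<and> x i \<le> \<gamma>"
        by (cases "i = p") (auto simp: T_def minus_le_iff)
    qed
  qed
  have sL': "(\<lambda>x. x p) \<in> L'"
    unfolding L'_def L2_def by (rule image_eqI[of _ _ "\<lambda>x. - x p"]) (simp_all add: T_def)
  have fs': "slope_form N p (f' i)" if i: "i \<in> {Suc p..<m}" for i
  proof -
    obtain r \<phi> where \<phi>: "affine p \<phi>" and fi: "f i = (\<lambda>x. rmul r (x p) + \<phi> x)" and r: "of_nat N * r \<in> \<int>"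
      using fs[OF i] by (rule slope_formE)
    have "\<phi> (T x) = \<phi> x" for x unfolding T_def using \<phi> by (rule affine_upd) simp
    then have "f' i = (\<lambda>x. rmul (- r) (x p) + \<phi> x)"
      by (simp add: f'_def fi T_def rmul.scale_minus_left)
    moreover have "of_nat N * (- r) \<in> \<int>" using r by simp
    ultimately show ?thesis by (simp only: slope_formI[OF \<phi>])
  qed
  have Gc: "G (cell (Suc p) L' f')"
    by (rule good_positive[OF p H N IH L' sL' fs']) simp_all
  have "T ` cell (Suc p) L' f' = cell (Suc p) L2 f"
  proof -
    have iff: "x \<in> cell (Suc p) L' f' \<longleftrightarrow> T x \<in> cell (Suc p) L2 f" for x
    proof -
      have "T x \<in> coords m \<longleftrightarrow> x \<in> coords m" using Tc TT by metis
      moreover have "T x i = x i" if "Suc p \<le> i" for i using that by (simp add: T_def)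
      ultimately show ?thesis by (simp add: cell_def L'_def f'_def)
    qed
    have "y \<in> T ` cell (Suc p) L' f'" if "y \<in> cell (Suc p) L2 f" for y
      by (rule image_eqI[of _ _ "T y"]) (simp_all add: iff TT that)
    then show ?thesis using iff by blast
  qed
  moreover have "bd m (cell (Suc p) L' f')"
    using slope_form_affine[OF fs'] by (intro bd_cell[OF L' _ pm]) simp
  ultimately have G2: "G (cell (Suc p) L2 f)" using G_image[OF T _ Gc] by simp
  show "G (cell (Suc p) L f)"
  proof (rule G_two(1)[OF bds _ _ _ _ G1 G2])
    show "cell (Suc p) L1 f \<subseteq> cell (Suc p) L f" "cell (Suc p) L2 f \<subseteq> cell (Suc p) L f"
      "cell (Suc p) L1 f \<inter> cell (Suc p) L2 f = {}"
      unfolding cell_def L1_def L2_def by auto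
    show "thin (cell (Suc p) L f - (cell (Suc p) L1 f \<union> cell (Suc p) L2 f))"
    proof (rule thin_subset)
      show "thin {x \<in> coords m. x p = 0}"
        using p by (intro thin_graph affine_const zero_mem) auto
      show "cell (Suc p) L f - (cell (Suc p) L1 f \<union> cell (Suc p) L2 f) \<subseteq> {x \<in> coords m. x p = 0}"
        unfolding cell_def L1_def L2_def by auto
    qed
  qed
qed

text \<open>Finitely many bounds have a common denominator for their slopes in x_p, and strong
  induction on it applies.\<close>

lemma good_cells_Suc:
  assumes "p < m" "good_cells p"
  shows "good_cells (Suc p)"
proof -
  have slopes: "good_slopes p N" if "0 < N" for N
    using that
  proof (induction N rule: less_induct)
    case (less N)
    then show ?case by (intro good_slopes_step[OF assms less.prems]) simp
  qed
  show ?thesis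
    unfolding good_cells_def
  proof (intro allI impI)
    fix L f assume L: "bounded_forms (Suc p) L" and f: "\<forall>i. Suc p \<le> i \<and> i < m \<longrightarrow> affine (Suc p) (f i)"
    define r where "r = (\<lambda>i. SOME r. \<exists>\<phi>. affine p \<phi> \<and> f i = (\<lambda>x. rmul r (x p) + \<phi> x))"
    have r: "\<exists>\<phi>. affine p \<phi> \<and> f i = (\<lambda>x. rmul (r i) (x p) + \<phi> x)" if "Suc p \<le> i" "i < m" for i
      unfolding r_def
    proof (rule someI_ex)
      have "affine (Suc p) (f i)" using f that by simp
      then show "\<exists>r \<phi>. affine p \<phi> \<and> f i = (\<lambda>x. rmul r (x p) + \<phi> x)" unfolding affine.simps(2) .
    qed
    obtain N where N: "N > 0" "\<forall>i<m. of_nat N * r i \<in> \<int>" using ex_common_denominator[of m r] by blast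
    show "G (cell (Suc p) L f)"
    proof (rule good_slopesD[OF slopes[OF N(1)] L])
      fix i assume i: "Suc p \<le> i" "i < m"
      obtain \<phi> where "affine p \<phi>" "f i = (\<lambda>x. rmul (r i) (x p) + \<phi> x)"
        using r[OF i] by (elim exE conjE)
      then show "slope_form N p (f i)" using N(2) i slope_formI by simp
    qed
  qed
qed

theorem good_all: "bd m X \<Longrightarrow> G X"
proof -
  have "good_cells p" if "p \<le> m" for p
    using that by (induction p) (simp_all add: good_cells_0 good_cells_Suc)
  then show "bd m X \<Longrightarrow> G X" by (intro good_cells_imp_all) simp_all
qed

end

section \<open>Linear maps and products of definable sets\<close>

definition lin_map :: "int mat \<Rightarrow> 'g::ab_group_add vec \<Rightarrow> 'g vec" where
  "lin_map M x = vec (dim_row M) (\<lambda>i. lin (row M i) x)"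

lemma lin_map_carrier: "M \<in> carrier_mat n k \<Longrightarrow> lin_map M x \<in> carrier_vec n"
  by (simp add: lin_map_def)

lemma lin_map_index:
  "M \<in> carrier_mat n k \<Longrightarrow> x \<in> carrier_vec k \<Longrightarrow> i < n \<Longrightarrow>
    lin_map M x $ i = (\<Sum>j<k. zmul (M $$ (i, j)) (x $ j))"
  by (auto simp: lin_map_def lin_def intro!: sum.cong)

lemma affine_map_lin_map: "M \<in> carrier_mat n k \<Longrightarrow> affine_map M (0\<^sub>v n) x = lin_map M x"
  by (simp add: affine_map_def lin_map_def)

lemma lin_lin_map:
  assumes "c \<in> carrier_vec n" "M \<in> carrier_mat n k" "x \<in> carrier_vec k"
  shows "lin c (lin_map M x) = lin (vec k (\<lambda>j. \<Sum>i<n. c $ i * M $$ (i, j))) x"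
proof -
  have "lin c (lin_map M x) = (\<Sum>i<n. zmul (c $ i) (\<Sum>j<k. zmul (M $$ (i, j)) (x $ j)))"
    using lin_map_carrier[OF assms(2), of x] lin_map_index[OF assms(2,3)] by (simp add: lin_def)
  also have "\<dots> = (\<Sum>i<n. \<Sum>j<k. zmul (c $ i * M $$ (i, j)) (x $ j))"
    by (simp add: zmul.scale_sum_right)
  also have "\<dots> = (\<Sum>j<k. zmul (\<Sum>i<n. c $ i * M $$ (i, j)) (x $ j))"
    by (subst sum.swap) (simp add: zmul.scale_sum_left)
  finally show ?thesis using assms(3) by (simp add: lin_def)
qed

lemma lin_map_mult:
  assumes "M \<in> carrier_mat l n" "N \<in> carrier_mat n k" "x \<in> carrier_vec k"
  shows "lin_map (M * N) x = lin_map M (lin_map N x)"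
proof (rule eq_vecI)
  fix i assume "i < dim_vec (lin_map M (lin_map N x))"
  then have i: "i < l" using assms(1) by (simp add: lin_map_def)
  have "vec k (\<lambda>j. \<Sum>i'<n. row M i $ i' * N $$ (i', j)) = row (M * N) i"
    using assms i by (intro eq_vecI) (auto simp: scalar_prod_def atLeast0LessThan intro!: sum.cong)
  then have "lin (row M i) (lin_map N x) = lin (row (M * N) i) x"
    using lin_lin_map[of "row M i" n N k x] assms i by simp
  then show "lin_map (M * N) x $ i = lin_map M (lin_map N x) $ i"
    using assms i by (simp add: lin_map_def)
qed (use assms in \<open>simp add: lin_map_def\<close>)

lemma lin_map_one: "x \<in> carrier_vec n \<Longrightarrow> lin_map (1\<^sub>m n) x = x"
  by (intro eq_vecI)
    (auto simp: lin_map_index[of _ n n] lin_map_def lin_def if_distrib[of "\<lambda>c. zmul c _"] cong: if_cong)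

text \<open>Evaluation at \<open>e\<close> times a unit vector isolates one coefficient, and in a
  torsion-free group a nonzero \<open>e\<close> distinguishes integers.\<close>

lemma mat_eq_one:
  fixes M :: "int mat" and e :: "'g::linordered_ab_group_add"
  assumes e: "e \<noteq> 0" and M: "M \<in> carrier_mat n n"
    and id: "\<And>x :: 'g vec. x \<in> carrier_vec n \<Longrightarrow> lin_map M x = x"
  shows "M = 1\<^sub>m n"
proof (rule eq_matI)
  fix i j assume "i < dim_row (1\<^sub>m n :: int mat)" "j < dim_col (1\<^sub>m n :: int mat)"
  then have ij: "i < n" "j < n" by simp_all
  define x where "x = vec n (\<lambda>l. if l = j then e else 0)"
  have x: "x \<in> carrier_vec n" by (simp add: x_def)
  have "x $ i = (\<Sum>l<n. zmul (M $$ (i, l)) (x $ l))"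
    using lin_map_index[OF M x ij(1)] id[OF x] by simp
  also have "\<dots> = zmul (M $$ (i, j)) e"
    using ij by (simp add: x_def if_distrib[of "zmul _"] cong: if_cong)
  finally have "zmul (M $$ (i, j) - (if i = j then 1 else 0)) e = 0"
    using ij by (auto simp: x_def zmul.scale_left_diff_distrib split: if_splits)
  then show "M $$ (i, j) = 1\<^sub>m n $$ (i, j)" using e ij by (simp add: zmul_eq_0_iff)
qed (use M in auto)

text \<open>The vectors may lie over any ordered group with a nonzero element, so that the criterion
  applies to the action on \<Gamma>^n as well as to the action on integer vectors.\<close>

lemma invertible_matI:
  fixes M M' :: "int mat" and e :: "'g::linordered_ab_group_add"
  assumes "e \<noteq> 0" and M: "M \<in> carrier_mat n n" "M' \<in> carrier_mat n n"
    and "\<And>x :: 'g vec. x \<in> carrier_vec n \<Longrightarrow> lin_map M (lin_map M' x) = x"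
    and "\<And>x :: 'g vec. x \<in> carrier_vec n \<Longrightarrow> lin_map M' (lin_map M x) = x"
  shows "invertible_mat M"
proof -
  have "M * M' = 1\<^sub>m n" "M' * M = 1\<^sub>m n"
    using assms by (intro mat_eq_one[of e]; simp add: lin_map_mult)+
  then show ?thesis using M unfolding invertible_mat_def inverts_mat_def by auto
qed

text \<open>One construction for both coordinate projections and coordinate permutations.\<close>

definition select_mat :: "nat \<Rightarrow> nat \<Rightarrow> (nat \<Rightarrow> nat) \<Rightarrow> int mat" where
  "select_mat n k \<sigma> = mat n k (\<lambda>(i, j). if j = \<sigma> i then 1 else 0)"

lemma select_mat_carrier: "select_mat n k \<sigma> \<in> carrier_mat n k"
  by (simp add: select_mat_def)

lemma lin_map_select:
  assumes "x \<in> carrier_vec k" "\<And>i. i < n \<Longrightarrow> \<sigma> i < k"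
  shows "lin_map (select_mat n k \<sigma>) x = vec n (\<lambda>i. x $ \<sigma> i)"
proof (rule eq_vecI)
  fix i assume "i < dim_vec (vec n (\<lambda>i. x $ \<sigma> i))"
  then have i: "i < n" by simp
  have "lin_map (select_mat n k \<sigma>) x $ i = (\<Sum>j<k. if j = \<sigma> i then x $ j else 0)"
    unfolding lin_map_index[OF select_mat_carrier assms(1) i]
    using i by (intro sum.cong) (auto simp: select_mat_def)
  then show "lin_map (select_mat n k \<sigma>) x $ i = vec n (\<lambda>i. x $ \<sigma> i) $ i"
    using assms(2)[OF i] i by simp
qed (simp add: lin_map_def select_mat_def)

lemma definable_carrier: "X \<in> definable A n \<Longrightarrow> X \<subseteq> carrier_vec n"
  by (induction rule: definable.induct) auto

lemma definable_empty:
  assumes "add_subgroup A" shows "{} \<in> definable A n"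
proof -
  have "{x \<in> carrier_vec n. lin (0\<^sub>v n) x < 0} \<in> definable A n"
    using assms by (intro definable_less) (auto simp: add_subgroup_def)
  moreover have "lin (0\<^sub>v n) x = 0" if "x \<in> carrier_vec n" for x :: "'a vec"
    using that by (simp add: lin_def)
  ultimately show ?thesis by (simp cong: conj_cong)
qed

lemma definable_univ: "add_subgroup A \<Longrightarrow> carrier_vec n \<in> definable A n"
  using definable_Compl[OF definable_empty] by force

text \<open>Substitution of the map into a linear condition multiplies its coefficient vector by the
  matrix and keeps the parameter.\<close>

lemma definable_lin_map:
  assumes "X \<in> definable A n" "M \<in> carrier_mat n k"
  shows "{x \<in> carrier_vec k. lin_map M x \<in> X} \<in> definable A k"
  using assms(1)
proof (induction rule: definable.induct)
  case (definable_eq c a)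
  have "{x \<in> carrier_vec k. lin_map M x \<in> {x \<in> carrier_vec n. lin c x = a}} =
      {x \<in> carrier_vec k. lin (vec k (\<lambda>j. \<Sum>i<n. c $ i * M $$ (i, j))) x = a}"
    using lin_lin_map[OF definable_eq(1) assms(2)] lin_map_carrier[OF assms(2)] by auto
  then show ?case using definable_eq(2) by (auto intro: definable.definable_eq)
next
  case (definable_le c a)
  have "{x \<in> carrier_vec k. lin_map M x \<in> {x \<in> carrier_vec n. lin c x \<le> a}} =
      {x \<in> carrier_vec k. lin (vec k (\<lambda>j. \<Sum>i<n. c $ i * M $$ (i, j))) x \<le> a}"
    using lin_lin_map[OF definable_le(1) assms(2)] lin_map_carrier[OF assms(2)] by auto
  then show ?case using definable_le(2) by (auto intro: definable.definable_le)
next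
  case (definable_less c a)
  have "{x \<in> carrier_vec k. lin_map M x \<in> {x \<in> carrier_vec n. lin c x < a}} =
      {x \<in> carrier_vec k. lin (vec k (\<lambda>j. \<Sum>i<n. c $ i * M $$ (i, j))) x < a}"
    using lin_lin_map[OF definable_less(1) assms(2)] lin_map_carrier[OF assms(2)] by auto
  then show ?case using definable_less(2) by (auto intro: definable.definable_less)
next
  case (definable_Compl X)
  have "{x \<in> carrier_vec k. lin_map M x \<in> carrier_vec n - X} = carrier_vec k - {x \<in> carrier_vec k. lin_map M x \<in> X}"
    using lin_map_carrier[OF assms(2)] by auto
  then show ?case using definable_Compl.IH by (simp add: definable.definable_Compl)
next
  case (definable_Un X Y)
  have "{x \<in> carrier_vec k. lin_map M x \<in> X \<union> Y} =
      {x \<in> carrier_vec k. lin_map M x \<in> X} \<union> {x \<in> carrier_vec k. lin_map M x \<in> Y}" by auto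
  then show ?case using definable_Un.IH by (simp add: definable.definable_Un)
next
  case (definable_Int X Y)
  have "{x \<in> carrier_vec k. lin_map M x \<in> X \<inter> Y} =
      {x \<in> carrier_vec k. lin_map M x \<in> X} \<inter> {x \<in> carrier_vec k. lin_map M x \<in> Y}" by auto
  then show ?case using definable_Int.IH by (simp add: definable.definable_Int)
qed

section \<open>Cartesian products of definable sets\<close>

abbreviation vec_prod :: "'a vec set \<Rightarrow> 'a vec set \<Rightarrow> 'a vec set" where
  "vec_prod X Y \<equiv> {x @\<^sub>v y | x y. x \<in> X \<and> y \<in> Y}"

lemma vec_first_append: "x \<in> carrier_vec n \<Longrightarrow> vec_first (x @\<^sub>v y) n = x"
  by (intro eq_vecI) (auto simp: vec_first_def append_vec_def Let_def)

lemma vec_last_append: "y \<in> carrier_vec k \<Longrightarrow> vec_last (x @\<^sub>v y) k = y"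
  by (intro eq_vecI) (auto simp: vec_last_def append_vec_def Let_def)

lemma vec_prod_eq:
  assumes "X \<subseteq> carrier_vec n" "Y \<subseteq> carrier_vec k"
  shows "vec_prod X Y = {v \<in> carrier_vec (n + k). vec_first v n \<in> X \<and> vec_last v k \<in> Y}"
proof (intro equalityI subsetI)
  fix v assume "v \<in> vec_prod X Y"
  then show "v \<in> {v \<in> carrier_vec (n + k). vec_first v n \<in> X \<and> vec_last v k \<in> Y}"
    using assms by (auto simp: vec_first_append[of _ n] vec_last_append[of _ k] subset_iff)
next
  fix v assume v: "v \<in> {v \<in> carrier_vec (n + k). vec_first v n \<in> X \<and> vec_last v k \<in> Y}"
  then have "v = vec_first v n @\<^sub>v vec_last v k" by simp
  with v show "v \<in> vec_prod X Y" by blast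
qed

text \<open>An intersection of preimages under the two coordinate projections, which are integral
  linear maps.\<close>

lemma definable_vec_prod:
  fixes X :: "'g::doag vec set"
  assumes "X \<in> definable A n" "Y \<in> definable A k"
  shows "vec_prod X Y \<in> definable A (n + k)"
proof -
  have 1: "lin_map (select_mat n (n + k) id) v = vec_first v n" if "v \<in> carrier_vec (n + k)" for v :: "'g vec"
    using lin_map_select[OF that, of n id] by (simp add: vec_first_def)
  have 2: "lin_map (select_mat k (n + k) ((+) n)) v = vec_last v k" if "v \<in> carrier_vec (n + k)" for v :: "'g vec"
    using lin_map_select[OF that, of k "(+) n"] that by (simp add: vec_last_def)
  have "vec_prod X Y = {v \<in> carrier_vec (n + k). lin_map (select_mat n (n + k) id) v \<in> X} \<inter>
      {v \<in> carrier_vec (n + k). lin_map (select_mat k (n + k) ((+) n)) v \<in> Y}"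
    unfolding vec_prod_eq[OF definable_carrier[OF assms(1)] definable_carrier[OF assms(2)]]
    using 1 2 by auto
  also have "\<dots> \<in> definable A (n + k)"
    by (intro definable_Int definable_lin_map[OF _ select_mat_carrier] assms)
  finally show ?thesis .
qed

lemma bdd_objD: "X \<in> bdd_obj A n \<Longrightarrow> X \<in> definable A n" "X \<in> bdd_obj A n \<Longrightarrow> X \<subseteq> carrier_vec n"
  using definable_carrier by (auto simp: bdd_obj_def)

lemma bdd_obj_subset: "X \<in> bdd_obj A n \<Longrightarrow> Y \<in> definable A n \<Longrightarrow> Y \<subseteq> X \<Longrightarrow> Y \<in> bdd_obj A n"
  unfolding bdd_obj_def by blast

lemma bdd_obj_empty: "add_subgroup A \<Longrightarrow> {} \<in> bdd_obj A n"
  by (simp add: bdd_obj_def definable_empty)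

lemma bdd_obj_vec_prod:
  assumes X: "X \<in> bdd_obj A n" and Y: "Y \<in> bdd_obj A k"
  shows "vec_prod X Y \<in> bdd_obj A (n + k)"
proof -
  obtain \<gamma> where \<gamma>: "\<forall>x\<in>X. \<forall>i<n. - \<gamma> \<le> x $ i \<and> x $ i \<le> \<gamma>" using X by (auto simp: bdd_obj_def)
  obtain \<delta> where \<delta>: "\<forall>x\<in>Y. \<forall>i<k. - \<delta> \<le> x $ i \<and> x $ i \<le> \<delta>" using Y by (auto simp: bdd_obj_def)
  have "- max \<gamma> \<delta> \<le> (x @\<^sub>v y) $ i \<and> (x @\<^sub>v y) $ i \<le> max \<gamma> \<delta>"
    if xy: "x \<in> X" "y \<in> Y" and i: "i < n + k" for x y i
  proof -
    have c: "x \<in> carrier_vec n" "y \<in> carrier_vec k" using xy bdd_objD(2)[OF X] bdd_objD(2)[OF Y] by auto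
    have "(x @\<^sub>v y) $ i = (if i < n then x $ i else y $ (i - n))" using c i by simp
    then show ?thesis using \<gamma> \<delta> xy i
      by (cases "i < n") (auto simp: minus_max_eq_min min_le_iff_disj le_max_iff_disj)
  qed
  then have "\<forall>v\<in>vec_prod X Y. \<forall>i<n + k. - max \<gamma> \<delta> \<le> v $ i \<and> v $ i \<le> max \<gamma> \<delta>" by blast
  then show ?thesis
    using definable_vec_prod[OF bdd_objD(1)[OF X] bdd_objD(1)[OF Y]] unfolding bdd_obj_def by blast
qed

section \<open>Morphisms and isomorphisms of definable sets\<close>

lemma Gamma_morD:
  assumes "Gamma_mor A n X Y f"
  shows "X \<in> definable A n" "Y \<in> definable A n" "bij_betw f X Y"
  using assms by (simp_all add: Gamma_mor_def)

lemma Gamma_mor_linear: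
  assumes A: "add_subgroup A" and X: "X \<in> definable A n" and Y: "Y \<in> definable A n"
    and M: "M \<in> carrier_mat n n" "invertible_mat M" and bij: "bij_betw (lin_map M) X Y"
  shows "Gamma_mor A n X Y (lin_map M)"
  unfolding Gamma_mor_def
proof (intro conjI X Y bij exI[of _ "{X}"] ballI)
  fix Z assume "Z \<in> {X}"
  have "\<forall>x\<in>Z. lin_map M x = affine_map M (0\<^sub>v n) x" by (simp add: affine_map_lin_map[OF M(1)])
  then show "\<exists>M'\<in>carrier_mat n n. \<exists>a\<in>carrier_vec n. invertible_mat M' \<and> (\<forall>i<n. a $ i \<in> A) \<and>
      (\<forall>x\<in>Z. lin_map M x = affine_map M' a x)"
    using M A by (intro bexI[of _ M] bexI[of _ "0\<^sub>v n"]) (auto simp: add_subgroup_def)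
qed (use X in auto)

text \<open>The image is a preimage under the inverse, hence definable; each direction is a morphism
  with a single piece and zero translation.\<close>

lemma Gamma_iso_linear:
  fixes X :: "'g::doag vec set"
  assumes A: "add_subgroup A" and X: "X \<in> definable A n"
    and M: "M \<in> carrier_mat n n" "M' \<in> carrier_mat n n"
    and inv: "\<And>x :: 'g vec. x \<in> carrier_vec n \<Longrightarrow> lin_map M (lin_map M' x) = x"
      "\<And>x :: 'g vec. x \<in> carrier_vec n \<Longrightarrow> lin_map M' (lin_map M x) = x"
  shows "Gamma_iso A n X (lin_map M ` X)"
proof -
  have Xc: "X \<subseteq> carrier_vec n" using X by (rule definable_carrier)
  have im: "lin_map M ` X = {y \<in> carrier_vec n. lin_map M' y \<in> X}"
  proof (intro equalityI subsetI)
    fix y assume y: "y \<in> {y \<in> carrier_vec n. lin_map M' y \<in> X}"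
    then have "y = lin_map M (lin_map M' y)" using inv(1) by simp
    then show "y \<in> lin_map M ` X" using y by blast
  qed (use Xc inv(2) lin_map_carrier[OF M(1)] in auto)
  have def: "lin_map M ` X \<in> definable A n"
    unfolding im using X M(2) by (rule definable_lin_map)
  have "lin_map M' (lin_map M x) = x" if "x \<in> X" for x using that Xc inv(2) by blast
  then have b: "bij_betw (lin_map M) X (lin_map M ` X)" "bij_betw (lin_map M') (lin_map M ` X) X"
    by (simp_all add: bij_betw_byWitness[where f' = "lin_map M'"] bij_betw_byWitness[where f' = "lin_map M"] image_subset_iff)
  obtain e :: 'g where e: "e \<noteq> 0" using nontrivial by blast
  have "Gamma_mor A n X (lin_map M ` X) (lin_map M)" "Gamma_mor A n (lin_map M ` X) X (lin_map M')"
    using A X def M b invertible_matI[OF e M inv] invertible_matI[OF e M(2,1) inv(2,1)]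
    by (auto intro: Gamma_mor_linear)
  then show ?thesis unfolding Gamma_iso_def using Xc inv(2) by (intro exI[of _ "lin_map M"] exI[of _ "lin_map M'"]) auto
qed

lemma Gamma_iso_refl:
  assumes "add_subgroup A" "X \<in> definable A n" shows "Gamma_iso A n X X"
proof -
  have "Gamma_iso A n X (lin_map (1\<^sub>m n) ` X)"
    by (rule Gamma_iso_linear[OF assms, of _ "1\<^sub>m n"]) (auto simp: lin_map_one)
  moreover have "lin_map (1\<^sub>m n) ` X = X"
    using definable_carrier[OF assms(2)] by (force simp: lin_map_one subset_iff)
  ultimately show ?thesis by simp
qed

text \<open>The block sum of \<open>M\<close> with an identity matrix, acting on the first factor of
  a product.\<close>

definition block_mat :: "nat \<Rightarrow> nat \<Rightarrow> int mat \<Rightarrow> int mat" where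
  "block_mat n k M = mat (n + k) (n + k) (\<lambda>(i, j). if i < n \<and> j < n then M $$ (i, j) else if i = j then 1 else 0)"

lemma block_mat_carrier: "block_mat n k M \<in> carrier_mat (n + k) (n + k)"
  by (simp add: block_mat_def)

lemma lin_map_block:
  assumes M: "M \<in> carrier_mat n n" and x: "x \<in> carrier_vec n" and y: "y \<in> carrier_vec k"
  shows "lin_map (block_mat n k M) (x @\<^sub>v y) = lin_map M x @\<^sub>v y"
proof (rule eq_vecI)
  have xy: "x @\<^sub>v y \<in> carrier_vec (n + k)" using x y by simp
  have Mx: "dim_vec (lin_map M x) = n" using lin_map_carrier[OF M, of x] by simp
  fix i assume "i < dim_vec (lin_map M x @\<^sub>v y)"
  then have i: "i < n + k" using Mx y by simp
  have "lin_map (block_mat n k M) (x @\<^sub>v y) $ i = (\<Sum>j<n + k. zmul (block_mat n k M $$ (i, j)) ((x @\<^sub>v y) $ j))"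
    by (rule lin_map_index[OF block_mat_carrier xy i])
  also have "\<dots> = (\<Sum>j<n. zmul (block_mat n k M $$ (i, j)) ((x @\<^sub>v y) $ j)) +
      (\<Sum>j\<in>{n..<n + k}. zmul (block_mat n k M $$ (i, j)) ((x @\<^sub>v y) $ j))"
    by (subst sum.union_disjoint[symmetric]) (auto intro: sum.cong)
  also have "\<dots> = (lin_map M x @\<^sub>v y) $ i"
  proof (cases "i < n")
    case True
    have "(\<Sum>j<n. zmul (block_mat n k M $$ (i, j)) ((x @\<^sub>v y) $ j)) = lin_map M x $ i"
      unfolding lin_map_index[OF M x True] using True x y by (intro sum.cong) (auto simp: block_mat_def)
    moreover have "(\<Sum>j\<in>{n..<n + k}. zmul (block_mat n k M $$ (i, j)) ((x @\<^sub>v y) $ j)) = 0"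
      using True by (intro sum.neutral) (auto simp: block_mat_def)
    ultimately show ?thesis using True Mx y by simp
  next
    case False
    have "(\<Sum>j<n. zmul (block_mat n k M $$ (i, j)) ((x @\<^sub>v y) $ j)) = 0"
      using False i by (intro sum.neutral) (auto simp: block_mat_def)
    moreover have "(\<Sum>j\<in>{n..<n + k}. zmul (block_mat n k M $$ (i, j)) ((x @\<^sub>v y) $ j)) =
        (\<Sum>j\<in>{n..<n + k}. if j = i then (x @\<^sub>v y) $ j else 0)"
      using False i by (intro sum.cong) (auto simp: block_mat_def)
    ultimately show ?thesis using False i x y Mx by simp
  qed
  finally show "lin_map (block_mat n k M) (x @\<^sub>v y) $ i = (lin_map M x @\<^sub>v y) $ i" .
qed (use lin_map_carrier[OF M, of x] y in \<open>simp add: lin_map_def block_mat_def\<close>)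

text \<open>The block sum with an inverse of \<open>M\<close> is inverse to it, which is checked on
  the action on integer vectors.\<close>

lemma invertible_block_mat:
  assumes M: "M \<in> carrier_mat n n" "invertible_mat M"
  shows "invertible_mat (block_mat n k M)"
proof -
  obtain N where N: "M * N = 1\<^sub>m n" "N * M = 1\<^sub>m (dim_row N)"
    using M unfolding invertible_mat_def inverts_mat_def by auto
  have Nc: "N \<in> carrier_mat n n"
  proof -
    have "dim_col (M * N) = n" "dim_col (N * M) = dim_row N" using N by simp_all
    then show ?thesis using M(1) by auto
  qed
  have NM: "N * M = 1\<^sub>m n" using N(2) Nc by simp
  have *: "lin_map (block_mat n k P) (lin_map (block_mat n k Q) v) = v"
    if "P \<in> carrier_mat n n" "Q \<in> carrier_mat n n" "P * Q = 1\<^sub>m n" "v \<in> carrier_vec (n + k)" for P Q and v :: "int vec"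
  proof -
    have v: "vec_first v n \<in> carrier_vec n" "vec_last v k \<in> carrier_vec k" by simp_all
    have "lin_map (block_mat n k P) (lin_map (block_mat n k Q) (vec_first v n @\<^sub>v vec_last v k)) =
        lin_map P (lin_map Q (vec_first v n)) @\<^sub>v vec_last v k"
      using lin_map_block[OF that(2) v] lin_map_block[OF that(1) lin_map_carrier[OF that(2)] v(2)] by simp
    also have "\<dots> = vec_first v n @\<^sub>v vec_last v k"
      using lin_map_mult[OF that(1,2) v(1)] that(3) lin_map_one[OF v(1)] by simp
    finally show ?thesis using that(4) by simp
  qed
  show ?thesis
    by (rule invertible_matI[of "1 :: int", OF _ block_mat_carrier block_mat_carrier *[OF M(1) Nc N(1)] *[OF Nc M(1) NM]]) simp_all
qed

text \<open>The pieces are the products of the old pieces with \<open>Y\<close>. On each, the matrix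
  becomes a block sum with an identity and the translation is padded by zeros.\<close>

lemma Gamma_mor_prod:
  fixes X :: "'g::doag vec set"
  assumes A: "add_subgroup A" and f: "Gamma_mor A n X X' f" and Y: "Y \<in> definable A k"
  shows "Gamma_mor A (n + k) (vec_prod X Y) (vec_prod X' Y) (\<lambda>v. f (vec_first v n) @\<^sub>v vec_last v k)"
proof -
  define F where "F = (\<lambda>v. f (vec_first v n) @\<^sub>v vec_last v k)"
  obtain P where X: "X \<in> definable A n" and X': "X' \<in> definable A n" and bij: "bij_betw f X X'"
    and P: "finite P" "P \<subseteq> definable A n" "\<Union>P = X" "disjoint P"
    and PM: "\<forall>Z\<in>P. \<exists>M\<in>carrier_mat n n. \<exists>a\<in>carrier_vec n.
           invertible_mat M \<and> (\<forall>i<n. a $ i \<in> A) \<and> (\<forall>x\<in>Z. f x = affine_map M a x)"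
    using f unfolding Gamma_mor_def by blast
  note Xc = definable_carrier[OF X] and Xc' = definable_carrier[OF X'] and Yc = definable_carrier[OF Y]
  have F: "F (x @\<^sub>v y) = f x @\<^sub>v y" if "x \<in> X" "y \<in> Y" for x y
    using that Xc Yc by (simp add: F_def vec_first_append vec_last_append subset_iff)
  have inj: "x = x' \<and> y = y'" if "x @\<^sub>v y = x' @\<^sub>v y'" "x \<in> carrier_vec n" "x' \<in> carrier_vec n"
    "y \<in> carrier_vec k" "y' \<in> carrier_vec k" for x x' y y'
    using that by (metis vec_first_append vec_last_append)
  have "bij_betw F (vec_prod X Y) (vec_prod X' Y)"
  proof (rule bij_betw_imageI)
    show "inj_on F (vec_prod X Y)"
    proof (rule inj_onI)
      fix v w assume v: "v \<in> vec_prod X Y" and w: "w \<in> vec_prod X Y" and eq: "F v = F w"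
      from v obtain x y where v': "v = x @\<^sub>v y" "x \<in> X" "y \<in> Y" by blast
      from w obtain x' y' where w': "w = x' @\<^sub>v y'" "x' \<in> X" "y' \<in> Y" by blast
      have "f x \<in> X'" "f x' \<in> X'" using bij v' w' by (auto simp: bij_betw_def)
      moreover have "f x @\<^sub>v y = f x' @\<^sub>v y'" using eq F v' w' by simp
      ultimately have "f x = f x'" "y = y'" using inj v' w' Xc' Yc by blast+
      then have "x = x'" using bij v' w' by (auto simp: bij_betw_def dest: inj_onD)
      then show "v = w" using v' w' \<open>y = y'\<close> by simp
    qed
    show "F ` vec_prod X Y = vec_prod X' Y"
    proof (intro equalityI subsetI)
      fix w assume "w \<in> F ` vec_prod X Y"
      then obtain x y where "x \<in> X" "y \<in> Y" "w = f x @\<^sub>v y" using F by auto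
      moreover have "f x \<in> X'" if "x \<in> X" for x using bij that by (auto simp: bij_betw_def)
      ultimately show "w \<in> vec_prod X' Y" by blast
    next
      fix w assume "w \<in> vec_prod X' Y"
      then obtain x' y where w: "x' \<in> X'" "y \<in> Y" "w = x' @\<^sub>v y" by blast
      then obtain x where "x \<in> X" "x' = f x" using bij by (auto simp: bij_betw_def)
      then have "w = F (x @\<^sub>v y)" "x @\<^sub>v y \<in> vec_prod X Y" using w F by auto
      then show "w \<in> F ` vec_prod X Y" by blast
    qed
  qed
  moreover have "\<exists>P. finite P \<and> P \<subseteq> definable A (n + k) \<and> \<Union>P = vec_prod X Y \<and> disjoint P \<and>
        (\<forall>Z\<in>P. \<exists>M\<in>carrier_mat (n + k) (n + k). \<exists>a\<in>carrier_vec (n + k).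
           invertible_mat M \<and> (\<forall>i<n + k. a $ i \<in> A) \<and> (\<forall>x\<in>Z. F x = affine_map M a x))"
  proof (intro exI[of _ "(\<lambda>Z. vec_prod Z Y) ` P"] conjI ballI)
    show "finite ((\<lambda>Z. vec_prod Z Y) ` P)" using P(1) by simp
    show "(\<lambda>Z. vec_prod Z Y) ` P \<subseteq> definable A (n + k)"
      using P(2) definable_vec_prod[OF _ Y] by auto
    show "\<Union>((\<lambda>Z. vec_prod Z Y) ` P) = vec_prod X Y" using P(3) by blast
    show "disjoint ((\<lambda>Z. vec_prod Z Y) ` P)"
    proof (rule disjointI)
      fix U V assume "U \<in> (\<lambda>Z. vec_prod Z Y) ` P" "V \<in> (\<lambda>Z. vec_prod Z Y) ` P" "U \<noteq> V"
      then obtain Z W where ZW: "Z \<in> P" "W \<in> P" "U = vec_prod Z Y" "V = vec_prod W Y" "Z \<noteq> W" by blast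
      have "Z \<inter> W = {}" using P(4) ZW by (auto simp: disjoint_def)
      moreover have "Z \<subseteq> carrier_vec n" "W \<subseteq> carrier_vec n" using ZW P(2) definable_carrier by blast+
      moreover have False if "v \<in> U" "v \<in> V" for v
      proof -
        from that ZW obtain x y where v: "v = x @\<^sub>v y" "x \<in> Z" "y \<in> Y" by blast
        from that ZW obtain x' y' where v': "v = x' @\<^sub>v y'" "x' \<in> W" "y' \<in> Y" by blast
        have "x @\<^sub>v y = x' @\<^sub>v y'" using v(1) v'(1) by simp
        moreover have "x \<in> carrier_vec n" "x' \<in> carrier_vec n" "y \<in> carrier_vec k" "y' \<in> carrier_vec k"
          using v v' Yc \<open>Z \<subseteq> _\<close> \<open>W \<subseteq> _\<close> by blast+
        ultimately have "x = x'" using inj by blast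
        then show False using v v' \<open>Z \<inter> W = {}\<close> by blast
      qed
      ultimately show "U \<inter> V = {}" by blast
    qed
    fix U assume "U \<in> (\<lambda>Z. vec_prod Z Y) ` P"
    then obtain Z where Z: "Z \<in> P" "U = vec_prod Z Y" by blast
    then obtain M a where M: "M \<in> carrier_mat n n" "invertible_mat M" and a: "a \<in> carrier_vec n" "\<forall>i<n. a $ i \<in> A"
      and fM: "\<forall>x\<in>Z. f x = affine_map M a x" using PM by blast
    have "F v = affine_map (block_mat n k M) (a @\<^sub>v 0\<^sub>v k) v" if vU: "v \<in> U" for v
    proof -
      obtain x y where v: "v = x @\<^sub>v y" "x \<in> Z" "y \<in> Y" using vU Z by blast
      have xX: "x \<in> X" using v(2) Z(1) P(3) by blast
      have c: "x \<in> carrier_vec n" "y \<in> carrier_vec k" using xX v Xc Yc by auto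
      have "F v = (lin_map M x + a) @\<^sub>v (y + 0\<^sub>v k)"
        using F[OF xX v(3)] fM v c by (simp add: affine_map_def lin_map_def)
      also have "\<dots> = (lin_map M x @\<^sub>v y) + (a @\<^sub>v 0\<^sub>v k)"
        using append_vec_add[OF lin_map_carrier[OF M(1), of x] a(1) c(2), of "0\<^sub>v k"] by simp
      also have "\<dots> = affine_map (block_mat n k M) (a @\<^sub>v 0\<^sub>v k) v"
        unfolding lin_map_block[OF M(1) c, symmetric] v(1)[symmetric] by (simp add: affine_map_def lin_map_def)
      finally show ?thesis .
    qed
    moreover have "\<forall>i<n + k. (a @\<^sub>v 0\<^sub>v k) $ i \<in> A"
      using a A by (auto simp: add_subgroup_def)
    ultimately show "\<exists>M\<in>carrier_mat (n + k) (n + k). \<exists>a\<in>carrier_vec (n + k).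
           invertible_mat M \<and> (\<forall>i<n + k. a $ i \<in> A) \<and> (\<forall>x\<in>U. F x = affine_map M a x)"
      using block_mat_carrier invertible_block_mat[OF M] a
      by (intro bexI[of _ "block_mat n k M"] bexI[of _ "a @\<^sub>v 0\<^sub>v k"]) auto
  qed
  ultimately show ?thesis
    unfolding Gamma_mor_def F_def[symmetric] using definable_vec_prod[OF X Y] definable_vec_prod[OF X' Y] by blast
qed

lemma Gamma_iso_prod:
  assumes A: "add_subgroup A" and iso: "Gamma_iso A n X X'" and Y: "Y \<in> definable A k"
  shows "Gamma_iso A (n + k) (vec_prod X Y) (vec_prod X' Y)"
proof -
  obtain f g where fg: "Gamma_mor A n X X' f" "Gamma_mor A n X' X g"
    "\<forall>x\<in>X. g (f x) = x" "\<forall>y\<in>X'. f (g y) = y"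
    using iso unfolding Gamma_iso_def by blast
  have X: "X \<subseteq> carrier_vec n" "X' \<subseteq> carrier_vec n" and Yc: "Y \<subseteq> carrier_vec k"
    using Gamma_morD(1,2)[OF fg(1)] Y definable_carrier by blast+
  let ?F = "\<lambda>f v. f (vec_first v n) @\<^sub>v vec_last v k"
  have app: "?F h (x @\<^sub>v y) = h x @\<^sub>v y" if "x \<in> carrier_vec n" "y \<in> Y" for h x y
    using that Yc by (simp add: vec_first_append vec_last_append subset_iff)
  have "?F g (?F f v) = v" if vv: "v \<in> vec_prod X Y" for v
  proof -
    obtain x y where v: "v = x @\<^sub>v y" "x \<in> X" "y \<in> Y" using vv by blast
    have "x \<in> carrier_vec n" "f x \<in> carrier_vec n" using v X bij_betwE[OF Gamma_morD(3)[OF fg(1)]] by blast+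
    then show ?thesis using v fg(3) app by simp
  qed
  moreover have "?F f (?F g v) = v" if vv: "v \<in> vec_prod X' Y" for v
  proof -
    obtain x y where v: "v = x @\<^sub>v y" "x \<in> X'" "y \<in> Y" using vv by blast
    have "x \<in> carrier_vec n" "g x \<in> carrier_vec n" using v X bij_betwE[OF Gamma_morD(3)[OF fg(2)]] by blast+
    then show ?thesis using v fg(4) app by simp
  qed
  ultimately show ?thesis
    unfolding Gamma_iso_def using Gamma_mor_prod[OF A fg(1) Y] Gamma_mor_prod[OF A fg(2) Y] by blast
qed

lemma Gamma_iso_prod_commute:
  fixes X :: "'g::doag vec set"
  assumes A: "add_subgroup A" and X: "X \<in> definable A n" and Y: "Y \<in> definable A k"
  shows "Gamma_iso A (n + k) (vec_prod X Y) (vec_prod Y X)"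
proof -
  \<comment> \<open>Coordinate i of y followed by x is coordinate n + i (for i < k) or i - k of x
    followed by y.\<close>
  define \<sigma> where "\<sigma> = (\<lambda>i. if i < k then n + i else i - k)"
  define \<tau> where "\<tau> = (\<lambda>i. if i < n then k + i else i - n)"
  have \<sigma>: "\<sigma> i < n + k" "\<tau> (\<sigma> i) = i" and \<tau>: "\<tau> i < n + k" "\<sigma> (\<tau> i) = i" if "i < n + k" for i
    using that by (auto simp: \<sigma>_def \<tau>_def)
  let ?M = "select_mat (n + k) (n + k) \<sigma>" and ?M' = "select_mat (n + k) (n + k) \<tau>"
  have M: "lin_map ?M v = vec (n + k) (\<lambda>i. v $ \<sigma> i)" "lin_map ?M' v = vec (n + k) (\<lambda>i. v $ \<tau> i)"
    if "v \<in> carrier_vec (n + k)" for v :: "'g vec"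
    using lin_map_select[OF that] \<sigma> \<tau> by auto
  have inv: "lin_map ?M (lin_map ?M' v) = v" "lin_map ?M' (lin_map ?M v) = v"
    if "v \<in> carrier_vec (n + k)" for v :: "'g vec"
    using that \<sigma> \<tau> by (auto simp: M intro!: eq_vecI)
  have swap: "lin_map ?M (x @\<^sub>v y) = y @\<^sub>v x" if "x \<in> carrier_vec n" "y \<in> carrier_vec k" for x y :: "'g vec"
  proof -
    have xy: "x @\<^sub>v y \<in> carrier_vec (n + k)" using that by simp
    show ?thesis unfolding M(1)[OF xy] using that by (intro eq_vecI) (auto simp: \<sigma>_def)
  qed
  have "lin_map ?M ` vec_prod X Y = vec_prod Y X"
    using swap definable_carrier[OF X] definable_carrier[OF Y] by (fastforce simp: image_iff subset_iff)
  then show ?thesis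
    using Gamma_iso_linear[OF A definable_vec_prod[OF X Y] select_mat_carrier select_mat_carrier inv] by simp
qed

section \<open>The Grothendieck semiring\<close>

lemma object_monoid_simps:
  "carrier (object_monoid A) = {(n, X). X \<in> bdd_obj A n}"
  "(n, X) \<otimes>\<^bsub>object_monoid A\<^esub> (k, Y) = (n + k, vec_prod X Y)"
  "\<one>\<^bsub>object_monoid A\<^esub> = (0, carrier_vec 0)"
  by (simp_all add: object_monoid_def)

lemma append_vec_assoc: "(x @\<^sub>v y) @\<^sub>v z = x @\<^sub>v (y @\<^sub>v z)"
  by (intro eq_vecI) (auto simp: append_vec_def Let_def)

lemma append_vec_empty: "x \<in> carrier_vec 0 \<Longrightarrow> x @\<^sub>v y = y" "x \<in> carrier_vec 0 \<Longrightarrow> y @\<^sub>v x = y"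
  by (intro eq_vecI; auto simp: append_vec_def Let_def)+

lemma vec_prod_assoc: "vec_prod (vec_prod X Y) Z = vec_prod X (vec_prod Y Z)"
proof (intro equalityI subsetI)
  fix v assume "v \<in> vec_prod (vec_prod X Y) Z"
  then obtain x y z where "v = (x @\<^sub>v y) @\<^sub>v z" "x \<in> X" "y \<in> Y" "z \<in> Z" by blast
  then show "v \<in> vec_prod X (vec_prod Y Z)" unfolding append_vec_assoc by blast
next
  fix v assume "v \<in> vec_prod X (vec_prod Y Z)"
  then obtain x y z where "v = x @\<^sub>v (y @\<^sub>v z)" "x \<in> X" "y \<in> Y" "z \<in> Z" by blast
  then show "v \<in> vec_prod (vec_prod X Y) Z" unfolding append_vec_assoc[symmetric] by blast
qed

lemma vec_prod_unit:
  fixes X :: "'a::zero vec set"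
  shows "vec_prod (carrier_vec 0) X = X" "vec_prod X (carrier_vec 0) = X"
proof -
  have e: "(0\<^sub>v 0 :: 'a vec) \<in> carrier_vec 0" by simp
  show "vec_prod (carrier_vec 0) X = X"
  proof (intro equalityI subsetI)
    fix v assume "v \<in> X"
    then show "v \<in> vec_prod (carrier_vec 0) X" using e unfolding mem_Collect_eq
      by - (rule exI[of _ "0\<^sub>v 0"], rule exI[of _ v], simp only: append_vec_empty(1)[OF e] simp_thms)
  qed (auto simp: append_vec_empty)
  show "vec_prod X (carrier_vec 0) = X"
  proof (intro equalityI subsetI)
    fix v assume "v \<in> X"
    then show "v \<in> vec_prod X (carrier_vec 0)" using e unfolding mem_Collect_eq
      by - (rule exI[of _ v], rule exI[of _ "0\<^sub>v 0"], simp only: append_vec_empty(2)[OF e] simp_thms)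
  qed (auto simp: append_vec_empty)
qed

lemma bdd_obj_0: "add_subgroup A \<Longrightarrow> carrier_vec 0 \<in> bdd_obj A 0"
  by (simp add: bdd_obj_def definable_univ)

locale subgroup_base =
  fixes A :: "'g::doag set"
  assumes A: "add_subgroup A"
begin

abbreviation "M \<equiv> object_monoid A"
abbreviation "S \<equiv> scissor_relations A"

lemma scissor_relations_cases:
  assumes "(u, v) \<in> S"
  obtains (cut) n X1 X2 Z1 Z2 where "X1 \<in> bdd_obj A n" "X2 \<in> bdd_obj A n" "Z1 \<union> Z2 \<in> bdd_obj A n"
      "Z1 \<in> bdd_obj A n" "Z2 \<in> bdd_obj A n" "Z1 \<inter> Z2 = {}" "Gamma_iso A n Z1 X1" "Gamma_iso A n Z2 X2"
      "u = {#(n, X1), (n, X2)#}" "v = {#(n, Z1 \<union> Z2)#}"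
  | (empty) n where "u = {#(n, {})#}" "v = {#}"
proof -
  from assms consider
    (1) n X1 X2 Z Z1 Z2 where "u = {#(n, X1), (n, X2)#}" "v = {#(n, Z)#}"
      "X1 \<in> bdd_obj A n" "X2 \<in> bdd_obj A n" "Z \<in> bdd_obj A n"
      "Z1 \<in> bdd_obj A n" "Z2 \<in> bdd_obj A n" "Z = Z1 \<union> Z2" "Z1 \<inter> Z2 = {}"
      "Gamma_iso A n Z1 X1" "Gamma_iso A n Z2 X2"
    | (2) n where "u = {#(n, {})#}" "v = {#}"
    unfolding scissor_relations_def by blast
  then show thesis
  proof cases
    case 1
    then show thesis by (intro cut[of X1 n X2 Z1 Z2]) simp_all
  next
    case 2
    then show thesis by (rule empty)
  qed
qed

lemma scissor_relations_cutI:
  "X1 \<in> bdd_obj A n \<Longrightarrow> X2 \<in> bdd_obj A n \<Longrightarrow> Z1 \<union> Z2 \<in> bdd_obj A n \<Longrightarrow>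
    Z1 \<in> bdd_obj A n \<Longrightarrow> Z2 \<in> bdd_obj A n \<Longrightarrow> Z1 \<inter> Z2 = {} \<Longrightarrow> Gamma_iso A n Z1 X1 \<Longrightarrow> Gamma_iso A n Z2 X2 \<Longrightarrow>
    ({#(n, X1), (n, X2)#}, {#(n, Z1 \<union> Z2)#}) \<in> S"
  unfolding scissor_relations_def by blast

lemma scissor_relations_emptyI: "({#(n, {})#}, {#}) \<in> S"
  unfolding scissor_relations_def by blast

lemma object_cut:
  assumes "X1 \<in> bdd_obj A n" "X2 \<in> bdd_obj A n" "Z1 \<union> Z2 \<in> bdd_obj A n"
    "Z1 \<in> bdd_obj A n" "Z2 \<in> bdd_obj A n" "Z1 \<inter> Z2 = {}" "Gamma_iso A n Z1 X1" "Gamma_iso A n Z2 X2"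
  shows "({#(n, X1), (n, X2)#}, {#(n, Z1 \<union> Z2)#}) \<in> add_congruence (carrier M) S"
  using assms by (intro add_congruence.base scissor_relations_cutI)

text \<open>A cut with an empty second part: [X] = [X] + [empty] = [Z].\<close>

lemma object_iso:
  assumes X: "X \<in> bdd_obj A n" and Z: "Z \<in> bdd_obj A n" and iso: "Gamma_iso A n Z X"
  shows "({#(n, X)#}, {#(n, Z)#}) \<in> add_congruence (carrier M) S"
proof -
  have e: "{} \<in> bdd_obj A n" using bdd_obj_empty[OF A] .
  have cut: "({#(n, X), (n, {})#}, {#(n, Z \<union> {})#}) \<in> add_congruence (carrier M) S"
    using X Z e iso Gamma_iso_refl[OF A bdd_objD(1)[OF e]] by (intro object_cut) simp_all
  have "({#(n, {})#} + {#(n, X)#}, {#} + {#(n, X)#}) \<in> add_congruence (carrier M) S"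
    using X scissor_relations_emptyI by (intro add_congruence.plus add_congruence.base) (auto simp: object_monoid_simps)
  then have "({#(n, X)#}, {#(n, X), (n, {})#}) \<in> add_congruence (carrier M) S"
    by (intro add_congruence.sym[of "{#(n, X), (n, {})#}"]) (simp add: add_mset_commute)
  from add_congruence.trans[OF this cut] show ?thesis by simp
qed

sublocale K: semiring_presentation "object_monoid A" "scissor_relations A"
proof -
  interpret monoid M
  proof (rule monoidI)
    fix x y z assume "x \<in> carrier M" "y \<in> carrier M" "z \<in> carrier M"
    show "x \<otimes>\<^bsub>M\<^esub> y \<otimes>\<^bsub>M\<^esub> z = x \<otimes>\<^bsub>M\<^esub> (y \<otimes>\<^bsub>M\<^esub> z)"
      by (cases x; cases y; cases z) (simp only: object_monoid_simps vec_prod_assoc add.assoc)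
  next
    fix x assume "x \<in> carrier M"
    show "\<one>\<^bsub>M\<^esub> \<otimes>\<^bsub>M\<^esub> x = x"
      by (cases x) (simp only: object_monoid_simps vec_prod_unit add_0)
    show "x \<otimes>\<^bsub>M\<^esub> \<one>\<^bsub>M\<^esub> = x"
      by (cases x) (simp only: object_monoid_simps vec_prod_unit add_0_right)
  qed (auto simp only: object_monoid_simps bdd_obj_vec_prod bdd_obj_0[OF A] mem_Collect_eq case_prod_conv)
  show "semiring_presentation M S"
  proof
    fix u v assume "(u, v) \<in> S"
    then show "set_mset u \<subseteq> carrier M \<and> set_mset v \<subseteq> carrier M"
      by (cases rule: scissor_relations_cases) (auto simp: object_monoid_simps bdd_obj_empty[OF A])
    fix g assume g: "g \<in> carrier M"
    then obtain k Y where g: "g = (k, Y)" and Y: "Y \<in> bdd_obj A k" by (auto simp: object_monoid_simps)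
    show "({#x \<otimes>\<^bsub>M\<^esub> g. x \<in># u#}, {#x \<otimes>\<^bsub>M\<^esub> g. x \<in># v#}) \<in> add_congruence (carrier M) S"
      using \<open>(u, v) \<in> S\<close>
    proof (cases rule: scissor_relations_cases)
      case (cut n X1 X2 Z1 Z2)
      \<comment> \<open>Products distribute over the cut, and the parts stay disjoint because a
        concatenation determines its first component.\<close>
      have dist: "vec_prod (Z1 \<union> Z2) Y = vec_prod Z1 Y \<union> vec_prod Z2 Y" by blast
      have "vec_prod Z1 Y \<inter> vec_prod Z2 Y = {}"
      proof -
        have False if "x \<in> Z1" "x' \<in> Z2" "y \<in> Y" "y' \<in> Y" "x @\<^sub>v y = x' @\<^sub>v y'" for x x' y y'
        proof -
          have "x \<in> carrier_vec n" "x' \<in> carrier_vec n"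
            using that cut bdd_objD(2) by blast+
          then have "x = x'" using that(5) vec_first_append by metis
          then show False using that cut by blast
        qed
        then show ?thesis by blast
      qed
      then have "({#(n + k, vec_prod X1 Y), (n + k, vec_prod X2 Y)#}, {#(n + k, vec_prod Z1 Y \<union> vec_prod Z2 Y)#})
          \<in> add_congruence (carrier M) S"
        using cut Y bdd_obj_vec_prod[of _ A n Y k] bdd_obj_vec_prod[OF cut(3) Y, unfolded dist]
          Gamma_iso_prod[OF A _ bdd_objD(1)[OF Y]]
        by (intro object_cut) simp_all
      then show ?thesis unfolding cut g dist[symmetric] by (simp add: object_monoid_simps)
    next
      case (empty n)
      have "vec_prod {} Y = {}" by blast
      then show ?thesis using empty g scissor_relations_emptyI[of "n + k"]
        by (auto simp: object_monoid_simps intro: add_congruence.base)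
    qed
  next
    fix x y assume "x \<in> carrier M" "y \<in> carrier M"
    then obtain n X k Y where x: "x = (n, X)" "X \<in> bdd_obj A n" and y: "y = (k, Y)" "Y \<in> bdd_obj A k"
      by (auto simp: object_monoid_simps)
    have "({#(n + k, vec_prod X Y)#}, {#(n + k, vec_prod Y X)#}) \<in> add_congruence (carrier M) S"
      using x y bdd_obj_vec_prod[OF x(2) y(2)] bdd_obj_vec_prod[OF y(2) x(2)] 
        Gamma_iso_prod_commute[OF A bdd_objD(1)[OF y(2)] bdd_objD(1)[OF x(2)]]
      by (intro object_iso) (simp_all add: add.commute)
    then show "({#x \<otimes>\<^bsub>M\<^esub> y#}, {#y \<otimes>\<^bsub>M\<^esub> x#}) \<in> add_congruence (carrier M) S"
      by (simp add: x y object_monoid_simps add.commute)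
  qed
qed

abbreviation "Kp \<equiv> K_plus A"

sublocale Kp: commutative_semiring "K_plus A"
  unfolding K_plus_def by (rule K.presented_commutative_semiring)

lemma K_class_closed: "X \<in> bdd_obj A n \<Longrightarrow> K_class A n X \<in> carrier Kp"
  by (auto simp: K_class_def K_plus_def K.presented_carrier object_monoid_simps)

lemma K_class_mult:
  "X \<in> bdd_obj A n \<Longrightarrow> Y \<in> bdd_obj A k \<Longrightarrow>
    K_class A n X \<otimes>\<^bsub>Kp\<^esub> K_class A k Y = K_class A (n + k) (vec_prod X Y)"
  using K.presented_mult[of "{#(n, X)#}" "{#(k, Y)#}"]
  by (simp add: K_class_def K_plus_def object_monoid_simps)

lemma K_class_iso: "X \<in> bdd_obj A n \<Longrightarrow> Z \<in> bdd_obj A n \<Longrightarrow> Gamma_iso A n Z X \<Longrightarrow> K_class A n X = K_class A n Z"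
  unfolding K_class_def by (intro K.presented_eq object_iso)

lemma K_class_Un:
  assumes "X \<in> bdd_obj A n" "Y \<in> bdd_obj A n" "X \<union> Y \<in> bdd_obj A n" "X \<inter> Y = {}"
  shows "K_class A n (X \<union> Y) = K_class A n X \<oplus>\<^bsub>Kp\<^esub> K_class A n Y"
proof -
  have "presented_class M S {#(n, X), (n, Y)#} = presented_class M S {#(n, X \<union> Y)#}"
    using assms Gamma_iso_refl[OF A bdd_objD(1)[OF assms(1)]] Gamma_iso_refl[OF A bdd_objD(1)[OF assms(2)]]
    by (intro K.presented_eq object_cut)
  then show ?thesis
    using K.presented_add[of "{#(n, X)#}" "{#(n, Y)#}"] assms
    by (simp add: K_class_def K_plus_def object_monoid_simps add_mset_commute)
qed

lemma K_class_empty: "K_class A n {} = \<zero>\<^bsub>Kp\<^esub>"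
  unfolding K_class_def K_plus_def K.presented_zero
  by (intro K.presented_relation scissor_relations_emptyI)

lemma K_class_unit: "K_class A 0 (carrier_vec 0) = \<one>\<^bsub>Kp\<^esub>"
  by (simp add: K_class_def K_plus_def K.presented_one object_monoid_simps)

lemma K_plus_degreeE:
  assumes "x \<in> K_plus_degree A n"
  obtains u where "\<forall>p\<in>#u. fst p = n \<and> snd p \<in> bdd_obj A n" "set_mset u \<subseteq> carrier M"
    "x = presented_class M S u"
proof -
  obtain u where u: "\<forall>p\<in>#u. fst p = n \<and> snd p \<in> bdd_obj A n" "x = presented_class M S u"
    using assms by (auto simp: K_plus_degree_def)
  have "p \<in> carrier M" if "p \<in># u" for p
    using u that by (cases p) (force simp: object_monoid_simps)
  with u show thesis by (intro that[of u]) auto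
qed

lemma K_plus_degree_closed: "x \<in> K_plus_degree A n \<Longrightarrow> x \<in> carrier Kp"
  by (erule K_plus_degreeE) (auto simp: K_plus_def K.presented_carrier)

text \<open>A homogeneous element is a finite sum of classes of sets, so additive statements reduce
  to one class at a time.\<close>

lemma K_plus_degree_induct [consumes 1, case_names zero add]:
  assumes x: "x \<in> K_plus_degree A n" and "P \<zero>\<^bsub>Kp\<^esub>"
    and step: "\<And>X x. X \<in> bdd_obj A n \<Longrightarrow> x \<in> K_plus_degree A n \<Longrightarrow> P x \<Longrightarrow> P (K_class A n X \<oplus>\<^bsub>Kp\<^esub> x)"
  shows "P x"
proof -
  obtain u where u: "\<forall>p\<in>#u. fst p = n \<and> snd p \<in> bdd_obj A n" and xu: "x = presented_class M S u"
    using x by (auto simp: K_plus_degree_def)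
  from u have "P (presented_class M S u)"
  proof (induction u)
    case empty
    then show ?case using assms(2) by (simp add: K_plus_def K.presented_zero)
  next
    case (add p u)
    obtain X where p: "p = (n, X)" "X \<in> bdd_obj A n" using add.prems by (cases p) auto
    have u: "\<forall>p\<in>#u. fst p = n \<and> snd p \<in> bdd_obj A n" using add.prems by simp
    have "presented_class M S u \<in> K_plus_degree A n" using u by (auto simp: K_plus_degree_def)
    moreover have "set_mset u \<subseteq> carrier M"
    proof
      fix p assume "p \<in># u"
      then show "p \<in> carrier M" using u by (cases p) (force simp: object_monoid_simps)
    qed
    then have "presented_class M S (add_mset p u) = K_class A n X \<oplus>\<^bsub>Kp\<^esub> presented_class M S u"
      using K.presented_add[of "{#(n, X)#}" u] p
      by (simp add: K_class_def K_plus_def object_monoid_simps)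
    ultimately show ?case using step[OF p(2)] add.IH[OF u] by simp
  qed
  then show ?thesis by (simp add: xu)
qed

lemma K_plus_degree_zero: "\<zero>\<^bsub>Kp\<^esub> \<in> K_plus_degree A n"
  by (auto simp: K_plus_degree_def K_plus_def K.presented_zero intro!: exI[of _ "{#}"])

lemma K_plus_degree_class: "X \<in> bdd_obj A n \<Longrightarrow> K_class A n X \<in> K_plus_degree A n"
  by (auto simp: K_plus_degree_def K_class_def intro!: exI[of _ "{#(n, X)#}"])

lemma K_plus_degree_add:
  assumes "x \<in> K_plus_degree A n" "y \<in> K_plus_degree A n"
  shows "x \<oplus>\<^bsub>Kp\<^esub> y \<in> K_plus_degree A n"
proof -
  obtain u where u: "\<forall>p\<in>#u. fst p = n \<and> snd p \<in> bdd_obj A n" "set_mset u \<subseteq> carrier M"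
      "x = presented_class M S u"
    using assms(1) by (rule K_plus_degreeE)
  obtain v where v: "\<forall>p\<in>#v. fst p = n \<and> snd p \<in> bdd_obj A n" "set_mset v \<subseteq> carrier M"
      "y = presented_class M S v"
    using assms(2) by (rule K_plus_degreeE)
  have "x \<oplus>\<^bsub>Kp\<^esub> y = presented_class M S (u + v)"
    using K.presented_add[OF u(2) v(2)] u(3) v(3) by (simp add: K_plus_def)
  moreover have "\<forall>p\<in>#u + v. fst p = n \<and> snd p \<in> bdd_obj A n" using u(1) v(1) by (simp add: ball_Un)
  ultimately show ?thesis unfolding K_plus_degree_def by blast
qed

lemma K_plus_degree_mult_class:
  assumes "y \<in> K_plus_degree A k" "X \<in> bdd_obj A n"
  shows "K_class A n X \<otimes>\<^bsub>Kp\<^esub> y \<in> K_plus_degree A (n + k)"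
  using assms(1)
proof (induction rule: K_plus_degree_induct)
  case zero
  then show ?case using K_class_closed[OF assms(2)] K_plus_degree_zero by simp
next
  case (add Y y)
  then show ?case
    using assms(2) K_class_closed K_plus_degree_closed
    by (simp add: Kp.r_distr K_class_mult K_plus_degree_add K_plus_degree_class bdd_obj_vec_prod)
qed

lemma K_plus_degree_mult:
  assumes "x \<in> K_plus_degree A n" and y: "y \<in> K_plus_degree A k"
  shows "x \<otimes>\<^bsub>Kp\<^esub> y \<in> K_plus_degree A (n + k)"
  using assms(1)
proof (induction rule: K_plus_degree_induct)
  case zero
  then show ?case using K_plus_degree_closed[OF y] K_plus_degree_zero by simp
next
  case (add X x)
  then show ?case
    using K_class_closed[OF add(1)] K_plus_degree_closed[OF add(2)] K_plus_degree_closed[OF y]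
    by (simp add: Kp.l_distr K_plus_degree_add K_plus_degree_mult_class[OF y])
qed

end

section \<open>Dimension-free values of bounded definable sets\<close>

lemma lin_one:
  fixes x :: "'g::ab_group_add vec"
  shows "x \<in> carrier_vec 1 \<Longrightarrow> lin (vec 1 (\<lambda>_. k)) x = zmul k (x $ 0)"
  by (simp add: lin_def)

lemma zmul_le_iff: "0 < k \<Longrightarrow> zmul k x \<le> zmul k y \<longleftrightarrow> x \<le> (y :: 'a :: linordered_ab_group_add)"
  by (simp add: not_less[symmetric] zmul_less_iff)

text \<open>The parameter \<open>a\<close> may lie outside \<open>A\<close>. With k a in
  \<open>A\<close> the condition is rewritten for the integral form k x_0.\<close>

lemma definable_coordinate:
  fixes A :: "'g::doag set"
  assumes "a \<in> div_hull A"
  shows "{x \<in> carrier_vec 1. x $ 0 = a} \<in> definable A 1"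
    and "{x \<in> carrier_vec 1. x $ 0 \<le> a} \<in> definable A 1"
    and "{x \<in> carrier_vec 1. x $ 0 < a} \<in> definable A 1"
proof -
  obtain k where k: "0 < k" "zmul k a \<in> A" using assms by (auto simp: div_hull_def)
  let ?c = "vec 1 (\<lambda>_. k)"
  have "{x :: 'g vec \<in> carrier_vec 1. x $ 0 = a} = {x \<in> carrier_vec 1. lin ?c x = zmul k a}"
    using k(1) by (auto simp: lin_one zmul_cancel simp del: One_nat_def)
  then show "{x \<in> carrier_vec 1. x $ 0 = a} \<in> definable A 1"
    using definable_eq[of ?c 1 "zmul k a" A] k(2) by simp
  have "{x :: 'g vec \<in> carrier_vec 1. x $ 0 \<le> a} = {x \<in> carrier_vec 1. lin ?c x \<le> zmul k a}"
    using k(1) by (auto simp: lin_one zmul_le_iff simp del: One_nat_def)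
  then show "{x \<in> carrier_vec 1. x $ 0 \<le> a} \<in> definable A 1"
    using definable_le[of ?c 1 "zmul k a" A] k(2) by simp
  have "{x :: 'g vec \<in> carrier_vec 1. x $ 0 < a} = {x \<in> carrier_vec 1. lin ?c x < zmul k a}"
    using k(1) by (auto simp: lin_one zmul_less_iff simp del: One_nat_def)
  then show "{x \<in> carrier_vec 1. x $ 0 < a} \<in> definable A 1"
    using definable_less[of ?c 1 "zmul k a" A] k(2) by simp
qed

lemma point_obj:
  fixes A :: "'g::doag set"
  assumes "a \<in> div_hull A"
  shows "{x \<in> carrier_vec 1. x $ 0 = a} \<in> bdd_obj A 1"
proof -
  have "- max a (- a) \<le> a" using minus_le_iff[of "max a (- a)" a] by simp
  moreover have "a \<le> max a (- a)" by simp
  ultimately have "\<exists>\<gamma>. \<forall>x\<in>{x :: 'g vec \<in> carrier_vec 1. x $ 0 = a}. \<forall>i<1. - \<gamma> \<le> x $ i \<and> x $ i \<le> \<gamma>"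
    by (intro exI[of _ "max a (- a)"]) simp
  then show ?thesis using definable_coordinate(1)[OF assms] unfolding bdd_obj_def by blast
qed

lemma interval_obj:
  fixes A :: "'g::doag set"
  assumes "add_subgroup A" "a \<in> div_hull A"
  shows "{x \<in> carrier_vec 1. 0 \<le> x $ 0 \<and> x $ 0 < a} \<in> bdd_obj A 1"
    and "{x \<in> carrier_vec 1. 0 < x $ 0 \<and> x $ 0 < a} \<in> bdd_obj A 1"
proof -
  note 0 = div_hull_subspace(1)[OF assms(1)]
  have "{x \<in> carrier_vec 1. 0 \<le> x $ 0 \<and> x $ 0 < a} =
      (carrier_vec 1 - {x \<in> carrier_vec 1. x $ 0 < 0}) \<inter> {x \<in> carrier_vec 1. x $ 0 < a}" by auto
  then have 1: "{x \<in> carrier_vec 1. 0 \<le> x $ 0 \<and> x $ 0 < a} \<in> definable A 1"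
    using definable_coordinate(3)[OF 0] definable_coordinate(3)[OF assms(2)]
    by (simp only: definable.intros)
  have "{x \<in> carrier_vec 1. 0 < x $ 0 \<and> x $ 0 < a} =
      (carrier_vec 1 - {x \<in> carrier_vec 1. x $ 0 \<le> 0}) \<inter> {x \<in> carrier_vec 1. x $ 0 < a}" by auto
  then have 2: "{x \<in> carrier_vec 1. 0 < x $ 0 \<and> x $ 0 < a} \<in> definable A 1"
    using definable_coordinate(2)[OF 0] definable_coordinate(3)[OF assms(2)]
    by (simp only: definable.intros)
  have "\<forall>x\<in>{x :: 'g vec \<in> carrier_vec 1. 0 \<le> x $ 0 \<and> x $ 0 < a}. \<forall>i<1. - a \<le> x $ i \<and> x $ i \<le> a"
    by (auto intro: order.trans[of _ 0])
  then show "{x \<in> carrier_vec 1. 0 \<le> x $ 0 \<and> x $ 0 < a} \<in> bdd_obj A 1"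
    using 1 unfolding bdd_obj_def by blast
  then show "{x \<in> carrier_vec 1. 0 < x $ 0 \<and> x $ 0 < a} \<in> bdd_obj A 1"
    using 2 by (rule bdd_obj_subset) auto
qed

section \<open>The degree 0 part of the localization and the values of sets\<close>

context subgroup_base
begin

lemma zero_vec_obj: "{x \<in> carrier_vec 1. x $ 0 = 0} = {0\<^sub>v 1 :: 'g vec}"
  "{0\<^sub>v 1} \<in> bdd_obj A 1"
proof -
  show *: "{x \<in> carrier_vec 1. x $ 0 = 0} = {0\<^sub>v 1 :: 'g vec}" by (auto intro!: eq_vecI)
  show "{0\<^sub>v 1} \<in> bdd_obj A 1"
    using point_obj[OF div_hull_subspace(1)[OF A]] unfolding * .
qed

lemma zero_class_degree: "zero_class A \<in> K_plus_degree A 1"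
  unfolding zero_class_def by (intro K_plus_degree_class zero_vec_obj)

lemma one_degree: "\<one>\<^bsub>Kp\<^esub> \<in> K_plus_degree A 0"
  using K_plus_degree_class[OF bdd_obj_0[OF A]] by (simp add: K_class_unit)

sublocale E: semiring_with_element "K_plus A" "zero_class A"
  by unfold_locales (rule K_plus_degree_closed[OF zero_class_degree])

lemma zero_class_pow_degree: "zero_class A [^]\<^bsub>Kp\<^esub> (n :: nat) \<in> K_plus_degree A n"
proof (induction n)
  case (Suc n)
  then show ?case using K_plus_degree_mult[OF Suc zero_class_degree] by simp
qed (simp add: one_degree)

lemma K_plus_df_simps:
  "carrier (K_plus_df A) = {frac Kp (zero_class A) x n | x n. x \<in> K_plus_degree A n}"
  "x \<oplus>\<^bsub>K_plus_df A\<^esub> y = x \<oplus>\<^bsub>localization Kp (zero_class A)\<^esub> y"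
  "x \<otimes>\<^bsub>K_plus_df A\<^esub> y = x \<otimes>\<^bsub>localization Kp (zero_class A)\<^esub> y"
  "\<zero>\<^bsub>K_plus_df A\<^esub> = \<zero>\<^bsub>localization Kp (zero_class A)\<^esub>"
  "\<one>\<^bsub>K_plus_df A\<^esub> = \<one>\<^bsub>localization Kp (zero_class A)\<^esub>"
  by (simp_all add: K_plus_df_def)

lemma K_plus_df_frac: "x \<in> K_plus_degree A n \<Longrightarrow> frac Kp (zero_class A) x n \<in> carrier (K_plus_df A)"
  unfolding K_plus_df_simps by blast

sublocale df: commutative_semiring "K_plus_df A"
proof -
  interpret L: commutative_semiring "localization Kp (zero_class A)"
    by (rule E.localization_commutative_semiring)
  show "commutative_semiring (K_plus_df A)"
    unfolding K_plus_df_def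
  proof (rule L.restrict_carrier)
    show "{frac Kp (zero_class A) x n | x n. x \<in> K_plus_degree A n} \<subseteq> carrier (localization Kp (zero_class A))"
      using E.frac_closed K_plus_degree_closed by blast
    show "\<zero>\<^bsub>localization Kp (zero_class A)\<^esub> \<in> {frac Kp (zero_class A) x n | x n. x \<in> K_plus_degree A n}"
      unfolding E.localization_zero using K_plus_degree_zero by blast
    show "\<one>\<^bsub>localization Kp (zero_class A)\<^esub> \<in> {frac Kp (zero_class A) x n | x n. x \<in> K_plus_degree A n}"
      unfolding E.localization_one using one_degree by blast
    fix u v assume "u \<in> {frac Kp (zero_class A) x n | x n. x \<in> K_plus_degree A n}"
      "v \<in> {frac Kp (zero_class A) x n | x n. x \<in> K_plus_degree A n}"
    then obtain x n y k where u: "u = frac Kp (zero_class A) x n" "x \<in> K_plus_degree A n"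
      and v: "v = frac Kp (zero_class A) y k" "y \<in> K_plus_degree A k" by blast
    note c = K_plus_degree_closed[OF u(2)] K_plus_degree_closed[OF v(2)]
    \<comment> \<open>Cross-multiplication by powers of an element of degree 1 brings both
      numerators to degree n + k, in step with the common denominator.\<close>
    have "x \<otimes>\<^bsub>Kp\<^esub> zero_class A [^]\<^bsub>Kp\<^esub> k \<oplus>\<^bsub>Kp\<^esub> y \<otimes>\<^bsub>Kp\<^esub> zero_class A [^]\<^bsub>Kp\<^esub> n \<in> K_plus_degree A (n + k)"
      using K_plus_degree_mult[OF u(2) zero_class_pow_degree[of k]]
        K_plus_degree_mult[OF v(2) zero_class_pow_degree[of n]]
      by (intro K_plus_degree_add) (simp_all add: add.commute)
    then show "u \<oplus>\<^bsub>localization Kp (zero_class A)\<^esub> v \<in> {frac Kp (zero_class A) x n | x n. x \<in> K_plus_degree A n}"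
      unfolding u(1) v(1) E.frac_add[OF c] by blast
    show "u \<otimes>\<^bsub>localization Kp (zero_class A)\<^esub> v \<in> {frac Kp (zero_class A) x n | x n. x \<in> K_plus_degree A n}"
      unfolding u(1) v(1) E.frac_mult[OF c] using K_plus_degree_mult[OF u(2) v(2)] by blast
  qed
qed

sublocale R: cring "K_df A"
  by (rule df.groth_ring_cring)

sublocale T: ring "K_df_rat A"
  by (rule R.rat_tensor_ring)

definition df_frac where
  "df_frac n x = pure_tensor (K_df A) 1 (groth_of (K_plus_df A) (frac Kp (zero_class A) x n))"

lemma groth_frac_closed:
  "x \<in> K_plus_degree A n \<Longrightarrow> groth_of (K_plus_df A) (frac Kp (zero_class A) x n) \<in> carrier (K_df A)"
  by (intro df.groth_of_closed K_plus_df_frac)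

lemma df_frac_closed: "x \<in> K_plus_degree A n \<Longrightarrow> df_frac n x \<in> carrier (K_df_rat A)"
  unfolding df_frac_def by (intro R.pure_tensor_closed groth_frac_closed)

lemma df_frac_add:
  assumes "x \<in> K_plus_degree A n" "y \<in> K_plus_degree A n"
  shows "df_frac n (x \<oplus>\<^bsub>Kp\<^esub> y) = df_frac n x \<oplus>\<^bsub>K_df_rat A\<^esub> df_frac n y"
proof -
  have "frac Kp (zero_class A) (x \<oplus>\<^bsub>Kp\<^esub> y) n =
      frac Kp (zero_class A) x n \<oplus>\<^bsub>K_plus_df A\<^esub> frac Kp (zero_class A) y n"
    using assms[THEN K_plus_degree_closed] by (simp add: K_plus_df_simps E.frac_add_same)
  then show ?thesis
    unfolding df_frac_def
    by (simp add: df.groth_of_add R.pure_tensor_add_right groth_frac_closed K_plus_df_frac assms)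
qed

lemma df_frac_mult:
  assumes "x \<in> K_plus_degree A n" "y \<in> K_plus_degree A k"
  shows "df_frac (n + k) (x \<otimes>\<^bsub>Kp\<^esub> y) = df_frac n x \<otimes>\<^bsub>K_df_rat A\<^esub> df_frac k y"
proof -
  have "frac Kp (zero_class A) (x \<otimes>\<^bsub>Kp\<^esub> y) (n + k) =
      frac Kp (zero_class A) x n \<otimes>\<^bsub>K_plus_df A\<^esub> frac Kp (zero_class A) y k"
    using assms[THEN K_plus_degree_closed] by (simp add: K_plus_df_simps E.frac_mult)
  then show ?thesis
    unfolding df_frac_def
    by (simp add: df.groth_of_mult R.pure_tensor_mult groth_frac_closed K_plus_df_frac assms)
qed

lemma df_frac_zero: "df_frac n \<zero>\<^bsub>Kp\<^esub> = \<zero>\<^bsub>K_df_rat A\<^esub>"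
proof -
  have "frac Kp (zero_class A) \<zero>\<^bsub>Kp\<^esub> n = \<zero>\<^bsub>K_plus_df A\<^esub>"
    unfolding K_plus_df_simps E.localization_zero by (rule E.frac_eqI) simp_all
  then show ?thesis by (simp add: df_frac_def df.groth_of_zero R.pure_tensor_zero)
qed

lemma df_frac_one: "df_frac 0 \<one>\<^bsub>Kp\<^esub> = \<one>\<^bsub>K_df_rat A\<^esub>"
  using df.groth_of_one by (simp add: df_frac_def K_plus_df_simps E.localization_one R.pure_tensor_one)

lemma df_frac_zero_class: "df_frac 1 (zero_class A) = \<one>\<^bsub>K_df_rat A\<^esub>"
proof -
  have "frac Kp (zero_class A) (zero_class A) 1 = frac Kp (zero_class A) \<one>\<^bsub>Kp\<^esub> 0"
    by (rule E.frac_eqI) simp_all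
  then show ?thesis using df_frac_one by (simp add: df_frac_def)
qed

text \<open>The class of [X]_n / [0]_1^n in the rational ring. Since the point 0 receives the value
  1, values in different dimensions can be compared.\<close>

definition val where
  "val n X = df_frac n (K_class A n X)"

lemma val_closed: "X \<in> bdd_obj A n \<Longrightarrow> val n X \<in> carrier (K_df_rat A)"
  unfolding val_def by (intro df_frac_closed K_plus_degree_class)

lemma val_Un:
  assumes "X \<in> bdd_obj A n" "Y \<in> bdd_obj A n" "X \<union> Y \<in> bdd_obj A n" "X \<inter> Y = {}"
  shows "val n (X \<union> Y) = val n X \<oplus>\<^bsub>K_df_rat A\<^esub> val n Y"
  using assms unfolding val_def by (simp add: K_class_Un df_frac_add K_plus_degree_class)

lemma val_prod:
  assumes "X \<in> bdd_obj A n" "Y \<in> bdd_obj A k"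
  shows "val (n + k) (vec_prod X Y) = val n X \<otimes>\<^bsub>K_df_rat A\<^esub> val k Y"
  unfolding val_def K_class_mult[OF assms, symmetric] by (intro df_frac_mult K_plus_degree_class assms)

lemma val_empty: "val n {} = \<zero>\<^bsub>K_df_rat A\<^esub>"
  by (simp add: val_def K_class_empty df_frac_zero)

lemma val_unit: "val 0 (carrier_vec 0) = \<one>\<^bsub>K_df_rat A\<^esub>"
  by (simp add: val_def K_class_unit df_frac_one)

lemma val_zero: "val 1 {0\<^sub>v 1} = \<one>\<^bsub>K_df_rat A\<^esub>"
  using df_frac_zero_class by (simp add: val_def zero_class_def)

lemma val_iso: "X \<in> bdd_obj A n \<Longrightarrow> Y \<in> bdd_obj A n \<Longrightarrow> Gamma_iso A n X Y \<Longrightarrow> val n Y = val n X"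
  unfolding val_def by (simp add: K_class_iso[of Y n X])

lemma df_class_closed: "X \<in> bdd_obj A 1 \<Longrightarrow> df_class A X \<in> carrier (K_df A)"
  unfolding df_class_def by (intro groth_frac_closed K_plus_degree_class)

lemma val_df_class: "val 1 X = pure_tensor (K_df A) 1 (df_class A X)"
  by (simp add: val_def df_frac_def df_class_def)

lemma e_rat_val: "e_rat A a = val 1 {x \<in> carrier_vec 1. x $ 0 = a}"
  by (simp add: e_rat_def e_df_def val_df_class del: One_nat_def)

lemma iota_rat_val: "a > 0 \<Longrightarrow> iota_rat A a = val 1 {x \<in> carrier_vec 1. 0 \<le> x $ 0 \<and> x $ 0 < a}"
  by (simp add: iota_rat_def iota_df_def val_df_class del: One_nat_def)

lemma e_rat_closed: "a \<in> div_hull A \<Longrightarrow> e_rat A a \<in> carrier (K_df_rat A)"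
  unfolding e_rat_val by (intro val_closed point_obj)

lemma iota_rat_closed:
  assumes "a \<in> div_hull A"
  shows "iota_rat A a \<in> carrier (K_df_rat A)"
proof -
  have "- a \<in> div_hull A"
    using div_hull_subspace(3)[OF A assms, of "- 1"] by simp
  then show ?thesis
    unfolding iota_rat_def iota_df_def
    using interval_obj(1)[OF A assms] interval_obj(1)[OF A, of "- a"]
    by (intro R.pure_tensor_closed) (simp add: df_class_closed)
qed

text \<open>The half-open interval is the open one together with the point 0, whose value is
  1.\<close>

lemma open_interval_val:
  assumes a: "a \<in> div_hull A" "0 < a"
  shows "val 1 {x \<in> carrier_vec 1. 0 < x $ 0 \<and> x $ 0 < a} = iota_rat A a \<ominus>\<^bsub>K_df_rat A\<^esub> \<one>\<^bsub>K_df_rat A\<^esub>"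
proof -
  let ?I = "{x \<in> carrier_vec 1. 0 < x $ 0 \<and> x $ 0 < a}"
  have "{x \<in> carrier_vec 1. 0 \<le> x $ 0 \<and> x $ 0 < a} = ?I \<union> {x \<in> carrier_vec 1. x $ 0 = 0}"
    using a(2) by auto
  then have eq: "?I \<union> {0\<^sub>v 1} = {x \<in> carrier_vec 1. 0 \<le> x $ 0 \<and> x $ 0 < a}"
    by (simp only: zero_vec_obj(1))
  have "val 1 (?I \<union> {0\<^sub>v 1}) = val 1 ?I \<oplus>\<^bsub>K_df_rat A\<^esub> val 1 {0\<^sub>v 1}"
    using interval_obj[OF A a(1)] zero_vec_obj(2)
    by (intro val_Un) (simp_all only: eq, auto)
  then have "iota_rat A a = val 1 ?I \<oplus>\<^bsub>K_df_rat A\<^esub> \<one>\<^bsub>K_df_rat A\<^esub>"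
    unfolding eq val_zero iota_rat_val[OF a(2)] .
  then show ?thesis
    using val_closed[OF interval_obj(2)[OF A a(1)]] by (simp add: T.minus_eq T.a_assoc T.r_neg)
qed

lemma pure_tensor_scalar:
  assumes "x \<in> carrier (K_df A)"
  shows "pure_tensor (K_df A) q x = pure_tensor (K_df A) q \<one>\<^bsub>K_df A\<^esub> \<otimes>\<^bsub>K_df_rat A\<^esub> pure_tensor (K_df A) 1 x"
  using R.pure_tensor_mult[OF R.one_closed assms, of q 1] assms by simp

text \<open>An element is a sum of rational multiples of differences of fractions, and a numerator
  is a sum of classes of sets. None of these layers leads out of a subalgebra.\<close>

lemma generated_by_values:
  assumes V: "subring V (K_df_rat A)" "subalgebra (rat_scalars (K_df A)) V (K_df_rat A)"
    and val: "\<And>n X. X \<in> bdd_obj A n \<Longrightarrow> val n X \<in> V"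
  shows "carrier (K_df_rat A) \<subseteq> V"
proof
  note V0 = subringE(2)[OF V(1)] and Vadd = subringE(7)[OF V(1)] and Vneg = subringE(5)[OF V(1)]
  have smult: "pure_tensor (K_df A) q \<one>\<^bsub>K_df A\<^esub> \<otimes>\<^bsub>K_df_rat A\<^esub> v \<in> V" if "v \<in> V" for q v
    using subalgebra.smult_closed[OF V(2) _ that] by (simp add: rat_scalars_def)
  have frac: "df_frac n x \<in> V" if "x \<in> K_plus_degree A n" for n x
    using that
  proof (induction rule: K_plus_degree_induct)
    case zero
    then show ?case using V0 by (simp add: df_frac_zero)
  next
    case (add X x)
    then show ?case
      using Vadd[OF val[OF add(1)] add(3)] by (simp add: df_frac_add K_plus_degree_class val_def)
  qed
  fix z assume "z \<in> carrier (K_df_rat A)"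
  then show "z \<in> V"
  proof (induction rule: R.rat_tensor_induct)
    case zero
    then show ?case by (rule V0)
  next
    case (add q x z)
    obtain u v where uv: "u \<in> carrier (K_plus_df A)" "v \<in> carrier (K_plus_df A)"
        "x = groth_of (K_plus_df A) u \<ominus>\<^bsub>K_df A\<^esub> groth_of (K_plus_df A) v"
      using df.groth_ring_elem[OF add(1)] .
    have "pure_tensor (K_df A) 1 (groth_of (K_plus_df A) w) \<in> V" if "w \<in> carrier (K_plus_df A)" for w
      using that frac unfolding K_plus_df_simps(1) df_frac_def by blast
    then have "pure_tensor (K_df A) 1 (groth_of (K_plus_df A) u) \<oplus>\<^bsub>K_df_rat A\<^esub>
        \<ominus>\<^bsub>K_df_rat A\<^esub> pure_tensor (K_df A) 1 (groth_of (K_plus_df A) v) \<in> V"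
      using uv(1,2) by (intro Vadd Vneg)
    then have "pure_tensor (K_df A) 1 x \<in> V"
      using df.groth_of_closed[OF uv(1)] df.groth_of_closed[OF uv(2)]
      by (simp add: uv(3) R.minus_eq R.pure_tensor_add_right R.pure_tensor_uminus)
    then have "pure_tensor (K_df A) q x \<in> V"
      unfolding pure_tensor_scalar[OF add(1), of q] by (rule smult)
    then show ?case using add(3) by (rule Vadd)
  qed
qed

end

section \<open>Translation to definable sets of functions\<close>

definition fvec :: "nat \<Rightarrow> 'g::zero vec \<Rightarrow> nat \<Rightarrow> 'g" where
  "fvec n v = (\<lambda>i. if i < n then v $ i else 0)"

lemma fvec_coords: "fvec n v \<in> coords n"
  by (simp add: fvec_def coords_def)

lemma vec_fvec: "v \<in> carrier_vec n \<Longrightarrow> vec n (fvec n v) = v"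
  by (intro eq_vecI) (auto simp: fvec_def)

lemma fvec_vec: "x \<in> coords n \<Longrightarrow> fvec n (vec n x) = x"
  by (auto simp: fvec_def coords_def fun_eq_iff)

lemma vec_inj: "inj_on (vec n) (coords n)"
  by (rule inj_on_inverseI[of _ "fvec n"]) (rule fvec_vec)

lemma vec_image: "vec n ` coords n = (carrier_vec n :: 'g::zero vec set)"
proof (intro equalityI subsetI)
  fix v :: "'g vec" assume "v \<in> carrier_vec n"
  then show "v \<in> vec n ` coords n" using vec_fvec[of v n] fvec_coords[of n v] by (metis imageI)
qed auto

lemma vec_image_Collect: "vec n ` {x \<in> coords n. P (vec n x)} = {v \<in> carrier_vec n. P v}"
  unfolding vec_image[symmetric] by blast

lemma coords_Suc: "x \<in> coords (Suc k) \<Longrightarrow> x(k := 0) \<in> coords k"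
  by (auto simp: coords_def)

lemma vec_snoc: "vec (Suc k) x = vec k x @\<^sub>v vec 1 (\<lambda>_. x k)"
  by (intro eq_vecI) (auto simp: less_Suc_eq)

text \<open>Splits off the last coordinate as a factor; setting it to 0 is the projection to the
  first \<open>k\<close> coordinates in the encoding by functions.\<close>

lemma vec_image_Suc:
  fixes Y :: "(nat \<Rightarrow> 'g::zero) set"
  assumes Y: "Y \<subseteq> coords k"
  shows "vec (Suc k) ` {x \<in> coords (Suc k). x(k := 0) \<in> Y \<and> Q (x k)} =
    vec_prod (vec k ` Y) {x \<in> carrier_vec 1. Q (x $ 0)}"
proof (intro equalityI subsetI)
  fix v assume "v \<in> vec (Suc k) ` {x \<in> coords (Suc k). x(k := 0) \<in> Y \<and> Q (x k)}"
  then obtain x where x: "v = vec (Suc k) x" "x(k := 0) \<in> Y" "Q (x k)" by blast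
  have "vec k x = vec k (x(k := 0))" by (intro eq_vecI) auto
  then have "v = vec k (x(k := 0)) @\<^sub>v vec 1 (\<lambda>_. x k)" unfolding x(1) vec_snoc by simp
  moreover have "vec 1 (\<lambda>_. x k) \<in> {x \<in> carrier_vec 1. Q (x $ 0)}" using x(3) by simp
  ultimately show "v \<in> vec_prod (vec k ` Y) {x \<in> carrier_vec 1. Q (x $ 0)}" using x(2) by blast
next
  fix v assume "v \<in> vec_prod (vec k ` Y) {x \<in> carrier_vec 1. Q (x $ 0)}"
  then obtain y z where yz: "v = vec k y @\<^sub>v z" "y \<in> Y" "z \<in> carrier_vec 1" "Q (z $ 0)" by blast
  let ?x = "y(k := z $ 0)"
  have "y k = 0" "y \<in> coords k" using yz(2) Y by (auto simp: coords_def)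
  then have "?x \<in> {x \<in> coords (Suc k). x(k := 0) \<in> Y \<and> Q (x k)}"
    using yz by (auto simp: coords_def fun_upd_idem)
  moreover have "v = vec (Suc k) ?x"
    unfolding yz(1) vec_snoc using yz(3) by (intro eq_vecI) auto
  ultimately show "v \<in> vec (Suc k) ` {x \<in> coords (Suc k). x(k := 0) \<in> Y \<and> Q (x k)}" by blast
qed

lemma lin_vec: "lin c (vec n x) = (\<Sum>j<n. zmul (c $ j) (x j))"
  by (simp add: lin_def)

lemma int_linear_matrix:
  assumes "\<And>i. i < n \<Longrightarrow> int_linear n (\<lambda>x. T x i)"
  obtains M where "M \<in> carrier_mat n n" "\<And>x. lin_map M (vec n x) = vec n (T x)"
proof -
  have "\<forall>i. \<exists>c. i < n \<longrightarrow> (\<forall>x. T x i = (\<Sum>j<n. zmul (c j) (x j)))"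
    using assms unfolding int_linear_def by metis
  then obtain c where c: "\<And>i x. i < n \<Longrightarrow> T x i = (\<Sum>j<n. zmul (c i j) (x j))" by metis
  let ?M = "mat n n (\<lambda>(i, j). c i j)"
  have "lin_map ?M (vec n x) = vec n (T x)" for x
    by (rule eq_vecI) (simp_all add: lin_map_def lin_vec c)
  then show thesis using that[of ?M] by simp
qed

lemma unimodular_iso:
  fixes X :: "(nat \<Rightarrow> 'g::doag) set"
  assumes A: "add_subgroup A" and U: "unimodular n T T'" and X: "X \<subseteq> coords n" "vec n ` X \<in> definable A n"
  shows "Gamma_iso A n (vec n ` X) (vec n ` T ` X)"
proof -
  obtain M where M: "M \<in> carrier_mat n n" "\<And>x. lin_map M (vec n x) = vec n (T x)"
    using U int_linear_matrix[of n T] unfolding unimodular_def by blast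
  obtain M' where M': "M' \<in> carrier_mat n n" "\<And>x. lin_map M' (vec n x) = vec n (T' x)"
    using U int_linear_matrix[of n T'] unfolding unimodular_def by blast
  have inv: "lin_map M (lin_map M' v) = v" "lin_map M' (lin_map M v) = v" if v: "v \<in> carrier_vec n" for v :: "'g vec"
  proof -
    obtain x where "x \<in> coords n" "v = vec n x" using v unfolding vec_image[symmetric] by blast
    then show "lin_map M (lin_map M' v) = v" "lin_map M' (lin_map M v) = v"
      using U by (simp_all add: M(2) M'(2) unimodular_def)
  qed
  have "lin_map M ` vec n ` X = vec n ` T ` X" by (simp add: image_image M(2))
  then show ?thesis using Gamma_iso_linear[OF A X(2) M(1) M'(1) inv] by simp
qed

section \<open>Values of definable sets of functions\<close>

context subgroup_base
begin

sublocale D: rational_subspace "div_hull A"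
  by unfold_locales (rule div_hull_subspace[OF A]; assumption)+

lemma div_hull_superset: "a \<in> A \<Longrightarrow> a \<in> div_hull A"
  by (auto simp: div_hull_def intro!: exI[of _ 1])

lemma dset_definable: "X \<in> D.dset n \<Longrightarrow> vec n ` X \<in> definable A n"
proof (induction rule: D.dset.induct)
  case (pos f)
  from D.affine_denominator[OF pos] obtain N k d where N: "N > 0" "d \<in> div_hull A"
    "\<And>x. zmul N (f x) = (\<Sum>i<n. zmul (k i) (x i)) + d" by blast
  obtain l where l: "0 < l" "zmul l d \<in> A" using N(2) by (auto simp: div_hull_def)
  \<comment> \<open>\<open>N\<close> clears the denominators of the slopes and \<open>l\<close>
    brings the constant into \<open>A\<close>. The linear part changes sides, hence the minus
    sign.\<close>
  let ?c = "vec n (\<lambda>i. - (l * k i))"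
  have "0 < f x \<longleftrightarrow> lin ?c (vec n x) < zmul l d" for x
  proof -
    have "zmul (l * N) (f x) = zmul l ((\<Sum>i<n. zmul (k i) (x i)) + d)"
      by (simp add: N(3)[symmetric])
    also have "\<dots> = zmul l d - lin ?c (vec n x)"
      by (simp add: lin_vec zmul.scale_right_distrib zmul.scale_sum_right zmul.scale_minus_left sum_negf)
    finally have "lin ?c (vec n x) < zmul l d \<longleftrightarrow> zmul (l * N) 0 < zmul (l * N) (f x)" by simp
    also have "\<dots> \<longleftrightarrow> 0 < f x" using l(1) N(1) by (intro zmul_less_iff) simp
    finally show ?thesis by simp
  qed
  then have "vec n ` {x \<in> coords n. 0 < f x} = {v \<in> carrier_vec n. lin ?c v < zmul l d}"
    using vec_image_Collect[of n "\<lambda>v. lin ?c v < zmul l d"] by simp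
  then show ?case using definable_less[of ?c n "zmul l d" A] l(2) by simp
next
  case (compl X)
  have "vec n ` (coords n - X) = carrier_vec n - vec n ` X"
    using inj_on_image_set_diff[OF vec_inj, of "coords n" X] D.dset_coords[OF compl.hyps]
    by (simp add: vec_image)
  then show ?case using definable_Compl[OF compl.IH] by simp
next
  case (Un X Y)
  then show ?case by (simp add: image_Un definable_Un)
qed

lemma definable_dset: "X \<in> definable A n \<Longrightarrow> {x \<in> coords n. vec n x \<in> X} \<in> D.dset n"
proof (induction rule: definable.induct)
  case (definable_eq c a)
  have f: "D.affine n (\<lambda>x. lin c (vec n x) - a)"
    unfolding lin_vec using div_hull_superset[OF definable_eq(2)]
    by (intro D.affine_diff D.affine_sum D.affine_zmul D.affine_coord D.affine_const) auto
  then show ?case using D.dset_zero[OF f] by simp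
next
  case (definable_less c a)
  have f: "D.affine n (\<lambda>x. a - lin c (vec n x))"
    unfolding lin_vec using div_hull_superset[OF definable_less(2)]
    by (intro D.affine_diff D.affine_sum D.affine_zmul D.affine_coord D.affine_const) auto
  then show ?case using D.dset.pos[OF f] by simp
next
  case (definable_le c a)
  have f: "D.affine n (\<lambda>x. lin c (vec n x) - a)"
    unfolding lin_vec using div_hull_superset[OF definable_le(2)]
    by (intro D.affine_diff D.affine_sum D.affine_zmul D.affine_coord D.affine_const) auto
  have "{x \<in> coords n. vec n x \<in> {v \<in> carrier_vec n. lin c v \<le> a}} =
      coords n - {x \<in> coords n. 0 < lin c (vec n x) - a}" by auto
  then show ?case using D.dset.compl[OF D.dset.pos[OF f]] by simp
next
  case (definable_Compl X)
  have "{x \<in> coords n. vec n x \<in> carrier_vec n - X} = coords n - {x \<in> coords n. vec n x \<in> X}" by auto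
  then show ?case using D.dset.compl[OF definable_Compl.IH] by simp
next
  case (definable_Un X Y)
  have "{x \<in> coords n. vec n x \<in> X \<union> Y} = {x \<in> coords n. vec n x \<in> X} \<union> {x \<in> coords n. vec n x \<in> Y}" by auto
  then show ?case using D.dset.Un[OF definable_Un.IH] by simp
next
  case (definable_Int X Y)
  have "{x \<in> coords n. vec n x \<in> X \<inter> Y} = {x \<in> coords n. vec n x \<in> X} \<inter> {x \<in> coords n. vec n x \<in> Y}" by auto
  then show ?case using D.dset_Int[OF definable_Int.IH] by simp
qed

lemma bd_obj: "D.bd n X \<Longrightarrow> vec n ` X \<in> bdd_obj A n"
  unfolding D.bd_def bdd_obj_def using dset_definable by auto

lemma obj_bd:
  assumes "X \<in> bdd_obj A n"
  obtains Y where "D.bd n Y" "vec n ` Y = X"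
proof -
  let ?Y = "{x \<in> coords n. vec n x \<in> X}"
  obtain \<gamma> where \<gamma>: "\<forall>x\<in>X. \<forall>i<n. - \<gamma> \<le> x $ i \<and> x $ i \<le> \<gamma>" using assms by (auto simp: bdd_obj_def)
  have "- \<gamma> \<le> x i \<and> x i \<le> \<gamma>" if "x \<in> ?Y" "i < n" for x i
    using bspec[OF \<gamma>, of "vec n x"] that by simp
  then have "D.bd n ?Y"
    unfolding D.bd_def using definable_dset[OF bdd_objD(1)[OF assms]] by blast
  moreover have "vec n ` ?Y = X"
    using vec_image_Collect[of n "\<lambda>v. v \<in> X"] bdd_objD(2)[OF assms] by blast
  ultimately show thesis by (rule that)
qed

lemma bd_coords: "D.bd n X \<Longrightarrow> X \<subseteq> coords n"
  by (intro D.dset_coords D.bd_dset)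

abbreviation "fval n X \<equiv> val n (vec n ` X)"

lemma fval_closed: "D.bd n X \<Longrightarrow> fval n X \<in> carrier (K_df_rat A)"
  by (intro val_closed bd_obj)

lemma fval_Un:
  assumes "D.bd n X" "D.bd n Y" "X \<inter> Y = {}"
  shows "fval n (X \<union> Y) = fval n X \<oplus>\<^bsub>K_df_rat A\<^esub> fval n Y"
proof -
  have "vec n ` X \<inter> vec n ` Y = {}"
    using inj_on_image_Int[OF vec_inj bd_coords[OF assms(1)] bd_coords[OF assms(2)]] assms(3) by simp
  then show ?thesis
    unfolding image_Un using bd_obj[OF D.bd_Un[OF assms(1,2)]]
    by (intro val_Un bd_obj assms) (simp_all add: image_Un)
qed

lemma fval_unimodular:
  assumes "unimodular n T T'" "D.bd n X"
  shows "fval n (T ` X) = fval n X"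
  by (intro val_iso bd_obj D.bd_image[OF assms] assms(2) unimodular_iso[OF A assms(1)]
      bd_coords dset_definable D.bd_dset)

text \<open>Every unimodular copy has the value of \<open>Z\<close>, and by disjointness the values
  add up. Division by this scalar is the algebraic content of \<open>G_divide\<close>.\<close>

lemma fval_copies:
  assumes Z: "D.bd n Z" and "finite (J :: nat set)" and U: "\<And>j. j \<in> J \<Longrightarrow> unimodular n (U j) (U' j)"
    and "disjoint_family_on (\<lambda>j. U j ` Z) J"
  shows "fval n (\<Union>j\<in>J. U j ` Z) =
    pure_tensor (K_df A) (of_nat (card J)) \<one>\<^bsub>K_df A\<^esub> \<otimes>\<^bsub>K_df_rat A\<^esub> fval n Z"
  using assms(2-4)
proof (induction J rule: finite_induct)
  case empty
  then show ?case using fval_closed[OF Z] by (simp add: val_empty R.pure_tensor_zero)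
next
  case (insert j J)
  have IH: "fval n (\<Union>j\<in>J. U j ` Z) =
      pure_tensor (K_df A) (of_nat (card J)) \<one>\<^bsub>K_df A\<^esub> \<otimes>\<^bsub>K_df_rat A\<^esub> fval n Z"
    using insert.prems by (intro insert.IH) (auto simp: disjoint_family_on_def)
  have bd: "D.bd n (U i ` Z)" if "i \<in> insert j J" for i
    by (rule D.bd_image[OF insert.prems(1)[OF that] Z])
  have "U j ` Z \<inter> (\<Union>i\<in>J. U i ` Z) = {}"
  proof -
    have "U j ` Z \<inter> U i ` Z = {}" if "i \<in> J" for i
      using insert.prems(2) insert.hyps(2) that unfolding disjoint_family_on_def by (metis insertCI)
    then show ?thesis by blast
  qed
  then have "fval n (\<Union>i\<in>insert j J. U i ` Z) =
      fval n (U j ` Z) \<oplus>\<^bsub>K_df_rat A\<^esub> fval n (\<Union>i\<in>J. U i ` Z)"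
    unfolding UN_insert using bd insert.hyps(1) by (intro fval_Un D.bd_UN) simp_all
  also have "\<dots> = pure_tensor (K_df A) 1 \<one>\<^bsub>K_df A\<^esub> \<otimes>\<^bsub>K_df_rat A\<^esub> fval n Z \<oplus>\<^bsub>K_df_rat A\<^esub>
      pure_tensor (K_df A) (of_nat (card J)) \<one>\<^bsub>K_df A\<^esub> \<otimes>\<^bsub>K_df_rat A\<^esub> fval n Z"
    using fval_unimodular[OF insert.prems(1) Z, of j] fval_closed[OF Z] by (simp add: IH R.pure_tensor_one)
  also have "\<dots> = pure_tensor (K_df A) (of_nat (card (insert j J))) \<one>\<^bsub>K_df A\<^esub> \<otimes>\<^bsub>K_df_rat A\<^esub> fval n Z"
    using insert.hyps fval_closed[OF Z]
    by (simp add: R.pure_tensor_add_left R.pure_tensor_closed T.l_distr)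
  finally show ?case .
qed

lemma fval_prod:
  assumes "D.bd k Y" "{x \<in> carrier_vec 1. Q (x $ 0)} \<in> bdd_obj A 1"
  shows "fval (Suc k) {x \<in> coords (Suc k). x(k := 0) \<in> Y \<and> Q (x k)} =
    fval k Y \<otimes>\<^bsub>K_df_rat A\<^esub> val 1 {x \<in> carrier_vec 1. Q (x $ 0)}"
  unfolding vec_image_Suc[OF bd_coords[OF assms(1)]]
  using val_prod[OF bd_obj[OF assms(1)] assms(2)] by simp

text \<open>Up to the encoding, \<open>X\<close> is a set of one dimension less times the point d,
  and that point has the value e(d).\<close>

lemma slice_prod:
  assumes X: "D.bd (Suc k) X" and d: "d \<in> div_hull A" "X \<subseteq> {x. x k = d}"
  obtains Y where "D.bd k Y" "fval (Suc k) X = fval k Y \<otimes>\<^bsub>K_df_rat A\<^esub> e_rat A d"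
proof -
  let ?Y = "{x \<in> coords k. x(k := d) \<in> X}"
  have "D.affine k (\<lambda>x. (x(k := d)) i)" if "i < Suc k" for i
    using that d(1) by (cases "i = k") (auto intro: D.affine_intros)
  then have "?Y \<in> D.dset k"
    using D.bd_dset[OF X] by (intro D.dset_preimage[of X "Suc k"]) (auto simp: coords_def)
  moreover obtain \<gamma> where \<gamma>: "\<forall>x\<in>X. \<forall>i<Suc k. - \<gamma> \<le> x i \<and> x i \<le> \<gamma>" using X by (auto simp: D.bd_def)
  have "- \<gamma> \<le> x i \<and> x i \<le> \<gamma>" if "x \<in> ?Y" "i < k" for x i
    using bspec[OF \<gamma>, of "x(k := d)"] that by (auto dest!: spec[of _ i])
  ultimately have Y: "D.bd k ?Y" unfolding D.bd_def by blast
  have "x \<in> X \<longleftrightarrow> x \<in> coords (Suc k) \<and> x(k := 0) \<in> ?Y \<and> x k = d" for x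
    using bd_coords[OF X] d(2) by (auto simp: coords_def fun_upd_idem less_Suc_eq_le Suc_le_eq)
  then have "X = {x \<in> coords (Suc k). x(k := 0) \<in> ?Y \<and> x k = d}" by blast
  then have "fval (Suc k) X = fval k ?Y \<otimes>\<^bsub>K_df_rat A\<^esub> e_rat A d"
    using fval_prod[OF Y point_obj[OF d(1)]] by (simp only: e_rat_val)
  with Y show thesis by (rule that)
qed

text \<open>Each coordinate contributes the factor iota(b_i) - 1 if b_i > 0, and the value of the
  empty set otherwise.\<close>

lemma box_val:
  assumes V: "subring V (K_df_rat A)" and iota: "\<And>a. a \<in> div_hull A \<Longrightarrow> iota_rat A a \<in> V"
    and b: "\<And>i. i < n \<Longrightarrow> b i \<in> div_hull A"
  shows "fval n {x \<in> coords n. \<forall>i<n. 0 < x i \<and> x i < b i} \<in> V"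
  using b
proof (induction n)
  case 0
  have "vec 0 ` {x \<in> coords 0. \<forall>i<0. 0 < x i \<and> x i < b i} = carrier_vec 0"
    by (simp add: vec_image)
  then show ?case using subringE(3)[OF V] by (simp only: val_unit)
next
  case (Suc k)
  let ?B = "\<lambda>n. {x \<in> coords n. \<forall>i<n. 0 < x i \<and> x i < b i}"
  have bd: "D.bd k (?B k)"
  proof -
    have "{x \<in> coords k. \<forall>i\<in>{..<k}. 0 < x i \<and> x i < b i} \<in> D.dset k"
      using Suc.prems
      by (intro D.dset_Ball D.dset_Collect_conj D.dset_less D.affine_intros) auto
    moreover have "\<exists>\<gamma>. \<forall>i<j. b i \<le> \<gamma> \<and> 0 \<le> \<gamma>" for j
    proof (induction j)
      case (Suc j)
      then obtain \<gamma> where "\<forall>i<j. b i \<le> \<gamma> \<and> 0 \<le> \<gamma>" by blast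
      then show ?case
        by (intro exI[of _ "max (max \<gamma> (b j)) 0"]) (auto simp: less_Suc_eq le_max_iff_disj)
    qed simp
    then obtain \<gamma> where \<gamma>: "\<And>i. i < k \<Longrightarrow> b i \<le> \<gamma> \<and> 0 \<le> \<gamma>" by blast
    have "- \<gamma> \<le> x i \<and> x i \<le> \<gamma>" if "x \<in> ?B k" "i < k" for x i
    proof -
      have "0 < x i" "x i < b i" using that by auto
      moreover have "- \<gamma> \<le> 0" using \<gamma>[OF that(2)] by simp
      ultimately show ?thesis using \<gamma>[OF that(2)] by (meson less_imp_le order.trans)
    qed
    ultimately show ?thesis unfolding D.bd_def by (simp add: Ball_def) blast
  qed
  have "?B (Suc k) = {x \<in> coords (Suc k). x(k := 0) \<in> ?B k \<and> (0 < x k \<and> x k < b k)}"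
    by (auto simp: coords_Suc less_Suc_eq)
  then have "fval (Suc k) (?B (Suc k)) =
      fval k (?B k) \<otimes>\<^bsub>K_df_rat A\<^esub> val 1 {x \<in> carrier_vec 1. 0 < x $ 0 \<and> x $ 0 < b k}"
    using fval_prod[OF bd interval_obj(2)[OF A Suc.prems[of k]]] by simp
  moreover have "val 1 {x \<in> carrier_vec 1. 0 < x $ 0 \<and> x $ 0 < b k} \<in> V"
  proof (cases "0 < b k")
    case True
    show ?thesis
      unfolding open_interval_val[OF Suc.prems[of k, OF lessI] True] T.minus_eq
      using Suc.prems[of k] by (intro subringE(7)[OF V] subringE(5)[OF V] subringE(3)[OF V] iota) simp_all
  next
    case False
    then have "{x \<in> carrier_vec 1. 0 < x $ 0 \<and> x $ 0 < b k} = {}" by auto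
    then show ?thesis using subringE(2)[OF V] by (simp only: val_empty)
  qed
  ultimately show ?case using Suc.IH Suc.prems subringE(6)[OF V] by simp
qed

text \<open>Strong induction on the dimension, in which only the slices call on lower dimensions.
  The subalgebra properties of \<open>V\<close> supply the assumptions of
  \<open>scissors_closed\<close>.\<close>

lemma fval_generated:
  assumes V: "subring V (K_df_rat A)" "subalgebra (rat_scalars (K_df A)) V (K_df_rat A)"
    and e: "\<And>a. a \<in> div_hull A \<Longrightarrow> e_rat A a \<in> V"
    and iota: "\<And>a. a \<in> div_hull A \<Longrightarrow> iota_rat A a \<in> V"
  shows "D.bd n X \<Longrightarrow> fval n X \<in> V"
proof (induction n arbitrary: X rule: less_induct)
  case (less n)
  note Vadd = subringE(7)[OF V(1)] and Vneg = subringE(5)[OF V(1)]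
  interpret scissors_closed "div_hull A" n "\<lambda>X. fval n X \<in> V"
  proof
    fix X Y assume XY: "D.bd n X" "D.bd n Y" "X \<inter> Y = {}" and X: "fval n X \<in> V"
    show "fval n Y \<in> V \<Longrightarrow> fval n (X \<union> Y) \<in> V"
      unfolding fval_Un[OF XY] by (rule Vadd[OF X])
    assume XY': "fval n (X \<union> Y) \<in> V"
    have "\<ominus>\<^bsub>K_df_rat A\<^esub> fval n X \<oplus>\<^bsub>K_df_rat A\<^esub> (fval n X \<oplus>\<^bsub>K_df_rat A\<^esub> fval n Y) \<in> V"
      by (rule Vadd[OF Vneg[OF X] XY'[unfolded fval_Un[OF XY]]])
    then show "fval n Y \<in> V"
      using fval_closed[OF XY(1)] fval_closed[OF XY(2)] by (simp add: T.r_neg1)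
  next
    fix T T' :: "(nat \<Rightarrow> 'g) \<Rightarrow> nat \<Rightarrow> 'g" and X
    assume "unimodular n T T'" "D.bd n X" "fval n X \<in> V"
    then show "fval n (T ` X) \<in> V" by (simp only: fval_unimodular)
  next
    fix Z and J :: "nat set" and U U' :: "nat \<Rightarrow> (nat \<Rightarrow> 'g) \<Rightarrow> nat \<Rightarrow> 'g"
    assume Z: "D.bd n Z" and J: "finite J" "J \<noteq> {}" and U: "\<And>j. j \<in> J \<Longrightarrow> unimodular n (U j) (U' j)"
      "disjoint_family_on (\<lambda>j. U j ` Z) J" and V': "fval n (\<Union>j\<in>J. U j ` Z) \<in> V"
    let ?s = "\<lambda>q. pure_tensor (K_df A) q \<one>\<^bsub>K_df A\<^esub>"
    have s: "?s q \<in> carrier (K_df_rat A)" for q by (simp add: R.pure_tensor_closed)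
    \<comment> \<open>Multiplication by the scalar 1 / card J undoes the counting of copies; it is
      defined because \<open>J\<close> is nonempty.\<close>
    have "?s (1 / of_nat (card J)) \<otimes>\<^bsub>K_df_rat A\<^esub> (?s (of_nat (card J)) \<otimes>\<^bsub>K_df_rat A\<^esub> fval n Z) \<in> V"
      using subalgebra.smult_closed[OF V(2) _ V'] fval_copies[OF Z J(1) U] by (simp add: rat_scalars_def)
    moreover have "?s (1 / of_nat (card J)) \<otimes>\<^bsub>K_df_rat A\<^esub> ?s (of_nat (card J)) = \<one>\<^bsub>K_df_rat A\<^esub>"
      using J by (simp add: R.pure_tensor_mult R.pure_tensor_one)
    ultimately show "fval n Z \<in> V"
      using fval_closed[OF Z] s by (simp add: T.m_assoc[symmetric])
  next
    fix X k d assume X: "D.bd n X" "n = Suc k" "d \<in> div_hull A" "X \<subseteq> {x. x k = d}"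
    obtain Y where Y: "D.bd k Y" "fval (Suc k) X = fval k Y \<otimes>\<^bsub>K_df_rat A\<^esub> e_rat A d"
      using slice_prod[of k X d] X by blast
    show "fval n X \<in> V"
      unfolding X(2) Y(2) using X(2) by (intro subringE(6)[OF V(1)] less.IH Y(1) e X(3)) simp
  next
    fix b :: "nat \<Rightarrow> 'g" assume b: "\<And>i. i < n \<Longrightarrow> b i \<in> div_hull A"
    show "fval n {x \<in> coords n. \<forall>i<n. 0 < x i \<and> x i < b i} \<in> V"
      by (rule box_val[OF V(1)]) (simp_all add: iota b)
  qed
  show ?case by (rule good_all[OF less.prems])
qed

end

theorem proposition2p21:
  fixes A :: "'g::doag set"
  assumes "add_subgroup A" and "sufficiently_saturated A"
  shows "algebra_generated (rat_scalars (K_df A)) (K_df_rat A)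
           (e_rat A ` div_hull A \<union> iota_rat A ` div_hull A) = carrier (K_df_rat A)"
proof -
  interpret subgroup_base A by unfold_locales (rule assms(1))
  show ?thesis
  proof
    \<comment> \<open>The whole ring is one of the subalgebras being intersected, which gives the
      inclusion from left to right.\<close>
    have "subgroup (carrier (K_df_rat A)) (add_monoid (K_df_rat A))"
      using T.add.subgroup_self by simp
    moreover have "k \<otimes>\<^bsub>K_df_rat A\<^esub> v \<in> carrier (K_df_rat A)"
      if "k \<in> rat_scalars (K_df A)" "v \<in> carrier (K_df_rat A)" for k v
      using that by (auto simp: rat_scalars_def R.pure_tensor_closed)
    ultimately have "subalgebra (rat_scalars (K_df A)) (carrier (K_df_rat A)) (K_df_rat A)"
      by (simp add: subalgebra_def subalgebra_axioms_def)
    then show "algebra_generated (rat_scalars (K_df A)) (K_df_rat A)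
        (e_rat A ` div_hull A \<union> iota_rat A ` div_hull A) \<subseteq> carrier (K_df_rat A)"
      unfolding algebra_generated_def using T.carrier_is_subring e_rat_closed iota_rat_closed
      by (intro Inter_lower) auto
    show "carrier (K_df_rat A) \<subseteq> algebra_generated (rat_scalars (K_df A)) (K_df_rat A)
        (e_rat A ` div_hull A \<union> iota_rat A ` div_hull A)"
      unfolding algebra_generated_def
    proof (rule Inter_greatest)
      fix V assume "V \<in> {V. subring V (K_df_rat A) \<and> subalgebra (rat_scalars (K_df A)) V (K_df_rat A) \<and>
          e_rat A ` div_hull A \<union> iota_rat A ` div_hull A \<subseteq> V}"
      then have V: "subring V (K_df_rat A)" "subalgebra (rat_scalars (K_df A)) V (K_df_rat A)"
        and gen: "\<And>a. a \<in> div_hull A \<Longrightarrow> e_rat A a \<in> V" "\<And>a. a \<in> div_hull A \<Longrightarrow> iota_rat A a \<in> V" by auto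
      \<comment> \<open>Every bounded object comes from a bounded set of functions, so its value is
        reached by the dissection argument.\<close>
      have "val n X \<in> V" if X: "X \<in> bdd_obj A n" for n X
        using fval_generated[OF V gen] obj_bd[OF X] by metis
      then show "carrier (K_df_rat A) \<subseteq> V" by (rule generated_by_values[OF V])
    qed
  qed
qed

end
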